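(* Let $\mathcal{C}=\mathcal{A}\oplus\mathcal{B}$ be a gluing, where $\mathcal{A}$ and $\mathcal{B}$ are both geometric polytopal $d$-complexes in $X$, with $X$ one of $\mathbb{E}^d$, $\mathbb{S}^d$ or $\mathbb{H}^d$, and suppose $\mathcal{A}\cap\mathcal{B}$ is a union of $m$ disjoint $(d-1)$-dimensional spheres. If $\mathcal{A}$ and $\mathcal{B}$ both satisfy the Gram relation, then $$\chi_\alpha(\mathcal{C})=(2-m)(-1)^{d-1}+\varepsilon^{d/2}\left(1+(-1)^d\right)\alpha_{-1}(\mathcal{C})-m.$$
   Context: $d$-polytopes in $\mathbb{E}^d$ (Euclidean) or $\mathbb{H}^d$ (hyperbolic) are bounded full-dimensional intersections of finitely many closed half-spaces; spherical $d$-polytopes are intersections of the unit sphere $\mathbb{S}^d\subset\mathbb{R}^{d+1}$ with full-dimensional pointed polyhedral cones with apex at the origin. A geometric polytopal $d$-complex in $X$ is a finite connected collection of such polytopes in $X$ (all of the same geometry), closed under taking faces, any two meeting in a face of both, with all maximal cells of dimension $d$. $|\mathcal{C}|$ is the union of cells, $\mathrm{int}(\mathcal{C})$ its interior, $\partial\mathcal{C}$ the complex of boundary faces. For a nonempty $F\in\partial\mathcal{C}$, $\alpha(F,\mathcal{C})$ is the fraction of a sufficiently small intrinsic $(d-1)$-sphere centered at a relative interior point of $F$ lying in $\mathrm{int}(\mathcal{C})$; $\alpha_i(\mathcal{C})=\sum\alpha(F,\mathcal{C})$ over $i$-faces $F$ of $\partial\mathcal{C}$, $0\le i\le d-1$,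 and $\chi_\alpha(\mathcal{C})=\sum_{i=0}^{d-1}(-1)^i\alpha_i(\mathcal{C})$. The normalized volume is $\alpha_{-1}(\mathcal{C})=\mathrm{vol}_d(|\mathcal{C}|)/\mathrm{vol}_d(\mathbb{S}^d)$ for spherical or hyperbolic $\mathcal{C}$ (curvature $\pm1$), and $\alpha_{-1}(\mathcal{C})=0$ for Euclidean $\mathcal{C}$. The curvature indicator is $\varepsilon=1,0,-1$ for $X=\mathbb{S}^d,\mathbb{E}^d,\mathbb{H}^d$ respectively; when $d$ is odd the term $\varepsilon^{d/2}(1+(-1)^d)\alpha_{-1}$ is understood to be $0$. A complex $\mathcal{C}$ satisfies the Gram relation if $\chi_\alpha(\mathcal{C})=(-1)^{d-1}+\varepsilon^{d/2}(1+(-1)^d)\alpha_{-1}(\mathcal{C})$. A gluing $\mathcal{C}=\mathcal{A}\oplus\mathcal{B}$ means $\mathcal{C}=\mathcal{A}\cup\mathcal{B}$ where $\mathcal{A},\mathcal{B}$ meet exactly along a common subcomplex $\mathcal{A}\cap\mathcal{B}$ contained in both $\partial\mathcal{A}$ and $\partial\mathcal{B}$.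
   Formalization: The formal theorem additionally assumes that the union of the gluing spheres |A∩B| lies in the interior of C; without this the claim fails, e.g. for a planar ring with a wedge removed at a vertex of the gluing circle. *)

theory Defs
  imports "HOL-Analysis.Analysis"
begin

text \<open>
  All three geometries of dimension \<open>d = DIM('a)\<close> (so \<open>d \<ge> 1\<close>) are realised in the \<open>d + 1\<close> dimensional
  space \<open>'a \<times> real\<close>: Euclidean space as the hyperplane at height 1, the unit sphere, and
  the upper sheet of the hyperboloid.  Every ray from the origin meets each model at most once, and
  hyperplanes, geodesics and convex sets of the model are its intersections with linear
  hyperplanes, linear planes and convex cones.
\<close>

datatype geometry = Euclidean | Spherical | Hyperbolic

definition lorentz :: "'a::euclidean_space \<times> real \<Rightarrow> 'a \<times> real \<Rightarrow> real" where
  "lorentz p q = fst p \<bullet> fst q - snd p * snd q"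

fun model_space :: "geometry \<Rightarrow> ('a::euclidean_space \<times> real) set" where
  "model_space Euclidean = {p. snd p = 1}"
| "model_space Spherical = sphere 0 1"
| "model_space Hyperbolic = {p. lorentz p p = -1 \<and> snd p > 0}"

fun curvature :: "geometry \<Rightarrow> real" where
  "curvature Euclidean = 0"
| "curvature Spherical = 1"
| "curvature Hyperbolic = -1"


subsection \<open>Polytopes and their faces\<close>

fun half_space :: "geometry \<Rightarrow> ('a::euclidean_space \<times> real) set \<Rightarrow> bool" where
  "half_space Euclidean H \<longleftrightarrow>
     (\<exists>a b. a \<noteq> 0 \<and> H = {p \<in> model_space Euclidean. a \<bullet> fst p \<le> b})"
| "half_space Spherical H \<longleftrightarrow>
     (\<exists>n. n \<noteq> 0 \<and> H = {p \<in> model_space Spherical. n \<bullet> p \<le> 0})"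
  \<comment> \<open>the hyperplane orthogonal to \<open>n\<close> meets the hyperboloid iff \<open>n\<close> is spacelike\<close>
| "half_space Hyperbolic H \<longleftrightarrow>
     (\<exists>n. lorentz n n > 0 \<and> H = {p \<in> model_space Hyperbolic. lorentz n p \<le> 0})"

text \<open>
  On the hyperboloid \<open>snd p\<close> is the hyperbolic cosine of the distance of \<open>p\<close> from \<open>(0, 1)\<close>,
  so boundedness in the ambient space and for the intrinsic distance agree.
\<close>

definition full_polytope :: "geometry \<Rightarrow> ('a::euclidean_space \<times> real) set \<Rightarrow> bool" where
  "full_polytope X P \<longleftrightarrow>
     (if X = Spherical
      then \<exists>K. polyhedron K \<and> conic K \<and> (\<forall>x\<in>K. - x \<in> K \<longrightarrow> x = 0) \<and> interior K \<noteq> {} \<and>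
               P = sphere 0 1 \<inter> K
      else \<exists>\<H>. finite \<H> \<and> (\<forall>H\<in>\<H>. half_space X H) \<and> P = model_space X \<inter> \<Inter>\<H> \<and>
               bounded P \<and> top_of_set (model_space X) interior_of P \<noteq> {})"

text \<open>
  Faces, including the empty one and \<open>P\<close> itself, correspond to faces of the cone over \<open>P\<close>
  (\<open>conic hull {}\<close> is empty).
\<close>

definition geo_face :: "geometry \<Rightarrow> ('a::euclidean_space \<times> real) set \<Rightarrow> ('a \<times> real) set \<Rightarrow> bool" where
  "geo_face X F P \<longleftrightarrow> F \<subseteq> model_space X \<and> (conic hull F) face_of (conic hull P)"

text \<open>The linear span of an \<open>i\<close>-dimensional cell has dimension \<open>i + 1\<close>; the empty cell has dimension \<open>-1\<close>.\<close>

definition cell_dim :: "('a::euclidean_space \<times> real) set \<Rightarrow> int" where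
  "cell_dim F = int (dim F) - 1"

definition cell_rel_interior :: "geometry \<Rightarrow> ('a::euclidean_space \<times> real) set \<Rightarrow> ('a \<times> real) set" where
  "cell_rel_interior X F = top_of_set (model_space X \<inter> span F) interior_of F"


subsection \<open>Geometric polytopal complexes\<close>

definition geometric_complex :: "geometry \<Rightarrow> ('a::euclidean_space \<times> real) set set \<Rightarrow> bool" where
  "geometric_complex X \<C> \<longleftrightarrow>
     finite \<C> \<and> \<C> \<noteq> {} \<and> connected (\<Union>\<C>) \<and>
     (\<forall>P\<in>\<C>. \<forall>F. geo_face X F P \<longrightarrow> F \<in> \<C>) \<and>
     (\<forall>P\<in>\<C>. \<forall>Q\<in>\<C>. geo_face X (P \<inter> Q) P \<and> geo_face X (P \<inter> Q) Q) \<and>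
     (\<forall>P\<in>\<C>. (\<forall>Q\<in>\<C>. P \<subseteq> Q \<longrightarrow> Q = P) \<longrightarrow> full_polytope X P)"

definition complex_interior :: "geometry \<Rightarrow> ('a::euclidean_space \<times> real) set set \<Rightarrow> ('a \<times> real) set" where
  "complex_interior X \<C> = top_of_set (model_space X) interior_of \<Union>\<C>"

definition complex_boundary :: "geometry \<Rightarrow> ('a::euclidean_space \<times> real) set set \<Rightarrow> ('a \<times> real) set set" where
  "complex_boundary X \<C> = {F \<in> \<C>. F \<inter> complex_interior X \<C> = {}}"

definition is_gluing ::
  "geometry \<Rightarrow> ('a::euclidean_space \<times> real) set set \<Rightarrow> ('a \<times> real) set set \<Rightarrow> ('a \<times> real) set set \<Rightarrow> bool" where
  "is_gluing X \<C> \<A> \<B> \<longleftrightarrow>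
     \<C> = \<A> \<union> \<B> \<and> \<Union>\<A> \<inter> \<Union>\<B> = \<Union>(\<A> \<inter> \<B>) \<and>
     \<A> \<inter> \<B> \<subseteq> complex_boundary X \<A> \<and> \<A> \<inter> \<B> \<subseteq> complex_boundary X \<B>"

text \<open>The model spheres are the unit spheres of \<open>'a\<close>, of dimension \<open>d - 1\<close>.\<close>

definition union_of_disjoint_spheres :: "nat \<Rightarrow> ('a::euclidean_space \<times> real) set \<Rightarrow> bool" where
  "union_of_disjoint_spheres m M \<longleftrightarrow>
     (\<exists>\<S>. finite \<S> \<and> card \<S> = m \<and> disjoint \<S> \<and> \<Union>\<S> = M \<and>
          (\<forall>S\<in>\<S>. S homeomorphic sphere (0::'a) 1))"


subsection \<open>Surface measure and volume\<close>

definition radial_cone :: "'v::real_vector set \<Rightarrow> 'v set" where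
  "radial_cone S = {s *\<^sub>R q | s q. 0 \<le> s \<and> s \<le> 1 \<and> q \<in> S}"

text \<open>
  The surface measure of \<open>U \<subseteq> sphere 0 1\<close> is \<open>DIM('v)\<close> times the Lebesgue measure of the
  radial cone over \<open>U\<close>; the constant cancels in the normalised measure.
\<close>

definition unit_sphere_fraction :: "'v::euclidean_space set \<Rightarrow> real" where
  "unit_sphere_fraction U =
     measure lborel (radial_cone U) / measure lborel (radial_cone (sphere (0::'v) 1))"

text \<open>
  In coordinates \<open>(s, q) \<mapsto> s *\<^sub>R q\<close> with \<open>q\<close> in one of the models, Lebesgue measure of \<open>'a \<times> real\<close> is
  \<open>s ^ d ds\<close> times the intrinsic volume of the model (on the hyperboloid because
  the Lorentzian metric becomes \<open>s\<^sup>2\<close> times the hyperbolic metric minus \<open>ds\<^sup>2\<close>).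
\<close>

definition geo_volume :: "('a::euclidean_space \<times> real) set \<Rightarrow> real" where
  "geo_volume S = real (DIM('a) + 1) * measure lborel (radial_cone S)"

definition normalized_volume :: "geometry \<Rightarrow> ('a::euclidean_space \<times> real) set set \<Rightarrow> real" where
  "normalized_volume X \<C> =
     (if X = Euclidean then 0
      else geo_volume (\<Union>\<C>) / geo_volume (sphere (0::'a \<times> real) 1))"


subsection \<open>Angles\<close>

fun tangent_vector :: "geometry \<Rightarrow> 'a::euclidean_space \<times> real \<Rightarrow> 'a \<times> real \<Rightarrow> bool" where
  "tangent_vector Euclidean p v \<longleftrightarrow> snd v = 0"
| "tangent_vector Spherical p v \<longleftrightarrow> p \<bullet> v = 0"
| "tangent_vector Hyperbolic p v \<longleftrightarrow> lorentz p v = 0"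

fun metric_form :: "geometry \<Rightarrow> 'a::euclidean_space \<times> real \<Rightarrow> 'a \<times> real \<Rightarrow> real" where
  "metric_form Euclidean v w = v \<bullet> w"
| "metric_form Spherical v w = v \<bullet> w"
| "metric_form Hyperbolic v w = lorentz v w"

definition tangent_frame :: "geometry \<Rightarrow> 'a::euclidean_space \<times> real \<Rightarrow> ('a \<Rightarrow> 'a \<times> real) \<Rightarrow> bool" where
  "tangent_frame X p L \<longleftrightarrow>
     linear L \<and> (\<forall>v. tangent_vector X p (L v)) \<and> (\<forall>v w. metric_form X (L v) (L w) = v \<bullet> w)"

text \<open>The point at distance \<open>r\<close> from \<open>p\<close> on the geodesic with unit initial direction \<open>u\<close>.\<close>

fun geo_exp :: "geometry \<Rightarrow> 'a::euclidean_space \<times> real \<Rightarrow> real \<Rightarrow> 'a \<times> real \<Rightarrow> 'a \<times> real" where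
  "geo_exp Euclidean p r u = p + r *\<^sub>R u"
| "geo_exp Spherical p r u = cos r *\<^sub>R p + sin r *\<^sub>R u"
| "geo_exp Hyperbolic p r u = cosh r *\<^sub>R p + sinh r *\<^sub>R u"

text \<open>
  The fraction of the intrinsic sphere of radius \<open>r\<close> about \<open>p\<close> that lies in \<open>S\<close>.  The isotropy
  group of \<open>p\<close> acts on this sphere as the rotations of the tangent space, so its normalised
  surface measure is the one transported from the unit tangent vectors; the choice of the
  isometry \<open>L\<close> of \<open>'a\<close> onto the tangent space does not matter.
\<close>

definition sphere_fraction ::
  "geometry \<Rightarrow> 'a::euclidean_space \<times> real \<Rightarrow> real \<Rightarrow> ('a \<times> real) set \<Rightarrow> real" where
  "sphere_fraction X p r S =
     (let L = (SOME L. tangent_frame X p L)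
      in unit_sphere_fraction {u \<in> sphere (0::'a) 1. geo_exp X p r (L u) \<in> S})"

text \<open>For small \<open>r\<close> the fraction is constant, and the constant does not depend on the chosen centre.\<close>

definition face_angle ::
  "geometry \<Rightarrow> ('a::euclidean_space \<times> real) set \<Rightarrow> ('a \<times> real) set set \<Rightarrow> real" where
  "face_angle X F \<C> =
     (let p = (SOME p. p \<in> cell_rel_interior X F)
      in THE a. \<forall>\<^sub>F r in at_right 0. sphere_fraction X p r (complex_interior X \<C>) = a)"

definition angle_sum :: "geometry \<Rightarrow> nat \<Rightarrow> ('a::euclidean_space \<times> real) set set \<Rightarrow> real" where
  "angle_sum X i \<C> = (\<Sum>F | F \<in> complex_boundary X \<C> \<and> cell_dim F = int i. face_angle X F \<C>)"

definition angle_char :: "geometry \<Rightarrow> ('a::euclidean_space \<times> real) set set \<Rightarrow> real" where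
  "angle_char X \<C> = (\<Sum>i<DIM('a). (-1) ^ i * angle_sum X i \<C>)"

text \<open>
  \<open>\<epsilon>\<close> to the power \<open>d / 2\<close>; for odd \<open>d\<close> it only occurs in a product with \<open>1 + (-1) ^ d = 0\<close>,
  which is understood to vanish.
\<close>

definition curvature_power :: "geometry \<Rightarrow> nat \<Rightarrow> real" where
  "curvature_power X d = (if even d then curvature X ^ (d div 2) else 0)"

definition gram_relation :: "geometry \<Rightarrow> ('a::euclidean_space \<times> real) set set \<Rightarrow> bool" where
  "gram_relation X \<C> \<longleftrightarrow>
     angle_char X \<C> = (-1) ^ (DIM('a) - 1)
       + curvature_power X DIM('a) * (1 + (-1) ^ DIM('a)) * normalized_volume X \<C>"

end

theory Submission
  imports Defs "HOL-Homology.Homology"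
begin

text \<open>
  Away from \<open>\<A> \<inter> \<B>\<close> the complexes \<open>\<A>\<close> and \<open>\<C>\<close> (or \<open>\<B>\<close> and \<open>\<C>\<close>) have the same boundary faces and
  the same angles there, while a nonempty face of \<open>\<A> \<inter> \<B>\<close> is interior to \<open>\<C>\<close>, so that its angles in
  \<open>\<A>\<close> and \<open>\<B>\<close> add up to 1.  Hence \<open>\<chi>\<^sub>\<alpha>(\<A>) + \<chi>\<^sub>\<alpha>(\<B>) - \<chi>\<^sub>\<alpha>(\<C>)\<close> is the alternating sum of the numbers of
  faces of \<open>\<A> \<inter> \<B>\<close>.  This is a topological invariant of the underlying space: attaching a closed
  \<open>k\<close>-cell along its boundary sphere changes the alternating sum of the ranks of the singular
  homology groups by \<open>(-1)\<^sup>k\<close>.  For \<open>m\<close> disjoint spheres of dimension \<open>d - 1\<close> it equals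
  \<open>m (1 - (-1)\<^sup>d)\<close>.  The volume is additive because \<open>|\<A>| \<inter> |\<B>|\<close> lies in finitely many hyperplanes.
\<close>

section \<open>Ranks of abelian groups\<close>

text \<open>The spheres of the hypothesis are given only up to homeomorphism, and nothing is known
  about how \<open>\<A> \<inter> \<B>\<close> subdivides them, so their faces cannot be counted
  directly; this is why homology enters. Ranks suit the purpose because the alternating sum of ranks
  along a long exact sequence telescopes. The three geometries are treated at once by passing from a
  cell to the cone over it in the ambient linear space: half-spaces become linear half-spaces, faces
  become faces of convex cones, and a suitable hyperplane section of the cone is a convex body
  homeomorphic to the cell. An angle is defined by choosing a centre and a frame and by picking the
  value that is attained for all small radii. That such a value exists rests on sign vectors:
  finitely many linear forms decide membership in a complex, and for small radii their signs depend
  only on the direction. Each sphere contributes \<open>1 - (-1) ^ d\<close>, that is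
  \<open>1 + (-1) ^ (d - 1)\<close>. Subtracting \<open>m\<close> of these from the sum of the two
  Gram relations produces both the factor \<open>2 - m\<close> and the isolated
  \<open>- m\<close>.\<close>

primrec comb :: "('a,'b) monoid_scheme \<Rightarrow> (nat \<Rightarrow> 'a) \<Rightarrow> (nat \<Rightarrow> int) \<Rightarrow> nat \<Rightarrow> 'a" where
  "comb G x c 0 = \<one>\<^bsub>G\<^esub>"
| "comb G x c (Suc n) = comb G x c n \<otimes>\<^bsub>G\<^esub> x n [^]\<^bsub>G\<^esub> c n"

definition indep :: "('a,'b) monoid_scheme \<Rightarrow> 'a set \<Rightarrow> (nat \<Rightarrow> 'a) \<Rightarrow> nat \<Rightarrow> bool" where
  "indep G K x n \<longleftrightarrow> (\<forall>i<n. x i \<in> K) \<and> (\<forall>c. comb G x c n = \<one>\<^bsub>G\<^esub> \<longrightarrow> (\<forall>i<n. c i = 0))"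

text \<open>The torsion-free rank, that is, the dimension after tensoring with the rationals, which
  makes it additive on exact sequences even in the presence of torsion. It is a predicate because
  the rank may be infinite; excluding size \<open>Suc r\<close> suffices since independent families
  can be truncated.\<close>

definition has_rank :: "('a,'b) monoid_scheme \<Rightarrow> 'a set \<Rightarrow> nat \<Rightarrow> bool" where
  "has_rank G K r \<longleftrightarrow> (\<exists>x. indep G K x r) \<and> (\<nexists>x. indep G K x (Suc r))"

lemma comb_cong:
  "(\<And>i. i < n \<Longrightarrow> x i = y i) \<Longrightarrow> (\<And>i. i < n \<Longrightarrow> c i = d i) \<Longrightarrow> comb G x c n = comb G y d n"
  by (induction n) auto

text \<open>Gaussian elimination without division. The last equation eliminates an unknown
  \<open>k\<close> with nonzero coefficient; multiplying the other unknowns by this pivot makes the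
  value forced on \<open>k\<close> an integer.\<close>

lemma int_linear_system_nontrivial_solution:
  fixes C :: "nat \<Rightarrow> 'j \<Rightarrow> int"
  assumes "finite J" "m < card J"
  shows "\<exists>e. (\<exists>j\<in>J. e j \<noteq> 0) \<and> (\<forall>i<m. (\<Sum>j\<in>J. C i j * e j) = 0)"
  using assms
proof (induction m arbitrary: J C)
  case 0
  then obtain j where "j \<in> J"
    by fastforce
  then show ?case
    by (intro exI[of _ "\<lambda>_. 1"]) auto
next
  case (Suc m)
  show ?case
  proof (cases "\<forall>j\<in>J. C m j = 0")
    case True
    obtain e where "\<exists>j\<in>J. e j \<noteq> 0" "\<forall>i<m. (\<Sum>j\<in>J. C i j * e j) = 0"
      using Suc.IH[of J C] Suc.prems by auto
    with True show ?thesis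
      by (intro exI[of _ e]) (auto simp: less_Suc_eq)
  next
    case False
    then obtain k where k: "k \<in> J" "C m k \<noteq> 0"
      by auto
    let ?J = "J - {k}" and ?t = "C m k"
    have "m < card ?J"
      using Suc.prems k by simp
    then obtain e where e: "\<exists>j\<in>?J. e j \<noteq> 0"
      "\<And>i. i < m \<Longrightarrow> (\<Sum>j\<in>?J. (?t * C i j - C i k * C m j) * e j) = 0"
      using Suc.IH[of ?J "\<lambda>i j. ?t * C i j - C i k * C m j"] Suc.prems(1) by auto
    define e' where "e' = (\<lambda>j. if j = k then - (\<Sum>j\<in>?J. C m j * e j) else ?t * e j)"
    have split: "(\<Sum>j\<in>J. C i j * e' j) =
        (\<Sum>j\<in>?J. ?t * C i j * e j) - C i k * (\<Sum>j\<in>?J. C m j * e j)" for i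
    proof -
      have "(\<Sum>j\<in>J. C i j * e' j) = C i k * e' k + (\<Sum>j\<in>?J. C i j * e' j)"
        using Suc.prems(1) k(1) by (simp add: sum.remove)
      also have "(\<Sum>j\<in>?J. C i j * e' j) = (\<Sum>j\<in>?J. ?t * C i j * e j)"
        by (intro sum.cong) (auto simp: e'_def)
      finally show ?thesis
        by (simp add: e'_def)
    qed
    have "(\<Sum>j\<in>J. C i j * e' j) = 0" if "i < m" for i
      using e(2)[OF that] unfolding split
      by (simp add: algebra_simps sum_subtractf sum_distrib_left)
    moreover have "(\<Sum>j\<in>J. C m j * e' j) = 0"
      unfolding split by (simp add: sum_distrib_left algebra_simps)
    moreover have "\<exists>j\<in>J. e' j \<noteq> 0"
      using e(1) k by (auto simp: e'_def)
    ultimately show ?thesis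
      by (intro exI[of _ e']) (auto simp: less_Suc_eq)
  qed
qed

section \<open>Integer combinations and rank-nullity in a commutative group\<close>

context comm_group
begin

lemma comb_closed: "(\<And>i. i < n \<Longrightarrow> x i \<in> carrier G) \<Longrightarrow> comb G x c n \<in> carrier G"
  by (induction n) auto

lemma comb_in_subgroup:
  "subgroup K G \<Longrightarrow> (\<And>i. i < n \<Longrightarrow> x i \<in> K) \<Longrightarrow> comb G x c n \<in> K"
  by (induction n) (auto simp: subgroup.one_closed subgroup.m_closed subgroup_int_pow_closed)

lemma comb_add:
  "(\<And>i. i < n \<Longrightarrow> x i \<in> carrier G) \<Longrightarrow>
   comb G x (\<lambda>i. c i + d i) n = comb G x c n \<otimes> comb G x d n"
proof (induction n)
  case (Suc n)
  then have "comb G x c n \<in> carrier G" "comb G x d n \<in> carrier G"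
    by (auto intro!: comb_closed)
  with Suc show ?case
    by (simp add: int_pow_mult m_ac)
qed simp

lemma comb_mult:
  "(\<And>i. i < n \<Longrightarrow> x i \<in> carrier G) \<Longrightarrow> comb G x (\<lambda>i. c i * k) n = comb G x c n [^] (k::int)"
proof (induction n)
  case (Suc n)
  then have "comb G x c n \<in> carrier G"
    by (auto intro!: comb_closed)
  with Suc show ?case
    by (simp add: int_pow_distrib int_pow_pow)
qed simp

lemma comb_zero: "(\<And>i. i < n \<Longrightarrow> x i \<in> carrier G) \<Longrightarrow> (\<And>i. i < n \<Longrightarrow> c i = 0) \<Longrightarrow> comb G x c n = \<one>"
  by (induction n) auto

lemma comb_append:
  assumes "\<And>i. i < n + m \<Longrightarrow> x i \<in> carrier G"
  shows "comb G x c (n + m) = comb G x c n \<otimes> comb G (\<lambda>i. x (n + i)) (\<lambda>i. c (n + i)) m"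
  using assms
proof (induction m)
  case 0
  then show ?case
    by (simp add: comb_closed)
next
  case (Suc m)
  then have "comb G x c n \<in> carrier G" "comb G (\<lambda>i. x (n + i)) (\<lambda>i. c (n + i)) m \<in> carrier G"
    by (auto intro!: comb_closed)
  with Suc show ?case
    by (simp add: m_assoc)
qed

lemma comb_comb:
  assumes "\<And>i. i < m \<Longrightarrow> z i \<in> carrier G"
  shows "comb G (\<lambda>j. comb G z (\<lambda>i. C i j) m) e n = comb G z (\<lambda>i. \<Sum>j<n. C i j * e j) m"
proof (induction n)
  case 0
  then show ?case
    using comb_zero[of m z "\<lambda>_. 0"] assms by simp
next
  case (Suc n)
  then show ?case
    using comb_add[OF assms, of m] comb_mult[OF assms, of m] by simp
qed

lemma comb_pow:
  assumes "\<And>i. i < n \<Longrightarrow> w i \<in> carrier G"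
  shows "comb G (\<lambda>i. w i [^] (k i::int)) e n = comb G w (\<lambda>i. k i * e i) n"
  using assms by (induction n) (auto simp: int_pow_pow)

lemma comb_hom:
  assumes "comm_group H" "f \<in> hom G H" "\<And>i. i < n \<Longrightarrow> x i \<in> carrier G"
  shows "f (comb G x c n) = comb H (f \<circ> x) c n"
proof -
  interpret H: comm_group H by fact
  interpret f: group_hom G H f
    using assms(2) by unfold_locales
  show ?thesis
    using assms(3) by (induction n) (auto simp: comb_closed f.hom_int_pow)
qed

text \<open>The Steinitz bound over the rationals. Expanding multiples \<open>k j\<close> of the
  \<open>n\<close> elements in the \<open>z i\<close> leaves \<open>m < n\<close> homogeneous
  equations; a nontrivial solution \<open>e\<close> gives the relation with coefficients
  \<open>k j * e j\<close>, which is nontrivial because no \<open>k j\<close> is 0.\<close>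

lemma dependent_if_more_elements:
  assumes z: "\<And>i. i < m \<Longrightarrow> z i \<in> carrier G"
    and span: "\<And>w. w \<in> K \<Longrightarrow> \<exists>k c. k \<noteq> (0::int) \<and> w [^] k = comb G z c m"
    and "K \<subseteq> carrier G" "m < n"
  shows "\<not> indep G K w n"
proof
  assume ind: "indep G K w n"
  then have w: "\<And>i. i < n \<Longrightarrow> w i \<in> K"
    by (auto simp: indep_def)
  have "\<forall>j. \<exists>k c. j < n \<longrightarrow> k \<noteq> (0::int) \<and> w j [^] k = comb G z c m"
    using span w by blast
  then obtain k C where kC: "\<And>j. j < n \<Longrightarrow> k j \<noteq> (0::int)" "\<And>j. j < n \<Longrightarrow> w j [^] k j = comb G z (C j) m"
    by metis
  obtain e where e: "\<exists>j<n. e j \<noteq> 0" "\<forall>i<m. (\<Sum>j<n. C j i * e j) = (0::int)"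
    using int_linear_system_nontrivial_solution[of "{..<n}" m "\<lambda>i j. C j i"] \<open>m < n\<close> by auto
  have "comb G w (\<lambda>j. k j * e j) n = comb G (\<lambda>j. w j [^] k j) e n"
    using w \<open>K \<subseteq> carrier G\<close> by (intro comb_pow[symmetric]) auto
  also have "\<dots> = comb G (\<lambda>j. comb G z (\<lambda>i. C j i) m) e n"
    by (intro comb_cong) (auto simp: kC)
  also have "\<dots> = comb G z (\<lambda>i. \<Sum>j<n. C j i * e j) m"
    using z by (rule comb_comb)
  also have "\<dots> = \<one>"
    using z e(2) by (intro comb_zero) auto
  finally have "comb G w (\<lambda>j. k j * e j) n = \<one>" .
  with ind have "\<forall>j<n. k j * e j = 0"
    unfolding indep_def by blast
  with e(1) kC(1) show False
    by fastforce
qed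

lemma indep_less:
  assumes "indep G K x n" "m \<le> n" "K \<subseteq> carrier G"
  shows "indep G K x m"
  unfolding indep_def
proof safe
  show "x i \<in> K" if "i < m" for i
    using assms that by (auto simp: indep_def)
  fix c i assume c: "comb G x c m = \<one>" "i < m"
  let ?c = "\<lambda>i. if i < m then c i else 0"
  have x: "\<And>i. i < n \<Longrightarrow> x i \<in> carrier G"
    using assms by (auto simp: indep_def)
  have "comb G x ?c (m + (n - m)) = comb G x ?c m \<otimes> comb G (\<lambda>i. x (m + i)) (\<lambda>i. ?c (m + i)) (n - m)"
    using x assms(2) by (intro comb_append) auto
  also have "comb G x ?c m = comb G x c m"
    by (intro comb_cong) auto
  also have "comb G (\<lambda>i. x (m + i)) (\<lambda>i. ?c (m + i)) (n - m) = \<one>"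
    using x by (intro comb_zero) auto
  finally have "comb G x ?c n = \<one>"
    using c assms(2) by simp
  then have "\<forall>i<n. ?c i = 0"
    using assms(1) unfolding indep_def by blast
  with c(2) assms(2) show "c i = 0"
    by (auto split: if_splits)
qed

lemma has_rank_unique:
  assumes "has_rank G K r" "has_rank G K s" "K \<subseteq> carrier G"
  shows "r = s"
  using assms indep_less[OF _ _ assms(3)] unfolding has_rank_def
  by (metis Suc_leI linorder_neqE_nat)

lemma has_rank_bounded:
  assumes "K \<subseteq> carrier G" "\<And>x. \<not> indep G K x N"
  shows "\<exists>r<N. has_rank G K r"
proof -
  define N' where "N' = (LEAST N. \<forall>x. \<not> indep G K x N)"
  have N': "\<forall>x. \<not> indep G K x N'" "N' \<le> N"
    using LeastI[of "\<lambda>N. \<forall>x. \<not> indep G K x N" N] Least_le[of "\<lambda>N. \<forall>x. \<not> indep G K x N" N] assms(2)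
    by (auto simp: N'_def)
  have "indep G K x 0" for x
    by (simp add: indep_def)
  with N' obtain r where r: "N' = Suc r"
    by (metis not0_implies_Suc)
  then have "\<exists>x. indep G K x r"
    using not_less_Least[of r "\<lambda>N. \<forall>x. \<not> indep G K x N"] by (auto simp: N'_def)
  with r N' show ?thesis
    by (auto simp: has_rank_def intro!: exI[of _ r])
qed

lemma has_rank_span:
  assumes "has_rank G K r" "indep G K x r" "y \<in> K" "K \<subseteq> carrier G"
  shows "\<exists>k c. k \<noteq> (0::int) \<and> y [^] k = comb G x c r"
proof -
  let ?x = "\<lambda>i. if i < r then x i else y"
  have x: "\<And>i. i < r \<Longrightarrow> x i \<in> carrier G" and y: "y \<in> carrier G"
    using assms by (auto simp: indep_def)
  have "\<not> indep G K ?x (Suc r)"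
    using assms(1) by (auto simp: has_rank_def)
  moreover have "\<forall>i<Suc r. ?x i \<in> K"
    using assms by (auto simp: indep_def)
  ultimately obtain c i where c: "comb G ?x c (Suc r) = \<one>" "i < Suc r" "c i \<noteq> 0"
    unfolding indep_def by blast
  have "comb G ?x c r = comb G x c r"
    by (intro comb_cong) auto
  with c have *: "comb G x c r \<otimes> y [^] c r = \<one>"
    by simp
  have "c r \<noteq> 0"
  proof
    assume "c r = 0"
    with * have "comb G x c r = \<one>"
      using x by (simp add: comb_closed)
    with assms(2) \<open>c r = 0\<close> c(2,3) show False
      by (auto simp: indep_def less_Suc_eq)
  qed
  moreover have "y [^] (- c r) = comb G x c r"
    using * x y by (metis comb_closed int_pow_closed int_pow_neg inv_equality)
  ultimately show ?thesis
    by (metis neg_equal_0_iff_equal)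
qed

lemma indep_hom_lift:
  assumes "comm_group H" "f \<in> hom G H" "indep H (f ` carrier G) y n"
  obtains x where "indep G (carrier G) x n" "\<And>i. i < n \<Longrightarrow> f (x i) = y i"
proof -
  have "\<forall>i. \<exists>u. i < n \<longrightarrow> u \<in> carrier G \<and> f u = y i"
    using assms(3) unfolding indep_def by (metis imageE)
  then obtain x where x: "\<And>i. i < n \<Longrightarrow> x i \<in> carrier G" "\<And>i. i < n \<Longrightarrow> f (x i) = y i"
    by metis
  interpret group_hom G H f
    using assms(1,2) by (simp add: group_hom_def group_hom_axioms_def comm_group_def)
  have "comb H y c n = \<one>\<^bsub>H\<^esub>" if "comb G x c n = \<one>" for c
  proof -
    have "comb H y c n = comb H (f \<circ> x) c n"
      by (intro comb_cong) (auto simp: x)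
    also have "\<dots> = f (comb G x c n)"
      using x by (intro comb_hom[symmetric] assms)
    finally show ?thesis
      using that by simp
  qed
  with assms(3) x show thesis
    by (intro that[of x]) (auto simp: indep_def)
qed

text \<open>Independent elements of the kernel and lifts of independent elements of the image form
  an independent family of \<open>G\<close>; it is maximal because every element has a nonzero
  multiple in its span.\<close>

theorem rank_nullity:
  assumes H: "comm_group H" and f: "f \<in> hom G H"
    and a: "has_rank G (kernel G H f) a" and b: "has_rank H (f ` carrier G) b"
  shows "has_rank G (carrier G) (a + b)"
proof -
  interpret H: comm_group H by fact
  interpret f: group_hom G H f
    using f by unfold_locales
  have ker: "kernel G H f \<subseteq> carrier G" and fG: "f ` carrier G \<subseteq> carrier H"
    by (auto simp: kernel_def)
  obtain x where x: "indep G (kernel G H f) x a"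
    using a by (auto simp: has_rank_def)
  obtain y where y: "indep H (f ` carrier G) y b"
    using b by (auto simp: has_rank_def)
  obtain y' where y': "indep G (carrier G) y' b" "\<And>i. i < b \<Longrightarrow> f (y' i) = y i"
    using indep_hom_lift[OF H f y] by blast
  define z where "z = (\<lambda>i. if i < a then x i else y' (i - a))"
  have xk: "x i \<in> kernel G H f" if "i < a" for i
    using x that by (auto simp: indep_def)
  then have xc: "x i \<in> carrier G" if "i < a" for i
    using that ker by auto
  have yc: "y' i \<in> carrier G" if "i < b" for i
    using y' that by (auto simp: indep_def)
  have zc: "z i \<in> carrier G" if "i < a + b" for i
    using that xc yc by (auto simp: z_def)
  have f_comb_x: "f (comb G x c a) = \<one>\<^bsub>H\<^esub>" for c :: "nat \<Rightarrow> int"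
    using comb_in_subgroup[OF f.subgroup_kernel, of a x c] xk by (auto simp: kernel_def)
  have f_comb_y: "f (comb G y' c b) = comb H y c b" for c
  proof -
    have "f (comb G y' c b) = comb H (f \<circ> y') c b"
      using yc by (intro comb_hom H f) auto
    also have "\<dots> = comb H y c b"
      by (intro comb_cong) (auto simp: y')
    finally show ?thesis .
  qed
  have z_split: "comb G z c (a + b) = comb G x c a \<otimes> comb G y' (\<lambda>i. c (a + i)) b" for c
  proof -
    have "comb G z c (a + b) = comb G z c a \<otimes> comb G (\<lambda>i. z (a + i)) (\<lambda>i. c (a + i)) b"
      by (intro comb_append zc)
    also have "comb G z c a = comb G x c a"
      by (intro comb_cong) (auto simp: z_def)
    also have "comb G (\<lambda>i. z (a + i)) (\<lambda>i. c (a + i)) b = comb G y' (\<lambda>i. c (a + i)) b"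
      by (intro comb_cong) (auto simp: z_def)
    finally show ?thesis .
  qed
  have "indep G (carrier G) z (a + b)"
    unfolding indep_def
  proof (intro conjI allI impI)
    show "z i \<in> carrier G" if "i < a + b" for i
      using that by (rule zc)
    fix c i assume c: "comb G z c (a + b) = \<one>" "i < a + b"
    have "\<one>\<^bsub>H\<^esub> = f (comb G x c a \<otimes> comb G y' (\<lambda>i. c (a + i)) b)"
      using c z_split by simp
    also have "\<dots> = comb H y (\<lambda>i. c (a + i)) b"
      using xc yc by (simp add: comb_closed f_comb_x f_comb_y H.comb_closed)
        (metis H.comb_closed H.l_one f_comb_y f.hom_closed comb_closed yc)
    finally have c0: "\<forall>i<b. c (a + i) = 0"
      using y by (auto simp: indep_def)
    then have "comb G y' (\<lambda>i. c (a + i)) b = \<one>"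
      using yc by (intro comb_zero) auto
    with c z_split have "comb G x c a = \<one>"
      using xc by (simp add: comb_closed)
    then have "\<forall>i<a. c i = 0"
      using x by (auto simp: indep_def)
    with c0 c(2) show "c i = 0"
      by (metis add_diff_inverse_nat nat_add_left_cancel_less)
  qed
  moreover have "\<not> indep G (carrier G) w (Suc (a + b))" for w
  proof (rule dependent_if_more_elements[where z = z and m = "a + b"])
    fix w assume w: "w \<in> carrier G"
    obtain k c where k: "k \<noteq> (0::int)" "f w [^]\<^bsub>H\<^esub> k = comb H y c b"
      using H.has_rank_span[OF b y] w fG by blast
    \<comment> \<open>\<open>v\<close> is the error made by expanding a multiple of \<open>w\<close>
      in the lifts alone. It lies in the kernel, where a second multiple is needed to expand it;
      hence the factor \<open>k * l\<close> below.\<close>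
    define v where "v = w [^] k \<otimes> inv (comb G y' c b)"
    have v: "v \<in> carrier G"
      using w yc by (simp add: v_def comb_closed)
    have "f v = \<one>\<^bsub>H\<^esub>"
      using w yc k by (simp add: v_def comb_closed f.hom_int_pow f_comb_y)
        (metis H.r_inv H.int_pow_closed f.hom_closed)
    then have "v \<in> kernel G H f"
      using v by (simp add: kernel_def)
    then obtain l d where l: "l \<noteq> (0::int)" "v [^] l = comb G x d a"
      using has_rank_span[OF a x] ker by blast
    have "w [^] k = v \<otimes> comb G y' c b"
      using w yc by (simp add: v_def comb_closed m_assoc)
    then have "w [^] (k * l) = v [^] l \<otimes> comb G y' c b [^] l"
      using w v yc by (metis comb_closed int_pow_distrib int_pow_pow)
    also have "comb G y' c b [^] l = comb G y' (\<lambda>i. c i * l) b"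
      using yc by (simp add: comb_mult)
    also have "v [^] l \<otimes> comb G y' (\<lambda>i. c i * l) b =
        comb G z (\<lambda>i. if i < a then d i else c (i - a) * l) (a + b)"
      unfolding z_split l by (intro arg_cong2[where f = "(\<otimes>)"] comb_cong) auto
    finally show "\<exists>k c. k \<noteq> (0::int) \<and> w [^] k = comb G z c (a + b)"
      using k l by (metis mult_eq_0_iff)
  qed (auto simp: zc)
  ultimately show ?thesis
    by (auto simp: has_rank_def)
qed

text \<open>Independent families of the kernel are independent in \<open>G\<close>, and those of the
  image lift to \<open>G\<close>, so both ranks are finite. In an exact sequence this splits the
  known ranks into the ranks of the maps.\<close>

lemma rank_nullity_converse:
  assumes H: "comm_group H" and f: "f \<in> hom G H" and r: "has_rank G (carrier G) r"
  obtains a b where "has_rank G (kernel G H f) a" "has_rank H (f ` carrier G) b" "r = a + b"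
proof -
  interpret H: comm_group H by fact
  interpret f: group_hom G H f
    using f by unfold_locales
  have no: "\<not> indep G (carrier G) x (Suc r)" for x
    using r by (auto simp: has_rank_def)
  have "\<not> indep G (kernel G H f) x (Suc r)" for x
    using no[of x] by (auto simp: indep_def kernel_def)
  then obtain a where a: "has_rank G (kernel G H f) a"
    using has_rank_bounded[of "kernel G H f" "Suc r"] by (auto simp: kernel_def)
  have "\<not> indep H (f ` carrier G) y (Suc r)" for y
    using no indep_hom_lift[OF H f] by metis
  then obtain b where b: "has_rank H (f ` carrier G) b"
    using H.has_rank_bounded[of "f ` carrier G" "Suc r"] f.hom_closed by blast
  have "r = a + b"
    using has_rank_unique[OF r rank_nullity[OF H f a b]] by simp
  with a b show thesis
    by (rule that)
qed

lemma has_rank_one: "has_rank G {\<one>} 0"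
  by (auto simp: has_rank_def indep_def)
     (meson int_pow_one lessI one_neq_zero r_one one_closed)

end

lemma has_rank_trivial_group:
  assumes "comm_group G" "trivial_group G"
  shows "has_rank G (carrier G) 0"
  using comm_group.has_rank_one[OF assms(1)] assms(2) by (simp add: trivial_group_def)

lemma has_rank_integer_group: "has_rank integer_group (carrier integer_group) 1"
proof -
  interpret comm_group integer_group
    by (rule abelian_integer_group)
  have pow: "x [^]\<^bsub>integer_group\<^esub> (n::int) = n * x" for x n
    by (simp add: group_int_pow_integer_group)
  have "indep integer_group UNIV (\<lambda>_. 1) 1"
    by (auto simp: indep_def pow)
  moreover have "\<not> indep integer_group UNIV w (Suc 1)" for w
  proof (rule dependent_if_more_elements[where z = "\<lambda>_. 1" and m = 1])
    fix w :: int
    show "\<exists>k c. k \<noteq> (0::int) \<and> w [^]\<^bsub>integer_group\<^esub> k = comb integer_group (\<lambda>_. 1) c 1"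
      by (intro exI[of _ 1] exI[of _ "\<lambda>_. w"]) (auto simp: pow)
  qed auto
  ultimately show ?thesis
    by (auto simp: has_rank_def)
qed

lemma has_rank_iso:
  assumes "comm_group G" "comm_group H" "G \<cong> H" "has_rank G (carrier G) r"
  shows "has_rank H (carrier H) r"
proof -
  interpret G: comm_group G by fact
  interpret H: comm_group H by fact
  obtain f where f: "f \<in> hom G H" "bij_betw f (carrier G) (carrier H)"
    using assms(3) by (auto simp: is_iso_def iso_def)
  interpret f: group_hom G H f
    using f by unfold_locales
  obtain a b where ab: "has_rank G (kernel G H f) a" "has_rank H (f ` carrier G) b" "r = a + b"
    using G.rank_nullity_converse[OF assms(2) f(1) assms(4)] .
  have "kernel G H f = {\<one>\<^bsub>G\<^esub>}"
    using f f.inj_iff_trivial_ker by (simp add: bij_betw_def)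
  then have "a = 0"
    using ab(1) G.has_rank_one G.has_rank_unique[of "{\<one>\<^bsub>G\<^esub>}"] by auto
  with ab f show ?thesis
    by (simp add: bij_betw_def)
qed

section \<open>Euler characteristics of pairs of spaces\<close>

text \<open>The Euler characteristic of the pair \<open>(X, S)\<close>, as a predicate because it
  presupposes finite ranks that vanish in large degrees. Degrees are integers since the boundary map
  leads from degree 0 to degree -1.\<close>

definition has_euler :: "'a topology \<Rightarrow> 'a set \<Rightarrow> int \<Rightarrow> bool" where
  "has_euler X S e \<longleftrightarrow> (\<exists>r N.
     (\<forall>p. has_rank (relative_homology_group p X S) (carrier (relative_homology_group p X S)) (r p)) \<and>
     (\<forall>p\<ge>int N. r p = (0::nat)) \<and> e = (\<Sum>p<N. (-1) ^ p * int (r (int p))))"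

lemma has_eulerI:
  assumes "\<And>p. has_rank (relative_homology_group p X S) (carrier (relative_homology_group p X S)) (r p)"
    and "\<And>p. p \<ge> int N \<Longrightarrow> r p = 0" and "e = (\<Sum>p<N. (-1) ^ p * int (r (int p)))"
  shows "has_euler X S e"
  using assms unfolding has_euler_def by blast

lemma has_eulerE:
  assumes "has_euler X S e"
  obtains r N where "\<And>p. has_rank (relative_homology_group p X S) (carrier (relative_homology_group p X S)) (r p)"
    and "\<And>p n. n \<ge> N \<Longrightarrow> p \<ge> int n \<Longrightarrow> r p = 0"
    and "\<And>n. n \<ge> N \<Longrightarrow> e = (\<Sum>p<n. (-1) ^ p * int (r (int p)))"
proof -
  obtain r N where r: "\<And>p. has_rank (relative_homology_group p X S) (carrier (relative_homology_group p X S)) (r p)"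
    and N: "\<And>p. p \<ge> int N \<Longrightarrow> r p = 0" and e: "e = (\<Sum>p<N. (-1) ^ p * int (r (int p)))"
    using assms unfolding has_euler_def by blast
  have "e = (\<Sum>p<n. (-1) ^ p * int (r (int p)))" if "n \<ge> N" for n
    unfolding e using that by (intro sum.mono_neutral_left) (auto simp: N)
  with r N show thesis
    by (intro that[of r N]) auto
qed

lemma has_euler_unique:
  assumes "has_euler X S e" "has_euler X S e'"
  shows "e = e'"
proof -
  obtain r N where r: "\<And>p. has_rank (relative_homology_group p X S) (carrier (relative_homology_group p X S)) (r p)"
    "\<And>n. n \<ge> N \<Longrightarrow> e = (\<Sum>p<n. (-1) ^ p * int (r (int p)))"
    using assms(1) by (elim has_eulerE) blast
  obtain r' N' where r': "\<And>p. has_rank (relative_homology_group p X S) (carrier (relative_homology_group p X S)) (r' p)"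
    "\<And>n. n \<ge> N' \<Longrightarrow> e' = (\<Sum>p<n. (-1) ^ p * int (r' (int p)))"
    using assms(2) by (elim has_eulerE) blast
  have "r p = r' p" for p
    using comm_group.has_rank_unique[OF abelian_relative_homology_group r(1) r'(1)] by simp
  with r(2)[of "max N N'"] r'(2)[of "max N N'"] show ?thesis
    by simp
qed

lemma has_euler_iso:
  assumes "has_euler X S e" "\<And>p. relative_homology_group p X S \<cong> relative_homology_group p Y T"
  shows "has_euler Y T e"
  using has_rank_iso[OF abelian_relative_homology_group abelian_relative_homology_group assms(2)] assms(1)
  unfolding has_euler_def by blast

lemma has_euler_homotopy_equivalent:
  assumes "X homotopy_equivalent_space Y" "has_euler X {} e"
  shows "has_euler Y {} e"
  using has_euler_iso[OF assms(2)] homotopy_equivalent_space_imp_isomorphic_homology_groups[OF assms(1)] .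

lemma has_euler_homeomorphic:
  assumes "X homeomorphic_space Y" "has_euler X {} e"
  shows "has_euler Y {} e"
  using assms has_euler_homotopy_equivalent homeomorphic_imp_homotopy_equivalent_space by blast

text \<open>In the long exact sequence of a pair, \<open>a\<close>, \<open>b\<close> and
  \<open>c\<close> are the ranks of the boundary map, of the map induced by inclusion and of the map
  to relative homology. Each rank is shared by two neighbouring groups. The terms in
  \<open>a\<close> telescope; the two assumptions remove the end terms.\<close>

lemma alternating_sum_ranks:
  fixes a b c :: "int \<Rightarrow> nat"
  assumes "a 0 = 0" "\<And>p. p \<ge> int N \<Longrightarrow> a p = 0"
  shows "(\<Sum>p<N. (-1) ^ p * int (b (int p) + c (int p))) =
     (\<Sum>p<N. (-1) ^ p * int (a (int p + 1) + b (int p))) + (\<Sum>p<N. (-1) ^ p * int (c (int p) + a (int p)))"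
proof -
  have "(\<Sum>p<n. (-1) ^ p * int (a (int p + 1) + a (int p))) = - ((-1) ^ n * int (a (int n)))" for n
    using assms(1) by (induction n) (auto simp: algebra_simps)
  from this[of N] have "(\<Sum>p<N. (-1) ^ p * int (a (int p + 1) + a (int p))) = 0"
    using assms(2) by simp
  then show ?thesis
    by (simp add: algebra_simps sum.distrib)
qed

section \<open>The long exact sequence of a pair\<close>

context
  fixes X :: "'a topology" and S :: "'a set" and G K L :: "int \<Rightarrow> 'a chain set monoid"
    and i j d :: "int \<Rightarrow> 'a chain set \<Rightarrow> 'a chain set"
  defines "G \<equiv> \<lambda>p. homology_group p (subtopology X S)" and "K \<equiv> \<lambda>p. homology_group p X"
    and "L \<equiv> \<lambda>p. relative_homology_group p X S"
    and "i \<equiv> \<lambda>p. hom_induced p (subtopology X S) {} X {} id"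
    and "j \<equiv> \<lambda>p. hom_induced p X {} X S id" and "d \<equiv> \<lambda>p. hom_boundary p X S"
begin

private lemma groups: "comm_group (G p)" "comm_group (K p)" "comm_group (L p)"
  by (simp_all add: G_def K_def L_def)

private lemma homs: "i p \<in> hom (G p) (K p)" "j p \<in> hom (K p) (L p)" "d p \<in> hom (L p) (G (p - 1))"
  by (simp_all add: G_def K_def L_def i_def j_def d_def hom_induced_hom hom_boundary_hom)

private lemma exact:
  "kernel (L p) (G (p - 1)) (d p) = j p ` carrier (K p)"
  "kernel (G (p - 1)) (K (p - 1)) (i (p - 1)) = d p ` carrier (L p)"
  "kernel (K p) (L p) (j p) = i p ` carrier (G p)"
  using homology_exactness_axiom_1[of p X S] homology_exactness_axiom_2[of p X S]
    homology_exactness_axiom_3[of p X S]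
  by (simp_all add: G_def K_def L_def i_def j_def d_def)

text \<open>Supplies the lower end of the telescoping sum: the boundary map in degree 0 has values
  in a homology group of negative degree, which is trivial.\<close>

private lemma boundary_rank_0:
  assumes "has_rank (G (- 1)) (d 0 ` carrier (L 0)) n"
  shows "n = 0"
proof -
  have "trivial_group (G (- 1))"
    by (simp add: G_def)
  then have "d 0 ` carrier (L 0) \<subseteq> {\<one>\<^bsub>G (- 1)\<^esub>}"
    using homs(3)[of 0] by (auto simp: hom_def trivial_group_def)
  moreover have "\<one>\<^bsub>G (- 1)\<^esub> \<in> d 0 ` carrier (L 0)"
    using homs(3)[of 0] groups by (metis (no_types, lifting) comm_group_def diff_0 group_def hom_one
        image_eqI monoid.one_closed)
  ultimately have "d 0 ` carrier (L 0) = {\<one>\<^bsub>G (- 1)\<^esub>}"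
    by auto
  with assms show ?thesis
    using comm_group.has_rank_one[OF groups(1)] comm_group.has_rank_unique[OF groups(1)]
      \<open>trivial_group (G (- 1))\<close> by (metis order_refl trivial_group_def)
qed

private lemma euler_pair_aux:
  fixes a b c :: "int \<Rightarrow> nat"
  assumes a: "\<And>p. has_rank (G (p - 1)) (d p ` carrier (L p)) (a p)"
    and "\<And>p. has_rank (G p) (carrier (G p)) (a (p + 1) + b p)"
    and "\<And>p. has_rank (K p) (carrier (K p)) (b p + c p)"
    and "\<And>p. has_rank (L p) (carrier (L p)) (c p + a p)"
    and z: "\<And>p. p \<ge> int N \<Longrightarrow> a p = 0" "\<And>p. p \<ge> int N \<Longrightarrow> b p = 0" "\<And>p. p \<ge> int N \<Longrightarrow> c p = 0"
  shows "\<exists>s t. has_euler (subtopology X S) {} s \<and> has_euler X S t \<and> has_euler X {} (s + t)"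
proof (intro exI conjI)
  show "has_euler (subtopology X S) {} (\<Sum>p<N. (-1) ^ p * int (a (int p + 1) + b (int p)))"
    by (rule has_eulerI[OF assms(2)[unfolded G_def]]) (auto simp: z)
  show "has_euler X S (\<Sum>p<N. (-1) ^ p * int (c (int p) + a (int p)))"
    by (rule has_eulerI[OF assms(4)[unfolded L_def]]) (auto simp: z)
  have "a 0 = 0"
    using boundary_rank_0 a[of 0] by simp
  then show "has_euler X {} ((\<Sum>p<N. (-1) ^ p * int (a (int p + 1) + b (int p)))
     + (\<Sum>p<N. (-1) ^ p * int (c (int p) + a (int p))))"
    by (intro has_eulerI[OF assms(3)[unfolded K_def], where N = N] alternating_sum_ranks[symmetric])
      (auto simp: z)
qed

text \<open>The ranks of \<open>G\<close> and \<open>K\<close> are split along the maps leaving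
  them. By exactness the outer pieces are the image and the kernel of the boundary map on
  \<open>L\<close>, whose rank then follows from rank-nullity.\<close>

lemma has_euler_relative:
  assumes "has_euler (subtopology X S) {} s" "has_euler X {} x"
  shows "has_euler X S (x - s)"
proof -
  obtain rs Ns where rs: "\<And>p. has_rank (G p) (carrier (G p)) (rs p)" and Ns: "\<And>p. p \<ge> int Ns \<Longrightarrow> rs p = 0"
    using assms(1) unfolding G_def by (elim has_eulerE) blast
  obtain rx Nx where rx: "\<And>p. has_rank (K p) (carrier (K p)) (rx p)" and Nx: "\<And>p. p \<ge> int Nx \<Longrightarrow> rx p = 0"
    using assms(2) unfolding K_def by (elim has_eulerE) blast
  have "\<exists>a b. has_rank (G p) (kernel (G p) (K p) (i p)) a \<and> has_rank (K p) (i p ` carrier (G p)) b \<and>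
      rs p = a + b" for p
    using comm_group.rank_nullity_converse[OF groups(1) groups(2) homs(1) rs] by metis
  then obtain a b where ab: "\<And>p. has_rank (G p) (kernel (G p) (K p) (i p)) (a p)"
    "\<And>p. has_rank (K p) (i p ` carrier (G p)) (b p)" "\<And>p. rs p = a p + b p"
    by metis
  have "\<exists>b c. has_rank (K p) (kernel (K p) (L p) (j p)) b \<and> has_rank (L p) (j p ` carrier (K p)) c \<and>
      rx p = b + c" for p
    using comm_group.rank_nullity_converse[OF groups(2) groups(3) homs(2) rx] by metis
  then obtain b' c where bc: "\<And>p. has_rank (K p) (kernel (K p) (L p) (j p)) (b' p)"
    "\<And>p. has_rank (L p) (j p ` carrier (K p)) (c p)" "\<And>p. rx p = b' p + c p"
    by metis
  have "b' p = b p" for p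
    using bc(1)[of p] ab(2)[of p] comm_group.has_rank_unique[OF groups(2)] unfolding exact
    by (metis (no_types, lifting) exact(3) kernel_def mem_Collect_eq subsetI)
  have da: "has_rank (G (p - 1)) (d p ` carrier (L p)) (a (p - 1))" for p
    using ab(1)[of "p - 1"] by (simp add: exact)
  have "\<exists>s t. has_euler (subtopology X S) {} s \<and> has_euler X S t \<and> has_euler X {} (s + t)"
  \<comment> \<open>The successor in \<open>N\<close> absorbs the degree shift of the boundary map:
    \<open>a (p - 1)\<close> has to vanish as well.\<close>
  proof (rule euler_pair_aux[where a = "\<lambda>p. a (p - 1)" and b = b and c = c and N = "Suc (max Ns Nx)"])
    show "has_rank (G p) (carrier (G p)) (a (p + 1 - 1) + b p)" for p
      using rs[of p] ab(3)[of p] by simp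
    show "has_rank (K p) (carrier (K p)) (b p + c p)" for p
      using rx[of p] bc(3)[of p] \<open>b' p = b p\<close> by simp
    show "has_rank (L p) (carrier (L p)) (c p + a (p - 1))" for p
      using comm_group.rank_nullity[OF groups(3) groups(1) homs(3)] bc(2) da by (simp add: exact)
    show "a (p - 1) = 0" "b p = 0" "c p = 0" if "p \<ge> int (Suc (max Ns Nx))" for p
      using that Ns[of "p - 1"] Ns[of p] Nx[of p] ab(3)[of "p - 1"] ab(3)[of p] bc(3)[of p] by auto
  qed (rule da)
  then obtain s' t where st: "has_euler (subtopology X S) {} s'" "has_euler X S t" "has_euler X {} (s' + t)"
    by blast
  with has_euler_unique[OF assms(1)] has_euler_unique[OF assms(2)] show ?thesis
    by (metis add_diff_cancel_left')
qed

lemma has_euler_total: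
  assumes "has_euler (subtopology X S) {} s" "has_euler X S t"
  shows "has_euler X {} (s + t)"
proof -
  obtain rs Ns where rs: "\<And>p. has_rank (G p) (carrier (G p)) (rs p)" and Ns: "\<And>p. p \<ge> int Ns \<Longrightarrow> rs p = 0"
    using assms(1) unfolding G_def by (elim has_eulerE) blast
  obtain rt Nt where rt: "\<And>p. has_rank (L p) (carrier (L p)) (rt p)" and Nt: "\<And>p. p \<ge> int Nt \<Longrightarrow> rt p = 0"
    using assms(2) unfolding L_def by (elim has_eulerE) blast
  have "\<exists>a b. has_rank (G p) (kernel (G p) (K p) (i p)) a \<and> has_rank (K p) (i p ` carrier (G p)) b \<and>
      rs p = a + b" for p
    using comm_group.rank_nullity_converse[OF groups(1) groups(2) homs(1) rs] by metis
  then obtain a b where ab: "\<And>p. has_rank (G p) (kernel (G p) (K p) (i p)) (a p)"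
    "\<And>p. has_rank (K p) (i p ` carrier (G p)) (b p)" "\<And>p. rs p = a p + b p"
    by metis
  have "\<exists>c a. has_rank (L p) (kernel (L p) (G (p - 1)) (d p)) c \<and>
      has_rank (G (p - 1)) (d p ` carrier (L p)) a \<and> rt p = c + a" for p
    using comm_group.rank_nullity_converse[OF groups(3) groups(1) homs(3) rt] by metis
  then obtain c a' where ca: "\<And>p. has_rank (L p) (kernel (L p) (G (p - 1)) (d p)) (c p)"
    "\<And>p. has_rank (G (p - 1)) (d p ` carrier (L p)) (a' p)" "\<And>p. rt p = c p + a' p"
    by metis
  have aa: "a' (p + 1) = a p" for p
    using ab(1)[of p] ca(2)[of "p + 1"] comm_group.has_rank_unique[OF groups(1)[of p]] exact(2)[of "p + 1"]
    by (metis (no_types, lifting) add_diff_cancel_right' kernel_def mem_Collect_eq subsetI)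
  have "\<exists>s t. has_euler (subtopology X S) {} s \<and> has_euler X S t \<and> has_euler X {} (s + t)"
  proof (rule euler_pair_aux[where a = a' and b = b and c = c and N = "Suc (max Ns Nt)"])
    show "has_rank (G (p - 1)) (d p ` carrier (L p)) (a' p)" for p
      by (rule ca(2))
    show "has_rank (G p) (carrier (G p)) (a' (p + 1) + b p)" for p
      using rs[of p] ab(3)[of p] by (simp add: aa)
    show "has_rank (L p) (carrier (L p)) (c p + a' p)" for p
      using rt[of p] ca(3)[of p] by simp
    show "has_rank (K p) (carrier (K p)) (b p + c p)" for p
      using comm_group.rank_nullity[OF groups(2) groups(3) homs(2)] ab(2) ca(1) by (simp add: exact)
    show "a' p = 0" "b p = 0" "c p = 0" if "p \<ge> int (Suc (max Ns Nt))" for p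
      using that Ns[of p] Nt[of p] ab(3)[of p] ca(3)[of p] by auto
  qed
  then obtain s' t' where st: "has_euler (subtopology X S) {} s'" "has_euler X S t'" "has_euler X {} (s' + t')"
    by blast
  with has_euler_unique[OF assms(1)] has_euler_unique[OF assms(2)] show ?thesis
    by metis
qed

end

section \<open>Euler characteristics of points, spheres and disjoint unions\<close>

lemma has_euler_empty: "topspace X = {} \<Longrightarrow> has_euler X S 0"
  by (rule has_eulerI[where r = "\<lambda>_. 0" and N = 0])
    (auto intro!: has_rank_trivial_group trivial_relative_homology_group_empty)

lemma has_euler_singleton:
  assumes "topspace X = {a}"
  shows "has_euler X {} 1"
proof (rule has_eulerI[where r = "\<lambda>p. if p = 0 then 1 else 0" and N = 1])
  fix p :: int
  have "has_rank (homology_group 0 X) (carrier (homology_group 0 X)) 1"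
    using has_rank_iso[OF abelian_integer_group abelian_relative_homology_group _ has_rank_integer_group]
      group.iso_sym[OF _ homology_coefficients[OF assms]] by simp
  then show "has_rank (homology_group p X) (carrier (homology_group p X)) (if p = 0 then 1 else 0)"
    using homology_dimension_axiom[OF assms] by (auto intro!: has_rank_trivial_group)
qed auto

lemma has_euler_contractible:
  assumes "contractible_space X" "topspace X \<noteq> {}"
  shows "has_euler X {} 1"
proof -
  obtain a where a: "a \<in> topspace X" "X homotopy_equivalent_space (subtopology X {a})"
    using assms unfolding contractible_eq_homotopy_equivalent_singleton_subtopology
    by (metis topspace_discrete_topology)
  have "has_euler (subtopology X {a}) {} 1"
    by (rule has_euler_singleton) (use a in auto)
  moreover have "subtopology X {a} homotopy_equivalent_space X"
    using a(2) homotopy_equivalent_space_sym by blast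
  ultimately show ?thesis
    using has_euler_homotopy_equivalent by blast
qed

text \<open>Homology relative to a point is reduced homology, of rank 1 in degree \<open>n\<close>
  only. Splitting off the point also covers \<open>n = 0\<close>, where both contributions fall in
  the same degree.\<close>

lemma has_euler_nsphere: "has_euler (nsphere n) {} (1 + (-1) ^ n)"
proof -
  obtain a where a: "a \<in> topspace (nsphere n)"
    using in_topspace_nsphere by blast
  have "has_euler (subtopology (nsphere n) {a}) {} 1"
    by (rule has_euler_singleton) (use a in auto)
  moreover have "has_euler (nsphere n) {a} ((-1) ^ n)"
  proof (rule has_eulerI[where r = "\<lambda>p. if p = int n then 1 else 0" and N = "Suc n"])
    fix p :: int
    have iso: "reduced_homology_group p (nsphere n) \<cong> relative_homology_group p (nsphere n) {a}"
      by (rule isomorphic_reduced_homology_by_singleton[OF a])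
    show "has_rank (relative_homology_group p (nsphere n) {a})
       (carrier (relative_homology_group p (nsphere n) {a})) (if p = int n then 1 else 0)"
    proof (cases "p = int n")
      case True
      have "integer_group \<cong> relative_homology_group p (nsphere n) {a}"
        using iso reduced_homology_group_nsphere(1)[of n] True
        by (meson group.iso_sym group_reduced_homology_group iso_trans)
      then show ?thesis
        using has_rank_iso[OF abelian_integer_group abelian_relative_homology_group _ has_rank_integer_group] True
        by auto
    next
      case False
      then have "trivial_group (relative_homology_group p (nsphere n) {a})"
        using iso reduced_homology_group_nsphere(2)[of p n] isomorphic_group_triviality
        by (metis group_reduced_homology_group group_relative_homology_group)
      then show ?thesis
        using False by (auto intro!: has_rank_trivial_group)
    qed
  qed (auto simp: if_distrib cong: if_cong)
  ultimately show ?thesis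
    by (rule has_euler_total)
qed

lemma has_euler_excision:
  assumes "X closure_of U \<subseteq> X interior_of T" "T \<subseteq> topspace X" "has_euler (subtopology X (topspace X - U)) (T - U) e"
  shows "has_euler X T e"
proof (rule has_euler_iso[OF assms(3)])
  show "relative_homology_group p (subtopology X (topspace X - U)) (T - U) \<cong> relative_homology_group p X T" for p
    using homology_excision_axiom[OF assms(1,2), of p] by (auto simp: is_iso_def)
qed

text \<open>\<open>S\<close> is open and closed, so it can be excised from the pair
  \<open>(X, S)\<close>, which leaves \<open>T\<close> relative to the empty set.\<close>

lemma has_euler_disjoint_Un:
  assumes "closedin X S" "closedin X T" "S \<inter> T = {}" "topspace X = S \<union> T"
    and "has_euler (subtopology X S) {} s" "has_euler (subtopology X T) {} t"
  shows "has_euler X {} (s + t)"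
proof -
  have S: "S = topspace X - T" "T = topspace X - S"
    using assms(3,4) by auto
  then have "openin X S"
    by (subst S(1)) (rule openin_diff[OF openin_topspace assms(2)])
  have "has_euler X S t"
  proof (rule has_euler_excision[where U = S])
    show "X closure_of S \<subseteq> X interior_of S"
      using assms(1) \<open>openin X S\<close> by (simp add: closure_of_closedin interior_of_openin)
    show "has_euler (subtopology X (topspace X - S)) (S - S) t"
      using assms(6) by (simp flip: S(2))
  qed (use assms in auto)
  with assms(5) show ?thesis
    by (rule has_euler_total)
qed

text \<open>The sphere has dimension \<open>dim V - 1\<close>, which turns the sign of the usual
  formula around. For \<open>V = {0}\<close> it is empty, in agreement with the value 0; a cell of
  dimension 0 therefore needs no separate treatment.\<close>

lemma has_euler_sphere_subspace:
  fixes V :: "'a::euclidean_space set"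
  assumes "subspace V"
  shows "has_euler (top_of_set (sphere 0 1 \<inter> V)) {} (1 - (-1) ^ dim V)"
proof (cases "dim V = 0")
  case True
  then have "sphere 0 1 \<inter> V = {}"
    by auto
  then have "has_euler (top_of_set (sphere 0 1 \<inter> V)) {} 0"
    by (intro has_euler_empty) simp
  then show ?thesis
    by (simp only: True power_0 diff_self)
next
  case False
  obtain B where B: "B \<subseteq> V" "pairwise orthogonal B" "\<And>x. x \<in> B \<Longrightarrow> norm x = 1" "independent B"
    "card B = dim V" "span B = V"
    using orthonormal_basis_subspace[OF assms] by metis
  obtain f :: "(nat \<Rightarrow> real) \<Rightarrow> 'a" and g where
    "homeomorphic_maps (nsphere (dim V - 1)) (top_of_set (sphere 0 1 \<inter> span B)) f g"
    using homeomorphic_maps_nsphere_euclidean_sphere[OF B(4,2,5) False B(3)] .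
  then have "nsphere (dim V - 1) homeomorphic_space top_of_set (sphere 0 1 \<inter> V)"
    using B(6) homeomorphic_space_def by blast
  then have "has_euler (top_of_set (sphere 0 1 \<inter> V)) {} (1 + (-1) ^ (dim V - 1))"
    using has_euler_homeomorphic has_euler_nsphere by blast
  moreover have "(-1::int) ^ (dim V - 1) = - ((-1) ^ dim V)"
    using False by (cases "dim V") auto
  ultimately show ?thesis
    by simp
qed

section \<open>Attaching cells\<close>

text \<open>Off its centre, the cell is pushed radially outwards onto its boundary sphere, which
  lies in \<open>X\<close>, while \<open>X\<close> stays fixed. The formula for \<open>k\<close> is
  the segment from \<open>g y\<close> to its normalisation, read in the coordinates of the
  ball.\<close>

lemma punctured_cell_homotopy_eqv:
  fixes X F :: "'a::euclidean_space set" and V :: "'b::euclidean_space set"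
  assumes V: "subspace V" and hg: "homeomorphism (cball 0 1 \<inter> V) F h g"
    and "closed X" and XF: "X \<inter> F = h ` (sphere 0 1 \<inter> V)"
  shows "(X \<union> F - {h 0}) homotopy_eqv X"
proof -
  let ?D = "cball 0 1 \<inter> V" and ?N = "X \<union> F - {h 0}"
  have "compact ?D"
    by (simp add: V closed_subspace compact_Int_closed)
  then have "closed F"
    using hg by (metis compact_imp_closed compact_continuous_image homeomorphism_def)
  have h: "continuous_on ?D h" and g: "continuous_on F g"
    and gh: "\<And>x. x \<in> ?D \<Longrightarrow> g (h x) = x" and hgy: "\<And>y. y \<in> F \<Longrightarrow> h (g y) = y"
    and hF: "\<And>x. x \<in> ?D \<Longrightarrow> h x \<in> F" and gD: "\<And>y. y \<in> F \<Longrightarrow> g y \<in> ?D"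
    using hg by (auto simp: homeomorphism_def)
  have 0: "0 \<in> ?D"
    using V by (simp add: subspace_0)
  have g0: "g y \<noteq> 0" if "y \<in> F - {h 0}" for y
    using hgy that by force
  have bd: "norm (g y) = 1" if "y \<in> X \<inter> F" for y
    using that gh unfolding XF by force
  have h0X: "h 0 \<notin> X"
    using bd[of "h 0"] gh[OF 0] hF[OF 0] by force
  define k where "k = (\<lambda>(t::real, y). h ((1 - t) *\<^sub>R g y + (t / norm (g y)) *\<^sub>R g y))"
  define H where "H = (\<lambda>z. if snd z \<in> X then snd z else k z)"
  have kD: "(1 - t) *\<^sub>R g y + (t / norm (g y)) *\<^sub>R g y \<in> ?D - {0}"
    if "t \<in> {0..1}" "y \<in> F - {h 0}" for t y
  proof -
    have n: "0 < norm (g y)" "norm (g y) \<le> 1" "g y \<in> V"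
      using g0[OF that(2)] gD[of y] that by auto
    have *: "(1 - t) *\<^sub>R g y + (t / norm (g y)) *\<^sub>R g y = ((1 - t) + t / norm (g y)) *\<^sub>R g y"
      by (simp add: scaleR_left_distrib)
    have "0 < (1 - t) + t / norm (g y)"
      using that n by (cases "t = 1") (auto intro: add_pos_nonneg)
    moreover have "((1 - t) + t / norm (g y)) * norm (g y) \<le> 1"
    proof -
      have "((1 - t) + t / norm (g y)) * norm (g y) = (1 - t) * norm (g y) + t"
        using n by (simp add: field_simps)
      also have "\<dots> \<le> (1 - t) * 1 + t"
        using n that by (intro add_mono mult_left_mono) auto
      finally show ?thesis
        by simp
    qed
    ultimately show ?thesis
      using n V unfolding * by (auto simp: subspace_scale)
  qed
  have k_in: "k (t, y) \<in> F - {h 0}" if "t \<in> {0..1}" "y \<in> F - {h 0}" for t y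
    using kD[OF that] hF gh[OF 0] gh by (force simp: k_def)
  have k_bd: "k (t, y) = y" if "y \<in> X \<inter> F" for t y
    using bd[OF that] hgy that by (simp add: k_def algebra_simps)
  have k0: "k (0, y) = y" if "y \<in> F" for y
    using hgy that by (simp add: k_def)
  have k1: "k (1, y) \<in> X" if "y \<in> F - {h 0}" for y
  proof -
    have "(1 / norm (g y)) *\<^sub>R g y \<in> sphere 0 1 \<inter> V"
      using g0[OF that] gD[of y] that V by (simp add: subspace_scale)
    then show ?thesis
      using XF by (auto simp: k_def)
  qed
  have cont_k: "continuous_on ({0..1} \<times> (F - {h 0})) k"
  proof -
    have "continuous_on ({0..1} \<times> (F - {h 0})) (\<lambda>z. g (snd z))"
      by (rule continuous_on_compose2[OF g]) (auto intro!: continuous_intros)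
    then have "continuous_on ({0..1} \<times> (F - {h 0}))
        (\<lambda>z. (1 - fst z) *\<^sub>R g (snd z) + (fst z / norm (g (snd z))) *\<^sub>R g (snd z))"
      using g0 by (intro continuous_intros) auto
    then have "continuous_on ({0..1} \<times> (F - {h 0}))
        (\<lambda>z. h ((1 - fst z) *\<^sub>R g (snd z) + (fst z / norm (g (snd z))) *\<^sub>R g (snd z)))"
    proof (rule continuous_on_compose2[OF h])
      show "(\<lambda>z. (1 - fst z) *\<^sub>R g (snd z) + (fst z / norm (g (snd z))) *\<^sub>R g (snd z)) `
          ({0..1} \<times> (F - {h 0})) \<subseteq> ?D"
      proof (rule image_subsetI)
        fix z assume "z \<in> {0..1::real} \<times> (F - {h 0})"
        then show "(1 - fst z) *\<^sub>R g (snd z) + (fst z / norm (g (snd z))) *\<^sub>R g (snd z) \<in> ?D"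
          using kD[of "fst z" "snd z"] by (auto simp: mem_Times_iff)
      qed
    qed
    then show ?thesis
      by (simp add: k_def case_prod_unfold)
  qed
  have N: "{0..1::real} \<times> ?N = ({0..1} \<times> X) \<union> ({0..1} \<times> (F - {h 0}))"
    using h0X by auto
  have cont_H: "continuous_on ({0..1} \<times> ?N) H"
    unfolding N H_def
  proof (rule continuous_on_cases_local)
    have "{0..1::real} \<times> X = (({0..1} \<times> X) \<union> ({0..1} \<times> (F - {h 0}))) \<inter> ({0..1} \<times> X)"
      by auto
    then show "closedin (top_of_set (({0..1::real} \<times> X) \<union> ({0..1} \<times> (F - {h 0})))) ({0..1} \<times> X)"
      using \<open>closed X\<close> by (metis closed_Times closed_atLeastAtMost closedin_closed_Int)
    have "{0..1::real} \<times> (F - {h 0}) = (({0..1} \<times> X) \<union> ({0..1} \<times> (F - {h 0}))) \<inter> ({0..1} \<times> F)"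
      using h0X by auto
    then show "closedin (top_of_set (({0..1::real} \<times> X) \<union> ({0..1} \<times> (F - {h 0})))) ({0..1} \<times> (F - {h 0}))"
      using \<open>closed F\<close> by (metis closed_Times closed_atLeastAtMost closedin_closed_Int)
  qed (use cont_k k_bd in \<open>auto intro!: continuous_intros\<close>)
  have H_in: "H z \<in> ?N" if "z \<in> {0..1} \<times> ?N" for z
    using that k_in[of "fst z" "snd z"] h0X by (auto simp: H_def)
  have H0: "H (0, y) = y" if "y \<in> ?N" for y
    using that k0 by (auto simp: H_def)
  have H1: "H (1, y) \<in> X" if "y \<in> ?N" for y
    using that k1 by (auto simp: H_def)
  have "homotopic_with_canon (\<lambda>x. True) ?N ?N id (\<lambda>y. H (1, y))"
  proof -
    have "homotopic_with_canon (\<lambda>x. True) ?N ?N (\<lambda>y. H (0, y)) (\<lambda>y. H (1, y))"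
      unfolding homotopic_with_def using cont_H H_in
      by (intro exI[of _ H]) auto
    then show ?thesis
      by (rule homotopic_with_eq) (use H0 in auto)
  qed
  moreover have "retraction ?N X (\<lambda>y. H (1, y))"
    unfolding retraction_def
  proof (intro conjI)
    show "continuous_on ?N (\<lambda>y. H (1, y))"
      by (rule continuous_on_compose2[OF cont_H]) (auto intro!: continuous_intros)
  qed (use h0X H1 in \<open>auto simp: H_def\<close>)
  ultimately show ?thesis
    by (rule deformation_retract_imp_homotopy_eqv)
qed

text \<open>Excision needs the closure of the excised set inside the interior of the subspace, so
  \<open>X\<close> is replaced by the homotopy equivalent open subset \<open>?N\<close> of
  \<open>?Y\<close>. Excising \<open>X - F\<close> leaves the pair of the cell and the punctured
  cell, with characteristic 1 minus that of the boundary sphere.\<close>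

lemma has_euler_attach_cell:
  fixes X F :: "'a::euclidean_space set" and V :: "'b::euclidean_space set"
  assumes V: "subspace V" and hg: "homeomorphism (cball 0 1 \<inter> V) F h g"
    and "closed X" and XF: "X \<inter> F = h ` (sphere 0 1 \<inter> V)"
    and X: "has_euler (top_of_set X) {} e"
  shows "has_euler (top_of_set (X \<union> F)) {} (e + (-1) ^ dim V)"
proof -
  let ?D = "cball 0 1 \<inter> V" and ?Y = "X \<union> F"
  let ?N = "?Y - {h 0}"
  have "convex ?D" "compact ?D"
    using V by (auto simp: closed_subspace compact_Int_closed subspace_imp_convex convex_Int)
  have hD: "h ` ?D = F" and h: "continuous_on ?D h"
    and gh: "\<And>x. x \<in> ?D \<Longrightarrow> g (h x) = x" 
    using hg by (auto simp: homeomorphism_def)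
  then have "closed F"
    using \<open>compact ?D\<close> compact_imp_closed compact_continuous_image by metis
  have 0: "0 \<in> ?D"
    using V by (simp add: subspace_0)
  then have h0F: "h 0 \<in> F"
    using hD by blast
  have "h 0 \<notin> h ` (sphere 0 1 \<inter> V)"
    using gh[OF 0] gh by force
  then have h0X: "h 0 \<notin> X"
    using h0F XF by blast
  have N: "has_euler (top_of_set ?N) {} e"
    using has_euler_homotopy_equivalent[OF _ X] punctured_cell_homotopy_eqv[OF V hg \<open>closed X\<close> XF]
      homotopy_equivalent_space_sym by blast
  have sphere: "has_euler (top_of_set (h ` (sphere 0 1 \<inter> V))) {} (1 - (-1) ^ dim V)"
  proof (rule has_euler_homeomorphic)
    have "homeomorphism (sphere 0 1 \<inter> V) (h ` (sphere 0 1 \<inter> V)) h g"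
      by (rule homeomorphism_of_subsets[OF hg]) (use hD in auto)
    then show "top_of_set (sphere 0 1 \<inter> V) homeomorphic_space top_of_set (h ` (sphere 0 1 \<inter> V))"
      using homeomorphic_def by auto
  qed (rule has_euler_sphere_subspace[OF V])
  \<comment> \<open>The same deformation, with the boundary sphere in the role of \<open>X\<close>,
    gives the homotopy type of the punctured cell.\<close>
  have "closed (h ` (sphere 0 1 \<inter> V))"
    using \<open>closed X\<close> \<open>closed F\<close> by (simp flip: XF add: closed_Int)
  moreover have "h ` (sphere 0 1 \<inter> V) \<inter> F = h ` (sphere 0 1 \<inter> V)"
    using hD by auto
  ultimately have "(h ` (sphere 0 1 \<inter> V) \<union> F - {h 0}) homotopy_eqv h ` (sphere 0 1 \<inter> V)"
    by (intro punctured_cell_homotopy_eqv[OF V hg])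
  moreover have "h ` (sphere 0 1 \<inter> V) \<union> F = F"
    using hD by auto
  ultimately have FN: "has_euler (top_of_set (F - {h 0})) {} (1 - (-1) ^ dim V)"
    using has_euler_homotopy_equivalent[OF _ sphere] homotopy_equivalent_space_sym by metis
  have "has_euler (top_of_set ?D) {} 1"
    using \<open>convex ?D\<close> 0 by (intro has_euler_contractible)
      (simp_all add: convex_imp_contractible ex_in_conv[symmetric] del: Int_iff, blast)
  moreover have "top_of_set ?D homeomorphic_space top_of_set F"
    using hg homeomorphic_def by auto
  ultimately have F: "has_euler (top_of_set F) {} 1"
    using has_euler_homeomorphic by blast
  have "has_euler (top_of_set F) (F - {h 0}) (1 - (1 - (-1) ^ dim V))"
    by (rule has_euler_relative[OF _ F]) (use FN in \<open>simp add: subtopology_subtopology Int_absorb1\<close>)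
  then have FF: "has_euler (top_of_set F) (F - {h 0}) ((-1) ^ dim V)"
    by simp
  have "has_euler (top_of_set ?Y) ?N ((-1) ^ dim V)"
  proof (rule has_euler_excision[where U = "X - F"])
    have "top_of_set ?Y closure_of (X - F) \<subseteq> X"
      using \<open>closed X\<close> by (intro closure_of_minimal closed_subset) auto
    also have "\<dots> \<subseteq> ?N"
      using h0X by auto
    also have "\<dots> = top_of_set ?Y interior_of ?N"
      by (rule interior_of_openin[symmetric]) (auto intro!: openin_delete)
    finally show "top_of_set ?Y closure_of (X - F) \<subseteq> top_of_set ?Y interior_of ?N" .
    have "?Y \<inter> (?Y - (X - F)) = F" "?N - (X - F) = F - {h 0}"
      by auto
    then show "has_euler (subtopology (top_of_set ?Y) (topspace (top_of_set ?Y) - (X - F))) (?N - (X - F)) ((-1) ^ dim V)"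
      using FF by (simp add: subtopology_subtopology)
  qed auto
  then show ?thesis
    using N by (intro has_euler_total) (auto simp: subtopology_subtopology Int_absorb1)
qed

text \<open>The cells are attached one by one, by induction over subfamilies closed under passing to
  smaller cells. A maximal cell meets the union of the others exactly in its boundary sphere: the
  intersection with another cell is again a cell, and a proper one by maximality.\<close>

theorem has_euler_cell_complex:
  fixes K :: "'a::euclidean_space set set" and k :: "'a set \<Rightarrow> nat"
  assumes "finite K"
    and cells: "\<And>F. F \<in> K \<Longrightarrow> \<exists>(V::'b::euclidean_space set) h g. subspace V \<and> dim V = k F \<and>
        homeomorphism (cball 0 1 \<inter> V) F h g \<and> h ` (sphere 0 1 \<inter> V) = \<Union>{G \<in> K. G \<subset> F}"
    and inter: "\<And>F G. F \<in> K \<Longrightarrow> G \<in> K \<Longrightarrow> F \<inter> G \<noteq> {} \<Longrightarrow> F \<inter> G \<in> K"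
  shows "has_euler (top_of_set (\<Union>K)) {} (\<Sum>F\<in>K. (-1) ^ k F)"
proof -
  have closed: "closed F" if F: "F \<in> K" for F
  proof -
    obtain V :: "'b set" and h g where "subspace V" "homeomorphism (cball 0 1 \<inter> V) F h g"
      using cells[OF F] by blast
    then show ?thesis
      by (metis closed_subspace compact_Int_closed compact_cball compact_continuous_image
          compact_imp_closed homeomorphism_def)
  qed
  have "has_euler (top_of_set (\<Union>L)) {} (\<Sum>F\<in>L. (-1) ^ k F)"
    if "L \<subseteq> K" "\<And>F G. F \<in> L \<Longrightarrow> G \<in> K \<Longrightarrow> G \<subseteq> F \<Longrightarrow> G \<in> L" for L
    using that
  proof (induction "card L" arbitrary: L)
    case 0
    then have "L = {}"
      using \<open>finite K\<close> finite_subset by fastforce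
    then show ?case
      by (auto intro: has_euler_empty)
  next
    case (Suc n)
    have "finite L" "L \<noteq> {}"
      using Suc \<open>finite K\<close> finite_subset by auto
    then obtain F where F: "F \<in> L" "\<And>G. G \<in> L \<Longrightarrow> F \<subseteq> G \<Longrightarrow> G = F"
      using finite_has_maximal[of L] by metis
    let ?X = "\<Union>(L - {F})"
    obtain V :: "'b set" and h g where V: "subspace V" "dim V = k F"
      "homeomorphism (cball 0 1 \<inter> V) F h g" "h ` (sphere 0 1 \<inter> V) = \<Union>{G \<in> K. G \<subset> F}"
      using cells[of F] F Suc.prems by blast
    have "has_euler (top_of_set ?X) {} (\<Sum>G\<in>L - {F}. (-1) ^ k G)"
    proof (rule Suc.hyps(1))
      show "n = card (L - {F})" "L - {F} \<subseteq> K"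
        using Suc.hyps(2) Suc.prems(1) F(1) \<open>finite L\<close> by auto
      show "G \<in> L - {F}" if "F' \<in> L - {F}" "G \<in> K" "G \<subseteq> F'" for F' G
        using that F(2)[of F'] Suc.prems(2)[of F' G] by auto
    qed
    moreover have "closed ?X"
      using closed Suc.prems \<open>finite L\<close> by (intro closed_Union) auto
    moreover have "?X \<inter> F = h ` (sphere 0 1 \<inter> V)"
      unfolding V(4)
    proof (intro equalityI subsetI)
      fix x assume "x \<in> ?X \<inter> F"
      then obtain G where x: "x \<in> F" "x \<in> G" "G \<in> L" "G \<noteq> F"
        by blast
      then have "G \<inter> F \<in> K"
        using inter[of G F] F Suc.prems by auto
      moreover have "G \<inter> F \<noteq> F"
        using F(2)[of G] x by auto
      ultimately show "x \<in> \<Union>{G \<in> K. G \<subset> F}"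
        using x by blast
    next
      fix x assume "x \<in> \<Union>{G \<in> K. G \<subset> F}"
      then obtain G where "x \<in> G" "G \<in> K" "G \<subset> F"
        by blast
      then show "x \<in> ?X \<inter> F"
        using Suc.prems(2)[OF F(1), of G] by blast
    qed
    ultimately have "has_euler (top_of_set (?X \<union> F)) {} ((\<Sum>G\<in>L - {F}. (-1) ^ k G) + (-1) ^ dim V)"
      by (intro has_euler_attach_cell[OF V(1,3)])
    moreover have "?X \<union> F = \<Union>L"
      using F by auto
    moreover have "(\<Sum>G\<in>L. (-1) ^ k G) = (\<Sum>G\<in>L - {F}. (-1::int) ^ k G) + (-1) ^ k F"
      using \<open>finite L\<close> F(1) by (simp add: sum.remove)
    ultimately show ?case
      by (simp add: V(2))
  qed
  from this[of K] show ?thesis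
    by auto
qed

text \<open>Compact convex sets of equal dimension are homeomorphic, and by invariance of domain
  such a homeomorphism respects relative interiors, hence also takes the unit sphere to the relative
  frontier.\<close>

lemma compact_convex_cell:
  fixes C :: "'a::euclidean_space set" and F :: "'c::euclidean_space set"
  assumes "compact C" "convex C" "C \<noteq> {}" and fF: "homeomorphism C F f f'"
    and dim: "aff_dim C \<le> DIM('b::euclidean_space)"
  shows "\<exists>(V::'b set) h g. subspace V \<and> int (dim V) = aff_dim C \<and>
     homeomorphism (cball 0 1 \<inter> V) F h g \<and> h ` (sphere 0 1 \<inter> V) = f ` rel_frontier C"
proof -
  define n where "n = nat (aff_dim C)"
  have n: "int n = aff_dim C"
    using \<open>C \<noteq> {}\<close> aff_dim_negative_iff[of C] by (simp add: n_def flip: linorder_not_less)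
  then have "n \<le> dim (UNIV::'b set)"
    using dim by simp
  then obtain V :: "'b set" where V: "subspace V" "dim V = n"
    using choose_subspace_of_subspace[of n UNIV] by auto
  let ?D = "cball 0 1 \<inter> V"
  have D: "compact ?D" "convex ?D"
    using V by (auto simp: closed_subspace compact_Int_closed subspace_imp_convex convex_Int)
  have "(0::'b) \<in> interior (cball 0 1) \<inter> V"
    using V by (simp add: subspace_0)
  then have "interior (cball (0::'b) 1) \<inter> V \<noteq> {}" "V \<inter> interior (cball (0::'b) 1) \<noteq> {}"
    by blast+
  then have "affine hull (V \<inter> cball 0 1) = V" "rel_interior ?D = interior (cball 0 1) \<inter> V"
    using affine_hull_convex_Int_nonempty_interior[of V "cball (0::'b) 1"]
      rel_interior_convex_Int_affine[of "cball (0::'b) 1" V] V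
    by (simp_all add: subspace_imp_affine subspace_imp_convex del: interior_cball)
  then have aff: "affine hull ?D = V" "rel_interior ?D = ball 0 1 \<inter> V"
    by (simp_all add: Int_commute)
  then have "aff_dim ?D = aff_dim C"
    using V n by (metis aff_dim_affine_hull aff_dim_subspace)
  then have "?D homeomorphic C"
    using homeomorphic_convex_compact_sets D assms by blast
  then obtain u v where uv: "homeomorphism ?D C u v"
    using homeomorphic_def by blast
  have u: "continuous_on ?D u" "u ` ?D = C" "inj_on u ?D" and v: "continuous_on C v" "v ` C = ?D" "inj_on v C"
    using uv unfolding homeomorphism_def by (auto intro!: inj_on_inverseI[of _ v u] inj_on_inverseI[of _ u v] simp del: Int_iff)
  have "u ` rel_interior ?D \<subseteq> rel_interior C"
    using continuous_image_subset_rel_interior[OF u(1,3), of C] u(2) \<open>aff_dim ?D = aff_dim C\<close> by simp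
  moreover have "v ` rel_interior C \<subseteq> rel_interior ?D"
    using continuous_image_subset_rel_interior[OF v(1,3), of ?D] v(2) \<open>aff_dim ?D = aff_dim C\<close> by simp
  ultimately have "u ` rel_interior ?D = rel_interior C"
    using uv rel_interior_subset[of C] unfolding homeomorphism_def by force
  then have "u ` (?D - rel_interior ?D) = C - rel_interior C"
    using u(2) inj_on_image_set_diff[OF u(3) Diff_subset rel_interior_subset] by simp
  moreover have "?D - rel_interior ?D = sphere 0 1 \<inter> V"
    unfolding aff by auto
  ultimately have "u ` (sphere 0 1 \<inter> V) = rel_frontier C"
    using \<open>compact C\<close> by (simp add: rel_frontier_def compact_imp_closed)
  then have "(f \<circ> u) ` (sphere 0 1 \<inter> V) = f ` rel_frontier C"
    by (metis image_comp)
  moreover have "homeomorphism ?D F (f \<circ> u) (v \<circ> f')"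
    by (rule homeomorphism_compose[OF uv fF])
  ultimately show ?thesis
    using V n by blast
qed

section \<open>The three models and their cells\<close>

text \<open>The union of the open rays from the origin that meet the model. On it,
  \<open>radial_norm\<close> is the positively homogeneous function whose level set 1 is the model,
  so dividing by it is the projection along rays.\<close>

fun model_cone :: "geometry \<Rightarrow> ('a::euclidean_space \<times> real) set" where
  "model_cone Euclidean = {x. snd x > 0}"
| "model_cone Spherical = - {0}"
| "model_cone Hyperbolic = {x. norm (fst x) < snd x}"

fun radial_norm :: "geometry \<Rightarrow> 'a::euclidean_space \<times> real \<Rightarrow> real" where
  "radial_norm Euclidean x = snd x"
| "radial_norm Spherical x = norm x"
| "radial_norm Hyperbolic x = sqrt ((snd x)\<^sup>2 - (norm (fst x))\<^sup>2)"

definition radial_proj :: "geometry \<Rightarrow> 'a::euclidean_space \<times> real \<Rightarrow> 'a \<times> real" where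
  "radial_proj X x = x /\<^sub>R radial_norm X x"

lemma open_model_cone: "open (model_cone X)"
  by (cases X) (auto intro!: open_Collect_less continuous_intros)

lemma radial_norm_pos: "x \<in> model_cone X \<Longrightarrow> radial_norm X x > 0"
  by (cases X) (auto intro!: power_strict_mono)

lemma model_cone_scale: "x \<in> model_cone X \<Longrightarrow> c > 0 \<Longrightarrow> c *\<^sub>R x \<in> model_cone X"
  by (cases X) auto

lemma radial_norm_scale: "x \<in> model_cone X \<Longrightarrow> c > 0 \<Longrightarrow> radial_norm X (c *\<^sub>R x) = c * radial_norm X x"
  by (cases X) (auto simp: power_mult_distrib real_sqrt_mult simp flip: right_diff_distrib)

lemma continuous_on_radial_norm: "continuous_on (model_cone X) (radial_norm X)"
  by (cases X) (auto intro!: continuous_intros)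

lemma model_space_eq: "model_space X = {x \<in> model_cone X. radial_norm X x = 1}"
proof (cases X)
  case Hyperbolic
  have "lorentz p p = - 1 \<and> snd p > 0 \<longleftrightarrow> norm (fst p) < snd p \<and> sqrt ((snd p)\<^sup>2 - (norm (fst p))\<^sup>2) = 1"
    for p :: "'a \<times> real"
  proof -
    have l: "lorentz p p = (norm (fst p))\<^sup>2 - (snd p)\<^sup>2"
      by (simp add: lorentz_def dot_square_norm power2_eq_square[of "snd p"])
    show ?thesis
    proof
      assume p: "lorentz p p = - 1 \<and> snd p > 0"
      then have "norm (fst p) < snd p"
        using l by (intro power2_less_imp_less[of _ "snd p"]) auto
      with p l show "norm (fst p) < snd p \<and> sqrt ((snd p)\<^sup>2 - (norm (fst p))\<^sup>2) = 1"
        by simp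
    next
      assume p: "norm (fst p) < snd p \<and> sqrt ((snd p)\<^sup>2 - (norm (fst p))\<^sup>2) = 1"
      with norm_ge_zero[of "fst p"] l show "lorentz p p = - 1 \<and> snd p > 0"
        by (simp only: real_sqrt_eq_1_iff) linarith
    qed
  qed
  with Hyperbolic show ?thesis
    by auto
qed auto

lemma model_space_subset_cone: "model_space X \<subseteq> model_cone X"
  by (auto simp: model_space_eq)

lemma zero_notin_model_cone: "0 \<notin> model_cone X"
  by (cases X) auto

lemma zero_notin_model_space: "0 \<notin> model_space X"
  using zero_notin_model_cone model_space_subset_cone by blast

lemma closed_model_space: "closed (model_space X :: ('a::euclidean_space \<times> real) set)"
proof (cases X)
  case Euclidean
  then show ?thesis
    by (auto intro!: closed_Collect_eq continuous_intros)
next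
  case Hyperbolic
  have "model_space X = {p :: 'a \<times> real. lorentz p p = - 1} \<inter> {p. snd p \<ge> 0}"
  proof (intro equalityI subsetI)
    fix p :: "'a \<times> real" assume p: "p \<in> {p. lorentz p p = - 1} \<inter> {p. snd p \<ge> 0}"
    have "snd p \<noteq> 0"
    proof
      assume "snd p = 0"
      with p have "fst p \<bullet> fst p = - 1"
        by (simp add: lorentz_def)
      with inner_ge_zero[of "fst p"] show False
        by linarith
    qed
    with p Hyperbolic show "p \<in> model_space X"
      by simp
  qed (use Hyperbolic in auto)
  also have "closed \<dots>"
    unfolding lorentz_def by (intro closed_Int closed_Collect_eq closed_Collect_le continuous_intros)
  finally show ?thesis .
qed auto

lemma radial_proj_in_model: "x \<in> model_cone X \<Longrightarrow> radial_proj X x \<in> model_space X"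
  using radial_norm_pos[of x X] by (auto simp: radial_proj_def model_space_eq model_cone_scale radial_norm_scale)

lemma radial_proj_scale: "x \<in> model_cone X \<Longrightarrow> c > 0 \<Longrightarrow> radial_proj X (c *\<^sub>R x) = radial_proj X x"
  by (simp add: radial_proj_def radial_norm_scale)

lemma radial_proj_id: "x \<in> model_space X \<Longrightarrow> radial_proj X x = x"
  by (simp add: radial_proj_def model_space_eq)

lemma scale_radial_proj: "x \<in> model_cone X \<Longrightarrow> radial_norm X x *\<^sub>R radial_proj X x = x"
  using radial_norm_pos[of x X] by (simp add: radial_proj_def)

lemma continuous_on_radial_proj: "continuous_on (model_cone X) (radial_proj X)"
proof -
  have "radial_norm X x \<noteq> 0" if "x \<in> model_cone X" for x :: "'a \<times> real"
    using radial_norm_pos[OF that] by simp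
  then show ?thesis
    unfolding radial_proj_def using continuous_on_radial_norm by (intro continuous_intros) auto
qed

lemma conic_hull_iff:
  assumes "F \<subseteq> model_space X" "x \<in> model_cone X"
  shows "x \<in> conic hull F \<longleftrightarrow> radial_proj X x \<in> F"
proof
  assume "x \<in> conic hull F"
  then obtain c y where cy: "x = c *\<^sub>R y" "0 \<le> c" "y \<in> F"
    by (auto simp: conic_hull_explicit)
  then have "c > 0"
    using assms(2) zero_notin_model_cone by (metis order_le_less scaleR_zero_left)
  moreover have "y \<in> model_space X"
    using cy assms(1) by auto
  ultimately have "radial_proj X x = y"
    using cy model_space_subset_cone by (metis radial_proj_id radial_proj_scale subsetD)
  with cy show "radial_proj X x \<in> F"
    by simp
next
  assume "radial_proj X x \<in> F"
  then have "radial_norm X x *\<^sub>R radial_proj X x \<in> conic hull F"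
    using radial_norm_pos[OF assms(2)] by (intro conicD[OF conic_conic_hull] hull_inc) auto
  then show "x \<in> conic hull F"
    using assms(2) by (simp add: scale_radial_proj)
qed

lemma conic_hull_model_cone:
  assumes "F \<subseteq> model_space X" "x \<in> conic hull F" "x \<noteq> 0"
  shows "x \<in> model_cone X"
proof -
  obtain c y where "x = c *\<^sub>R y" "0 \<le> c" "y \<in> F"
    using assms(2) by (auto simp: conic_hull_explicit)
  with assms model_space_subset_cone show ?thesis
    by (metis model_cone_scale order_le_less scaleR_zero_left subsetD)
qed

lemma conic_hull_Int_model: "F \<subseteq> model_space X \<Longrightarrow> conic hull F \<inter> model_space X = F"
  using conic_hull_iff[of F X] radial_proj_id[of _ X] model_space_subset_cone[of X] hull_subset[of F conic]
  by fastforce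

text \<open>The functional \<open>l\<close> makes the cone over the cell pointed in a strong sense:
  the hyperplane where \<open>l\<close> equals 1 cuts it in a compact convex set that meets each of
  its rays once.\<close>

definition geo_cell :: "geometry \<Rightarrow> ('a::euclidean_space \<times> real) set \<Rightarrow> bool" where
  "geo_cell X F \<longleftrightarrow> F \<subseteq> model_space X \<and> convex (conic hull F) \<and> compact F \<and> (\<exists>l. \<forall>x\<in>F. 0 < l \<bullet> x)"

lemma geo_face_cell:
  assumes "geo_cell X P" "geo_face X F P"
  shows "geo_cell X F" "F \<subseteq> P"
proof -
  have P: "P \<subseteq> model_space X" "convex (conic hull P)" "compact P" and F: "F \<subseteq> model_space X"
    and face: "conic hull F face_of conic hull P"
    using assms by (auto simp: geo_cell_def geo_face_def)
  have "0 \<notin> P"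
    using P zero_notin_model_space by blast
  then have "closed (conic hull P)"
    using P closed_conic_hull by blast
  then have "closed (conic hull F)"
    using P face face_of_imp_closed by blast
  moreover have "conic hull F \<subseteq> conic hull P"
    using face face_of_imp_subset by blast
  then show "F \<subseteq> P"
    using conic_hull_Int_model P F by blast
  moreover have "F = P \<inter> conic hull F"
    using \<open>F \<subseteq> P\<close> conic_hull_Int_model[OF F] P hull_subset by blast
  ultimately have "compact F"
    using P by (metis compact_Int_closed)
  moreover have "convex (conic hull F)"
    using face face_of_imp_convex by blast
  ultimately show "geo_cell X F"
    using assms(1) F \<open>F \<subseteq> P\<close> unfolding geo_cell_def by blast
qed

lemma span_conic_hull: "span (conic hull F) = span F"
proof
  show "span (conic hull F) \<subseteq> span F"
    by (intro span_minimal hull_minimal) (auto simp: span_superset)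
  show "span F \<subseteq> span (conic hull F)"
    by (intro span_mono hull_subset)
qed

lemma affine_hull_conic_hull:
  assumes "F \<noteq> {}"
  shows "affine hull (conic hull F) = span F"
  using assms by (subst affine_hull_span_0) (auto simp: hull_inc span_conic_hull)

text \<open>Neighbourhoods pass from the model to the ambient space by preimage under the radial
  projection, and back by intersection. The affine hull of the cone is the span of \<open>F\<close>
  because the cone contains 0.\<close>

lemma cell_rel_interior_iff:
  assumes F: "F \<subseteq> model_space X" "F \<noteq> {}"
  shows "p \<in> cell_rel_interior X F \<longleftrightarrow> p \<in> model_space X \<and> p \<in> rel_interior (conic hull F)"
proof safe
  assume "p \<in> cell_rel_interior X F"
  then obtain T where T: "openin (top_of_set (model_space X \<inter> span F)) T" "p \<in> T" "T \<subseteq> F"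
    by (auto simp: cell_rel_interior_def interior_of_def)
  then obtain O' where O': "open O'" "T = model_space X \<inter> span F \<inter> O'"
    by (auto simp: openin_open)
  then show pM: "p \<in> model_space X"
    using T by auto
  let ?O = "model_cone X \<inter> radial_proj X -` O'"
  have "open ?O"
    using continuous_on_radial_proj open_model_cone O'(1) by (rule continuous_open_preimage)
  moreover have "p \<in> ?O"
    using T(2) O'(2) model_space_subset_cone radial_proj_id[OF pM] by auto
  moreover have "?O \<inter> span F \<subseteq> conic hull F"
  proof
    fix x assume x: "x \<in> ?O \<inter> span F"
    then have "radial_proj X x \<in> model_space X \<inter> span F \<inter> O'"
      using radial_proj_in_model[of x X] span_scale[of x F] unfolding radial_proj_def by blast
    with x T O' show "x \<in> conic hull F"
      using conic_hull_iff[OF F(1)] by blast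
  qed
  moreover have "p \<in> conic hull F"
    using T by (meson hull_inc subsetD)
  ultimately show "p \<in> rel_interior (conic hull F)"
    unfolding mem_rel_interior affine_hull_conic_hull[OF F(2)] by blast
next
  assume p: "p \<in> model_space X" "p \<in> rel_interior (conic hull F)"
  then obtain T where T: "open T" "p \<in> T" "T \<inter> span F \<subseteq> conic hull F"
    unfolding mem_rel_interior affine_hull_conic_hull[OF F(2)] by blast
  have "openin (top_of_set (model_space X \<inter> span F)) (model_space X \<inter> span F \<inter> T)"
    using T by (simp add: openin_open_Int)
  moreover have "p \<in> span F"
    using p rel_interior_subset affine_hull_conic_hull[OF F(2)] by (metis hull_subset subsetD)
  moreover have "model_space X \<inter> span F \<inter> T \<subseteq> F"
    using T conic_hull_Int_model[OF F(1)] by blast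
  ultimately show "p \<in> cell_rel_interior X F"
    using p T unfolding cell_rel_interior_def interior_of_def by blast
qed

lemma subset_face_if_rel_interior:
  assumes "geo_cell X F" "F \<noteq> {}" "geo_face X G F" "p \<in> G" "p \<in> cell_rel_interior X F"
  shows "G = F"
proof -
  have F: "F \<subseteq> model_space X" and G: "G \<subseteq> model_space X" and face: "conic hull G face_of conic hull F"
    using assms by (auto simp: geo_cell_def geo_face_def)
  have "p \<in> rel_interior (conic hull F)"
    using assms(5) cell_rel_interior_iff[OF F assms(2)] by simp
  then have "conic hull F \<subseteq> conic hull G"
    using assms(4) by (intro subset_of_face_of[OF face]) (auto intro: hull_inc)
  then have "F \<subseteq> G"
    using conic_hull_Int_model F G by blast
  with geo_face_cell(2)[OF assms(1,3)] show ?thesis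
    by auto
qed

text \<open>A hyperplane supporting the cone at \<open>x\<close> passes through the origin, since 0
  and twice \<open>x\<close> belong to the cone. It therefore cuts out a cone again, namely the one
  over a face of the cell. This identifies the boundary of a cell with the union of its proper
  faces.\<close>

lemma ex_proper_face:
  assumes F: "geo_cell X F" "x \<in> F" "x \<notin> cell_rel_interior X F"
  shows "\<exists>G. geo_face X G F \<and> G \<noteq> F \<and> x \<in> G"
proof -
  let ?C = "conic hull F"
  have M: "F \<subseteq> model_space X" and "convex ?C" "F \<noteq> {}"
    using F by (auto simp: geo_cell_def)
  have x: "x \<in> ?C" "x \<notin> rel_interior ?C"
    using F cell_rel_interior_iff[OF M \<open>F \<noteq> {}\<close>] M by (auto intro: hull_inc)
  obtain a where a: "\<And>y. y \<in> ?C \<Longrightarrow> a \<bullet> x \<le> a \<bullet> y" "\<And>y. y \<in> rel_interior ?C \<Longrightarrow> a \<bullet> x < a \<bullet> y"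
    using supporting_hyperplane_rel_boundary[OF \<open>convex ?C\<close> x] by metis
  have "a \<bullet> x \<le> 0" "a \<bullet> x \<le> 2 * (a \<bullet> x)"
    using a(1)[of 0] a(1)[of "2 *\<^sub>R x"] x \<open>F \<noteq> {}\<close> conicD[OF conic_conic_hull x(1), of 2] by auto
  then have ax: "a \<bullet> x = 0"
    by simp
  let ?T = "?C \<inter> {y. a \<bullet> y = 0}"
  have face: "?T face_of ?C"
    using a(1) ax by (intro face_of_Int_supporting_hyperplane_ge \<open>convex ?C\<close>) auto
  define G where "G = F \<inter> {y. a \<bullet> y = 0}"
  have "conic hull G = ?T"
  proof
    have "c *\<^sub>R x \<in> ?T" if "x \<in> ?T" "0 \<le> c" for x c
      using that conicD[OF conic_conic_hull, of x F c] by simp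
    then have "conic ?T"
      unfolding conic_def[of ?T] by blast
    then show "conic hull G \<subseteq> ?T"
      by (intro hull_minimal) (use hull_subset[of F conic] in \<open>auto simp: G_def\<close>)
    show "?T \<subseteq> conic hull G"
    proof
      fix y assume y: "y \<in> ?T"
      then obtain c z where cz: "y = c *\<^sub>R z" "0 \<le> c" "z \<in> F"
        by (auto simp: conic_hull_explicit)
      show "y \<in> conic hull G"
      proof (cases "c = 0")
        case True
        have "x \<in> G"
          using F ax by (simp add: G_def)
        then show ?thesis
          using True cz by (auto simp: conic_hull_contains_0)
      next
        case False
        then have "z \<in> G"
          using y cz by (simp add: G_def)
        then show ?thesis
          using cz conicD[OF conic_conic_hull hull_inc] by metis
      qed
    qed
  qed
  then have "geo_face X G F"
    using face M by (auto simp: geo_face_def G_def)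
  moreover obtain y where "y \<in> rel_interior ?C"
    using \<open>convex ?C\<close> \<open>F \<noteq> {}\<close> rel_interior_eq_empty by (metis conic_hull_eq_empty ex_in_conv)
  then have "?T \<noteq> ?C"
  proof -
    have "y \<in> ?C"
      using \<open>y \<in> rel_interior ?C\<close> rel_interior_subset by blast
    moreover have "y \<notin> ?T"
      using a(2)[OF \<open>y \<in> rel_interior ?C\<close>] ax by simp
    ultimately show ?thesis
      by blast
  qed
  then have "G \<noteq> F"
    using \<open>conic hull G = ?T\<close> by auto
  moreover have "x \<in> G"
    using F ax by (simp add: G_def)
  ultimately show ?thesis
    by blast
qed

lemma rel_interior_conic_scale:
  fixes C :: "'a::euclidean_space set"
  assumes "conic C" "x \<in> rel_interior C" "c > 0"
  shows "c *\<^sub>R x \<in> rel_interior C"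
proof -
  have "(*\<^sub>R) c ` C = C"
  proof
    show "(*\<^sub>R) c ` C \<subseteq> C"
      using assms by (auto intro: conicD)
    show "C \<subseteq> (*\<^sub>R) c ` C"
    proof
      fix y assume "y \<in> C"
      then have "inverse c *\<^sub>R y \<in> C"
        using assms by (auto intro: conicD)
      then show "y \<in> (*\<^sub>R) c ` C"
        using assms(3) by (intro image_eqI[of _ _ "inverse c *\<^sub>R y"]) auto
    qed
  qed
  then show ?thesis
    using rel_interior_scaleR[of c C] assms by auto
qed

lemma cell_rel_interior_nonempty:
  assumes "geo_cell X F" "F \<noteq> {}"
  shows "cell_rel_interior X F \<noteq> {}"
proof -
  have M: "F \<subseteq> model_space X" and "convex (conic hull F)"
    using assms by (auto simp: geo_cell_def)
  obtain y where y: "y \<in> conic hull F" "y \<in> rel_interior (conic hull F)"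
    using \<open>convex (conic hull F)\<close> \<open>F \<noteq> {}\<close> rel_interior_eq_empty rel_interior_subset
    by (metis conic_hull_eq_empty ex_in_conv subsetD)
  obtain z where z: "z \<in> F"
    using assms by blast
  have "\<exists>w. w \<noteq> 0 \<and> w \<in> conic hull F \<and> w \<in> rel_interior (conic hull F)"
  proof (cases "y = 0")
    case False
    with y show ?thesis by blast
  next
    \<comment> \<open>The origin has no radial projection; the point halfway between it and a point
      of \<open>F\<close> serves instead.\<close>
    case True
    have "z \<in> closure (conic hull F)"
      using z closure_subset[of "conic hull F"] hull_inc[of z F conic] by blast
    then have *: "z - (1/2) *\<^sub>R (z - y) \<in> rel_interior (conic hull F)"
      using rel_interior_closure_convex_shrink[OF \<open>convex (conic hull F)\<close> y(2), of z "1/2"] by simp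
    have "z \<noteq> 0"
      using z M zero_notin_model_space by blast
    moreover have "z - (1/2) *\<^sub>R (z - y) = (1 - 1/2) *\<^sub>R z"
      unfolding scaleR_left_diff_distrib using True by simp
    ultimately have "z - (1/2) *\<^sub>R (z - y) \<noteq> 0"
      by simp
    with * show ?thesis
      using rel_interior_subset by blast
  qed
  then obtain w where w: "w \<noteq> 0" "w \<in> conic hull F" "w \<in> rel_interior (conic hull F)"
    by blast
  have wU: "w \<in> model_cone X"
    using conic_hull_model_cone[OF M w(2,1)] .
  have "radial_proj X w \<in> rel_interior (conic hull F)"
    unfolding radial_proj_def using radial_norm_pos[OF wU] w(3)
    by (intro rel_interior_conic_scale conic_conic_hull) auto
  then show ?thesis
    using cell_rel_interior_iff[OF M assms(2)] radial_proj_in_model[OF wU] by blast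
qed

text \<open>The section \<open>C\<close> of the cone by the hyperplane where \<open>l\<close> equals
  1 is compact and convex, and radial projection maps it homeomorphically onto the cell, with
  inverse \<open>s\<close>. So the question is reduced to convex bodies, whatever the
  geometry.\<close>

lemma geo_cell_parametrization:
  assumes F: "geo_cell X (F :: ('a::euclidean_space \<times> real) set)" "F \<noteq> {}"
  shows "\<exists>(V::('a \<times> real) set) h g. subspace V \<and> dim V = dim F - 1 \<and>
     homeomorphism (cball 0 1 \<inter> V) F h g \<and> h ` (sphere 0 1 \<inter> V) = F - cell_rel_interior X F"
proof -
  obtain l where l: "\<And>x. x \<in> F \<Longrightarrow> 0 < l \<bullet> x"
    using F by (auto simp: geo_cell_def)
  have M: "F \<subseteq> model_space X" and conv: "convex (conic hull F)" and "compact F"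
    using F by (auto simp: geo_cell_def)
  define C where "C = conic hull F \<inter> {x. l \<bullet> x = 1}"
  define s where "s = (\<lambda>x. x /\<^sub>R (l \<bullet> x))"
  have CU: "C \<subseteq> model_cone X"
    using conic_hull_model_cone[OF M] by (force simp: C_def)
  have pC: "radial_proj X x \<in> F" if "x \<in> C" for x
    using that CU conic_hull_iff[OF M, of x] unfolding C_def by blast
  have sF: "s x \<in> C" if "x \<in> F" for x
    using l[OF that] that conicD[OF conic_conic_hull hull_inc, of x F "inverse (l \<bullet> x)"]
    by (simp add: s_def C_def)
  have ps: "radial_proj X (s x) = x" if "x \<in> F" for x
  proof -
    have "x \<in> model_space X"
      using M that by auto
    then show ?thesis
      using l[OF that] model_space_subset_cone radial_proj_scale[of x X "inverse (l \<bullet> x)"] radial_proj_id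
      unfolding s_def by fastforce
  qed
  have sp: "s (radial_proj X x) = x" if "x \<in> C" for x
  proof -
    have "radial_norm X x > 0"
      using CU that radial_norm_pos by blast
    then show ?thesis
      using that by (simp add: s_def radial_proj_def C_def)
  qed
  have cont_s: "continuous_on F s"
    unfolding s_def using l by (intro continuous_intros) force
  have C_img: "C = s ` F"
    using sF sp pC by (metis image_iff subsetI subset_antisym image_subsetI)
  then have "compact C"
    using cont_s \<open>compact F\<close> compact_continuous_image by blast
  have hom: "homeomorphism C F (radial_proj X) s"
    using pC sF ps sp by (intro homeomorphismI cont_s continuous_on_subset[OF continuous_on_radial_proj CU]) blast+
  have "convex C"
    unfolding C_def by (intro convex_Int conv convex_hyperplane)
  have "C \<noteq> {}"
    using C_img F by simp
  have "span C = span F"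
  proof
    show "span C \<subseteq> span F"
    proof (intro span_minimal subsetI subspace_span)
      fix y assume "y \<in> C"
      then obtain x where "x \<in> F" "y = s x"
        using C_img by blast
      then show "y \<in> span F"
        unfolding s_def by (simp only: span_scale span_base)
    qed
    show "span F \<subseteq> span C"
    proof (intro span_minimal subsetI subspace_span)
      fix x assume x: "x \<in> F"
      then have "(l \<bullet> x) *\<^sub>R s x \<in> span C"
        using sF by (intro span_scale span_base)
      then show "x \<in> span C"
        using l[OF x] by (simp add: s_def)
    qed
  qed
  then have dimC: "dim C = dim F"
    by (metis dim_span)
  have "affine hull C \<subseteq> {x. l \<bullet> x = 1}"
    by (intro hull_minimal) (auto simp: C_def affine_hyperplane)
  \<comment> \<open>Hence adjoining 0 raises the affine dimension by one, to the dimension of the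
    span.\<close>
  then have "0 \<notin> affine hull C"
    by auto
  then have "aff_dim (insert 0 C) = aff_dim C + 1"
    by (simp add: aff_dim_insert)
  moreover have "aff_dim (insert 0 C) = int (dim (insert 0 C))"
    by (intro aff_dim_zero hull_inc) auto
  ultimately have aff: "aff_dim C = int (dim F) - 1"
    by (simp add: dimC dim_insert span_zero)
  then have "aff_dim C \<le> DIM('a \<times> real)"
    using dim_subset_UNIV[of F] by linarith
  then obtain V :: "('a \<times> real) set" and h g where V: "subspace V" "int (dim V) = aff_dim C"
    "homeomorphism (cball 0 1 \<inter> V) F h g" "h ` (sphere 0 1 \<inter> V) = radial_proj X ` rel_frontier C"
    using compact_convex_cell[OF \<open>compact C\<close> \<open>convex C\<close> \<open>C \<noteq> {}\<close> hom] by blast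
  obtain p where p: "p \<in> cell_rel_interior X F"
    using cell_rel_interior_nonempty[OF F] by blast
  then have pr: "p \<in> rel_interior (conic hull F)" "p \<in> F"
    using cell_rel_interior_iff[OF M F(2)] rel_interior_subset conic_hull_Int_model[OF M] by blast+
  then have "s p \<in> rel_interior (conic hull F)" "l \<bullet> s p = 1"
    using l[OF pr(2)] by (auto simp: s_def intro!: rel_interior_conic_scale conic_conic_hull)
  \<comment> \<open>The relative interior of an intersection is the intersection of the relative
    interiors once these have a common point, here \<open>s p\<close>.\<close>
  then have "rel_interior C = rel_interior (conic hull F) \<inter> {x. l \<bullet> x = 1}"
    unfolding C_def
    by (subst convex_rel_interior_inter_two) (auto simp: conv convex_hyperplane rel_interior_affine affine_hyperplane)
  then have "rel_frontier C = C - rel_interior (conic hull F)"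
    using \<open>compact C\<close> by (auto simp: rel_frontier_def compact_imp_closed C_def)
  moreover have riff: "radial_proj X x \<in> rel_interior (conic hull F) \<longleftrightarrow> x \<in> rel_interior (conic hull F)"
    if "x \<in> C" for x
  proof -
    have "radial_norm X x > 0"
      using CU that radial_norm_pos by blast
    then show ?thesis
      using rel_interior_conic_scale[OF conic_conic_hull, of x F "inverse (radial_norm X x)"]
        rel_interior_conic_scale[OF conic_conic_hull, of "radial_proj X x" F "radial_norm X x"]
        scale_radial_proj[of x X] CU that by (auto simp: radial_proj_def)
  qed
  moreover have "x \<in> radial_proj X ` (C - rel_interior (conic hull F))"
    if "x \<in> F - rel_interior (conic hull F)" for x
    using that sF ps riff[of "s x"] by (intro image_eqI[of _ _ "s x"]) auto
  ultimately have "radial_proj X ` rel_frontier C = F - rel_interior (conic hull F)"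
    using pC by blast
  also have "\<dots> = F - cell_rel_interior X F"
    using cell_rel_interior_iff[OF M F(2)] M by auto
  finally show ?thesis
    using V aff by (intro exI[of _ V] exI[of _ h] exI[of _ g]) auto
qed

section \<open>Subcomplexes common to two complexes\<close>

text \<open>At height 1 the offset of an affine half-space becomes the last coordinate of a linear
  normal. On the hyperboloid, changing the sign of the last coordinate turns the Lorentzian product
  with the normal into the ordinary one.\<close>

lemma half_space_normal:
  assumes "half_space X H"
  shows "\<exists>n. n \<noteq> 0 \<and> H = model_space X \<inter> {x. n \<bullet> x \<le> 0}"
proof (cases X)
  case Euclidean
  then obtain a b where ab: "a \<noteq> 0" "H = {p \<in> model_space Euclidean. a \<bullet> fst p \<le> b}"
    using assms by auto
  then show ?thesis
    using Euclidean by (intro exI[of _ "(a, - b)"]) (auto simp: inner_prod_def zero_prod_def)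
next
  case Spherical
  then obtain n where "n \<noteq> 0" "H = {p \<in> model_space Spherical. n \<bullet> p \<le> 0}"
    using assms unfolding Spherical half_space.simps by blast
  then show ?thesis
    unfolding Spherical by blast
next
  case Hyperbolic
  then obtain n where n: "lorentz n n > 0" "H = {p \<in> model_space Hyperbolic. lorentz n p \<le> 0}"
    using assms by auto
  then have "n \<noteq> 0"
    by (auto simp: lorentz_def)
  moreover have "lorentz n p = (fst n, - snd n) \<bullet> p" for p
    by (simp add: lorentz_def inner_prod_def)
  ultimately show ?thesis
    using n Hyperbolic by (intro exI[of _ "(fst n, - snd n)"]) (auto simp: prod_eq_iff)
qed

text \<open>The normals of a polyhedral description can be kept and all offsets replaced by 0: a ray
  of the cone on which a normal is positive would leave the half-space, and offsets are nonnegative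
  since 0 belongs to the cone.\<close>

lemma polyhedral_cone_normals:
  fixes K :: "'a::euclidean_space set"
  assumes "polyhedron K" "conic K" "K \<noteq> {}"
  shows "\<exists>N. finite N \<and> 0 \<notin> N \<and> K = {x. \<forall>n\<in>N. n \<bullet> x \<le> 0}"
proof -
  obtain \<F> where F: "finite \<F>" "K = \<Inter>\<F>" "\<forall>h\<in>\<F>. \<exists>a b. a \<noteq> 0 \<and> h = {x. a \<bullet> x \<le> b}"
    using assms(1) unfolding polyhedron_def by metis
  then obtain a b where ab: "\<And>h. h \<in> \<F> \<Longrightarrow> a h \<noteq> 0" "\<And>h. h \<in> \<F> \<Longrightarrow> h = {x. a h \<bullet> x \<le> b h}"
    by metis
  have "0 \<in> K"
    using assms(2,3) conicD[of K _ 0] by fastforce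
  have "K = {x. \<forall>n\<in>a ` \<F>. n \<bullet> x \<le> 0}"
  proof (intro equalityI subsetI CollectI ballI)
    fix x n assume x: "x \<in> K" "n \<in> a ` \<F>"
    then obtain h where h: "h \<in> \<F>" "n = a h"
      by blast
    show "n \<bullet> x \<le> 0"
    proof (rule ccontr)
      assume neg: "\<not> n \<bullet> x \<le> 0"
      define c where "c = (\<bar>b h\<bar> + 1) / (n \<bullet> x)"
      have "c *\<^sub>R x \<in> h"
        using F(2) h conicD[OF assms(2) x(1), of c] neg by (auto simp: c_def)
      then have "c * (n \<bullet> x) \<le> b h"
        using ab(2)[OF h(1)] h(2) by (metis inner_scaleR_right mem_Collect_eq)
      then show False
        using neg by (auto simp: c_def)
    qed
  next
    fix x assume x: "x \<in> {x. \<forall>n\<in>a ` \<F>. n \<bullet> x \<le> 0}"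
    have "x \<in> h" if h: "h \<in> \<F>" for h
    proof -
      have "0 \<le> b h"
        using \<open>0 \<in> K\<close> F(2) h ab(2)[OF h] by (metis InterE inner_zero_right mem_Collect_eq)
      then show ?thesis
        using x h ab(2)[OF h] by force
    qed
    then show "x \<in> K"
      using F(2) by blast
  qed
  with F ab show ?thesis
    by (intro exI[of _ "a ` \<F>"]) auto
qed

text \<open>Pointedness makes the cone without its apex convex. Hence the convex hull of the compact
  set \<open>sphere 0 1 \<inter> K\<close> avoids 0 and can be strictly separated from it.\<close>

lemma pointed_cone_positive_functional:
  fixes K :: "'a::euclidean_space set"
  assumes "closed K" "convex K" "conic K" and pointed: "\<forall>x\<in>K. - x \<in> K \<longrightarrow> x = 0"
  shows "\<exists>l. \<forall>x\<in>sphere 0 1 \<inter> K. 0 < l \<bullet> x"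
proof -
  let ?S = "convex hull (sphere 0 1 \<inter> K)"
  have "convex (K - {0})"
    unfolding convex_def
  proof (intro ballI allI impI)
    fix x y and u v :: real
    assume xy: "x \<in> K - {0}" "y \<in> K - {0}" and uv: "0 \<le> u" "0 \<le> v" "u + v = 1"
    have "u *\<^sub>R x + v *\<^sub>R y \<in> K"
      using xy uv \<open>convex K\<close> by (auto simp: convex_def)
    moreover have "u *\<^sub>R x + v *\<^sub>R y \<noteq> 0"
    proof
      assume 0: "u *\<^sub>R x + v *\<^sub>R y = 0"
      show False
      proof (cases "u = 0")
        case True
        then show False
          using 0 uv xy by auto
      next
        case False
        have "- (u *\<^sub>R x) = v *\<^sub>R y"
          using 0 by (simp add: neg_eq_iff_add_eq_0)
        then have "- (u *\<^sub>R x) \<in> K" "u *\<^sub>R x \<in> K"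
          using xy uv conicD[OF assms(3)] by auto
        with pointed False xy show False
          by auto
      qed
    qed
    ultimately show "u *\<^sub>R x + v *\<^sub>R y \<in> K - {0}"
      by blast
  qed
  then have "?S \<subseteq> K - {0}"
    by (intro hull_minimal) auto
  moreover have "compact ?S"
    using \<open>closed K\<close> by (intro compact_convex_hull compact_Int_closed) auto
  ultimately obtain a b where "0 < b" "\<forall>x\<in>?S. b < a \<bullet> x"
    using separating_hyperplane_closed_0[of ?S] by (auto simp: compact_imp_closed)
  then show ?thesis
    by (intro exI[of _ a]) (meson hull_inc less_trans)
qed

lemma full_polytope_normals:
  assumes "full_polytope X P"
  shows "\<exists>N. finite N \<and> 0 \<notin> N \<and> P = model_space X \<inter> {x. \<forall>n\<in>N. n \<bullet> x \<le> 0}"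
    and "compact P" "\<exists>l. \<forall>x\<in>P. 0 < l \<bullet> x"
proof -
  have "(\<exists>N. finite N \<and> 0 \<notin> N \<and> P = model_space X \<inter> {x. \<forall>n\<in>N. n \<bullet> x \<le> 0}) \<and>
    compact P \<and> (\<exists>l. \<forall>x\<in>P. 0 < l \<bullet> x)"
  proof (cases "X = Spherical")
    case True
    then obtain K where K: "polyhedron K" "conic K" "\<forall>x\<in>K. - x \<in> K \<longrightarrow> x = 0" "interior K \<noteq> {}"
      "P = sphere 0 1 \<inter> K"
      using assms by (auto simp: full_polytope_def)
    then have "K \<noteq> {}"
      by auto
    then show ?thesis
      using polyhedral_cone_normals[of K] pointed_cone_positive_functional[of K] K True
      by (auto simp: polyhedron_imp_closed polyhedron_imp_convex compact_Int_closed)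
  next
    case False
    then obtain \<H> where H: "finite \<H>" "\<forall>H\<in>\<H>. half_space X H" "P = model_space X \<inter> \<Inter>\<H>" "bounded P"
      using assms by (auto simp: full_polytope_def)
    have "\<forall>H\<in>\<H>. \<exists>n. n \<noteq> 0 \<and> H = model_space X \<inter> {x. n \<bullet> x \<le> 0}"
      using H(2) half_space_normal by blast
    then obtain n where n: "\<And>H. H \<in> \<H> \<Longrightarrow> n H \<noteq> 0" "\<And>H. H \<in> \<H> \<Longrightarrow> H = model_space X \<inter> {x. n H \<bullet> x \<le> 0}"
      by metis
    have P: "P = model_space X \<inter> {x. \<forall>n\<in>n ` \<H>. n \<bullet> x \<le> 0}"
      using H(3) n(2) by blast
    have "{x. \<forall>n\<in>n ` \<H>. n \<bullet> x \<le> 0} = (\<Inter>n\<in>n ` \<H>. {x. n \<bullet> x \<le> 0})"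
      by blast
    then have "closed P"
      unfolding P by (auto intro!: closed_Int closed_model_space closed_INT closed_halfspace_le)
    then have "compact P"
      using H(4) by (simp add: compact_eq_bounded_closed)
    moreover have "0 < (0, 1) \<bullet> x" if "x \<in> P" for x
      using that False H(3) by (cases X) (auto simp: inner_prod_def)
    moreover have "finite (n ` \<H>)" "0 \<notin> n ` \<H>"
      using H(1) n(1) by auto
    ultimately show ?thesis
      using P by blast
  qed
  then show "\<exists>N. finite N \<and> 0 \<notin> N \<and> P = model_space X \<inter> {x. \<forall>n\<in>N. n \<bullet> x \<le> 0}"
    and "compact P" "\<exists>l. \<forall>x\<in>P. 0 < l \<bullet> x"
    by blast+
qed

lemma complex_Int_face:
  assumes "geometric_complex X \<A>" "P \<in> \<A>" "Q \<in> \<A>"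
  shows "geo_face X (P \<inter> Q) P"
  using assms by (auto simp: geometric_complex_def)

lemma complex_face:
  assumes "geometric_complex X \<A>" "P \<in> \<A>" "geo_face X F P"
  shows "F \<in> \<A>"
  using assms by (auto simp: geometric_complex_def)

lemma complex_ex_full_polytope:
  assumes A: "geometric_complex X \<A>" "F \<in> \<A>"
  obtains P where "P \<in> \<A>" "F \<subseteq> P" "full_polytope X P"
proof -
  have "finite \<A>"
    using A by (auto simp: geometric_complex_def)
  then obtain P where "P \<in> \<A>" "F \<subseteq> P" "\<forall>Q\<in>\<A>. P \<subseteq> Q \<longrightarrow> Q = P"
    using finite_has_maximal2[of \<A> F] A(2) by metis
  then show thesis
    using A that unfolding geometric_complex_def by blast
qed

lemma complex_cell:
  assumes A: "geometric_complex X \<A>" "F \<in> \<A>"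
  shows "geo_cell X F"
proof -
  obtain P where P: "P \<in> \<A>" "F \<subseteq> P" "full_polytope X P"
    using complex_ex_full_polytope[OF A] .
  \<comment> \<open>Convexity of the cone over \<open>P\<close> is contained in the statement that
    \<open>P\<close> is a face of itself.\<close>
  have "geo_face X P P"
    using complex_Int_face[OF A(1) P(1) P(1)] by simp
  then have "P \<subseteq> model_space X" "convex (conic hull P)"
    by (auto simp: geo_face_def dest: face_of_imp_convex)
  then have "geo_cell X P"
    using full_polytope_normals[OF P(3)] by (simp add: geo_cell_def)
  moreover have "geo_face X F P"
    using complex_Int_face[OF A(1) P(1) A(2)] P(2) by (simp add: Int_absorb1)
  ultimately show ?thesis
    by (rule geo_face_cell(1))
qed

lemma complex_contains_cell:
  assumes A: "geometric_complex X \<A>" and FG: "F \<in> \<A>" "G \<in> \<A>" "F \<noteq> {}"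
    and p: "p \<in> cell_rel_interior X F" "p \<in> G"
  shows "F \<subseteq> G"
proof -
  have "p \<in> F"
    using p(1) by (auto simp: cell_rel_interior_def interior_of_def)
  then have "F \<inter> G = F"
    using subset_face_if_rel_interior[OF complex_cell[OF A FG(1)] FG(3) complex_Int_face[OF A FG(1,2)]] p
    by blast
  then show ?thesis
    by blast
qed

lemma complex_subset_in:
  assumes A: "geometric_complex X \<A>" and "P \<in> \<A>" "F \<in> \<A>" "F \<subseteq> P"
  shows "geo_face X F P"
  using complex_Int_face[OF A, of P F] assms by (simp add: Int_absorb1)

lemma closed_Union_complex:
  assumes "geometric_complex X \<A>"
  shows "closed (\<Union>\<A>)" "bounded (\<Union>\<A>)" "\<Union>\<A> \<subseteq> model_space X"
  using assms complex_cell[OF assms] unfolding geo_cell_def geometric_complex_def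
  by (auto intro!: closed_Union compact_imp_closed bounded_Union compact_imp_bounded)

lemma face_in_Int:
  assumes "geometric_complex X \<A>" "geometric_complex X \<B>" "F \<in> \<A> \<inter> \<B>" "geo_face X G F"
  shows "G \<in> \<A> \<inter> \<B>"
  using assms complex_face by blast

text \<open>The common cells inherit closure under faces, and closure under intersections because an
  intersection is a face. The exponent is the geometric dimension of a cell, one less than that of
  its span; the empty face is not a ball and is removed.\<close>

theorem euler_sum_common_subcomplex:
  assumes A: "geometric_complex X (\<A> :: ('a::euclidean_space \<times> real) set set)" and B: "geometric_complex X \<B>"
  shows "has_euler (top_of_set (\<Union>(\<A> \<inter> \<B>))) {} (\<Sum>F\<in>\<A> \<inter> \<B> - {{}}. (-1) ^ (dim F - 1))"
proof -
  let ?K = "\<A> \<inter> \<B> - {{}}"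
  have "has_euler (top_of_set (\<Union>?K)) {} (\<Sum>F\<in>?K. (-1) ^ (dim F - 1))"
  proof (rule has_euler_cell_complex)
    show "finite ?K"
      using A by (auto simp: geometric_complex_def)
    fix F assume F: "F \<in> ?K"
    then have cell: "geo_cell X F" "F \<noteq> {}"
      using complex_cell[OF A] by auto
    have "F - cell_rel_interior X F = \<Union>{G \<in> ?K. G \<subset> F}"
    proof (intro equalityI subsetI)
      fix x assume "x \<in> F - cell_rel_interior X F"
      then obtain G where G: "geo_face X G F" "G \<noteq> F" "x \<in> G"
        using ex_proper_face[OF cell(1)] by blast
      then have "G \<in> ?K" "G \<subset> F"
        using face_in_Int[OF A B _ G(1)] F geo_face_cell(2)[OF cell(1) G(1)] by auto
      with G(3) show "x \<in> \<Union>{G \<in> ?K. G \<subset> F}"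
        by blast
    next
      fix x assume "x \<in> \<Union>{G \<in> ?K. G \<subset> F}"
      then obtain G where G: "G \<in> ?K" "G \<subset> F" "x \<in> G"
        by blast
      then have "x \<notin> cell_rel_interior X F"
        using complex_contains_cell[OF A, of F G x] F cell(2) by auto
      with G show "x \<in> F - cell_rel_interior X F"
        by blast
    qed
    then show "\<exists>(V::('a \<times> real) set) h g. subspace V \<and> dim V = dim F - 1 \<and>
        homeomorphism (cball 0 1 \<inter> V) F h g \<and> h ` (sphere 0 1 \<inter> V) = \<Union>{G \<in> ?K. G \<subset> F}"
      using geo_cell_parametrization[OF cell] by metis
  next
    fix F G assume "F \<in> ?K" "G \<in> ?K" "F \<inter> G \<noteq> {}"
    then show "F \<inter> G \<in> ?K"
      using face_in_Int[OF A B _ complex_Int_face[OF A, of F G]] by blast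
  qed
  moreover have "\<Union>?K = \<Union>(\<A> \<inter> \<B>)"
    by blast
  ultimately show ?thesis
    by simp
qed

lemma has_euler_disjoint_spheres:
  assumes "union_of_disjoint_spheres m (M :: ('a::euclidean_space \<times> real) set)"
  shows "has_euler (top_of_set M) {} (int m * (1 - (-1) ^ DIM('a)))"
proof -
  have sph: "has_euler (top_of_set S) {} (1 - (-1) ^ DIM('a))" if "S homeomorphic sphere (0::'a) 1"
    for S :: "('a \<times> real) set"
  proof (rule has_euler_homeomorphic)
    show "top_of_set (sphere (0::'a) 1) homeomorphic_space top_of_set S"
      using that homeomorphic_sym by auto
    show "has_euler (top_of_set (sphere (0::'a) 1)) {} (1 - (-1) ^ DIM('a))"
      using has_euler_sphere_subspace[of "UNIV :: 'a set"] by simp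
  qed
  obtain \<S> where S: "finite \<S>" "card \<S> = m" "disjoint \<S>" "\<Union>\<S> = M"
    "\<forall>S\<in>\<S>. S homeomorphic sphere (0::'a) 1"
    using assms by (auto simp: union_of_disjoint_spheres_def)
  have "has_euler (top_of_set (\<Union>\<S>)) {} (int (card \<S>) * (1 - (-1) ^ DIM('a)))"
    using S(1,3,5)
  proof (induction \<S> rule: finite_induct)
    case empty
    then show ?case
      by (auto intro: has_euler_empty)
  next
    case (insert S \<S>)
    have cl: "closed T" if "T \<in> insert S \<S>" for T
      using insert.prems that by (meson compact_imp_closed compact_sphere homeomorphic_compactness)
    have "has_euler (top_of_set (S \<union> \<Union>\<S>)) {} ((1 - (-1) ^ DIM('a)) + int (card \<S>) * (1 - (-1) ^ DIM('a)))"
    proof (rule has_euler_disjoint_Un)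
      have "closed S" "closed (\<Union>\<S>)"
        using cl insert.hyps by (auto intro!: closed_Union)
      then show "closedin (top_of_set (S \<union> \<Union>\<S>)) S" "closedin (top_of_set (S \<union> \<Union>\<S>)) (\<Union>\<S>)"
        by (auto intro!: closed_subset)
      show "S \<inter> \<Union>\<S> = {}"
        using insert.prems(1) insert.hyps(2) by (auto simp: pairwise_insert disjnt_def)
      have "subtopology (top_of_set (S \<union> \<Union>\<S>)) S = top_of_set S"
        "subtopology (top_of_set (S \<union> \<Union>\<S>)) (\<Union>\<S>) = top_of_set (\<Union>\<S>)"
        by (auto simp: subtopology_subtopology Int_absorb1)
      moreover have "disjoint \<S>"
        using insert.prems(1) by (simp add: pairwise_insert)
      ultimately show "has_euler (subtopology (top_of_set (S \<union> \<Union>\<S>)) S) {} (1 - (-1) ^ DIM('a))"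
        "has_euler (subtopology (top_of_set (S \<union> \<Union>\<S>)) (\<Union>\<S>)) {} (int (card \<S>) * (1 - (-1) ^ DIM('a)))"
        using sph insert.IH insert.prems(2) by auto
    qed auto
    then show ?case
      using insert.hyps by (simp add: algebra_simps)
  qed
  with S show ?thesis
    by simp
qed

section \<open>Local structure of a complex\<close>

lemma complex_interior_iff:
  "x \<in> complex_interior X \<A> \<longleftrightarrow> x \<in> model_space X \<and> (\<exists>W. open W \<and> x \<in> W \<and> model_space X \<inter> W \<subseteq> \<Union>\<A>)"
proof
  assume "x \<in> complex_interior X \<A>"
  then obtain T where T: "openin (top_of_set (model_space X)) T" "x \<in> T" "T \<subseteq> \<Union>\<A>"
    by (auto simp: complex_interior_def interior_of_def)
  then obtain W where "open W" "T = model_space X \<inter> W"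
    by (auto simp: openin_open)
  with T show "x \<in> model_space X \<and> (\<exists>W. open W \<and> x \<in> W \<and> model_space X \<inter> W \<subseteq> \<Union>\<A>)"
    by blast
next
  assume "x \<in> model_space X \<and> (\<exists>W. open W \<and> x \<in> W \<and> model_space X \<inter> W \<subseteq> \<Union>\<A>)"
  then obtain W where W: "x \<in> model_space X" "open W" "x \<in> W" "model_space X \<inter> W \<subseteq> \<Union>\<A>"
    by blast
  then have "openin (top_of_set (model_space X)) (model_space X \<inter> W)"
    by (simp add: openin_open_Int)
  with W show "x \<in> complex_interior X \<A>"
    unfolding complex_interior_def interior_of_def by blast
qed

lemma complex_interior_subset: "complex_interior X \<A> \<subseteq> \<Union>\<A>"
  unfolding complex_interior_iff subset_iff by blast

lemma complex_interior_mono: "\<Union>\<A> \<subseteq> \<Union>\<B> \<Longrightarrow> complex_interior X \<A> \<subseteq> complex_interior X \<B>"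
  unfolding complex_interior_def by (rule interior_of_mono)

lemma openin_complex_interior: "openin (top_of_set (model_space X)) (complex_interior X \<A>)"
  by (simp add: complex_interior_def)

lemma open_strict_halfspaces:
  fixes K :: "'a::euclidean_space set"
  assumes "finite K"
  shows "open {x. \<forall>n\<in>K. n \<bullet> x < 0}"
proof -
  have "{x. \<forall>n\<in>K. n \<bullet> x < 0} = (\<Inter>n\<in>K. {x. n \<bullet> x < 0})"
    by auto
  then show ?thesis
    using assms by (auto intro!: open_INT open_halfspace_lt)
qed

text \<open>\<open>K\<close> collects the normals of all full-dimensional cells, which together
  cover the complex. Their signs decide membership in each of these cells, and a point strictly
  inside all half-spaces of one cell is interior to the complex.\<close>

lemma complex_hyperplanes:
  assumes A: "geometric_complex X (\<A> :: ('a::euclidean_space \<times> real) set set)"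
  obtains K where "finite K" "0 \<notin> K"
    and "\<And>x y. x \<in> model_space X \<Longrightarrow> y \<in> model_space X \<Longrightarrow> (\<And>n. n \<in> K \<Longrightarrow> sgn (n \<bullet> x) = sgn (n \<bullet> y)) \<Longrightarrow>
      x \<in> \<Union>\<A> \<Longrightarrow> y \<in> \<Union>\<A>"
    and "\<And>x. x \<in> \<Union>\<A> \<Longrightarrow> x \<notin> complex_interior X \<A> \<Longrightarrow> \<exists>n\<in>K. n \<bullet> x = 0"
proof -
  let ?P = "{P \<in> \<A>. full_polytope X P}"
  have "\<forall>P\<in>?P. \<exists>N. finite N \<and> 0 \<notin> N \<and> P = model_space X \<inter> {x. \<forall>n\<in>N. n \<bullet> x \<le> 0}"
    using full_polytope_normals(1) by blast
  from bchoice[OF this] obtain N where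
    *: "\<forall>P\<in>?P. finite (N P) \<and> 0 \<notin> N P \<and> P = model_space X \<inter> {x. \<forall>n\<in>N P. n \<bullet> x \<le> 0}" ..
  have N: "finite (N P)" "0 \<notin> N P" "P = model_space X \<inter> {x. \<forall>n\<in>N P. n \<bullet> x \<le> 0}" if "P \<in> ?P" for P
    by (rule conjunct1[OF bspec[OF * that]], rule conjunct1[OF conjunct2[OF bspec[OF * that]]],
      rule conjunct2[OF conjunct2[OF bspec[OF * that]]])
  define K where "K = (\<Union>P\<in>?P. N P)"
  have ex: "\<exists>P\<in>?P. x \<in> P" if "x \<in> \<Union>\<A>" for x
    using that complex_ex_full_polytope[OF A] by (metis (mono_tags, lifting) UnionE mem_Collect_eq subsetD)
  show thesis
  proof
    have "finite \<A>"
      using A by (simp add: geometric_complex_def)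
    then show "finite K"
      unfolding K_def by (intro finite_UN_I N(1)) simp_all
    show "0 \<notin> K"
      using N(2) unfolding K_def by blast
  next
    fix x y assume xy: "x \<in> model_space X" "y \<in> model_space X" "x \<in> \<Union>\<A>"
      and s: "\<And>n. n \<in> K \<Longrightarrow> sgn (n \<bullet> x) = sgn (n \<bullet> y)"
    obtain P where P: "P \<in> ?P" "x \<in> P"
      using ex[OF xy(3)] by blast
    have "n \<bullet> y \<le> 0" if "n \<in> N P" for n
    proof -
      have "n \<bullet> x \<le> 0"
        using P N(3)[OF P(1)] that by blast
      moreover have "sgn (n \<bullet> x) = sgn (n \<bullet> y)"
        using s[of n] P(1) that unfolding K_def by blast
      ultimately show ?thesis
        by (auto simp: sgn_if split: if_splits)
    qed
    then show "y \<in> \<Union>\<A>"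
      using N(3)[OF P(1)] P(1) xy(2) by blast
  next
    fix x assume x: "x \<in> \<Union>\<A>" "x \<notin> complex_interior X \<A>"
    obtain P where P: "P \<in> ?P" "x \<in> P"
      using ex[OF x(1)] by blast
    let ?W = "{x. \<forall>n\<in>N P. n \<bullet> x < 0}"
    have "open ?W"
      using N(1)[OF P(1)] by (rule open_strict_halfspaces)
    moreover have "model_space X \<inter> ?W \<subseteq> \<Union>\<A>"
      using N(3)[OF P(1)] P(1) by fastforce
    moreover have "x \<in> model_space X"
      using P N(3)[OF P(1)] by blast
    ultimately have "x \<notin> ?W"
      using x(2) unfolding complex_interior_iff by blast
    then obtain n where n: "n \<in> N P" "\<not> n \<bullet> x < 0"
      by blast
    moreover have "n \<bullet> x \<le> 0"
      using P N(3)[OF P(1)] n(1) by blast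
    ultimately show "\<exists>n\<in>K. n \<bullet> x = 0"
      using P(1) by (intro bexI[of _ n]) (auto simp: K_def)
  qed
qed

text \<open>If \<open>x\<close> and \<open>y\<close> have the same sign vector and \<open>z\<close> is close to \<open>y\<close>, then \<open>x + t z\<close> has
  the sign vector of \<open>z\<close> for every \<open>t > 0\<close>, and lies close to \<open>x\<close> for small \<open>t\<close>.\<close>

lemma complex_interior_sign_vector:
  fixes K :: "('a::euclidean_space \<times> real) set"
  assumes K: "finite K"
    and mem: "\<And>x y. x \<in> model_space X \<Longrightarrow> y \<in> model_space X \<Longrightarrow> (\<And>n. n \<in> K \<Longrightarrow> sgn (n \<bullet> x) = sgn (n \<bullet> y)) \<Longrightarrow>
      x \<in> \<Union>\<A> \<Longrightarrow> y \<in> \<Union>\<A>"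
    and x: "x \<in> complex_interior X \<A>" and y: "y \<in> model_space X"
    and s: "\<And>n. n \<in> K \<Longrightarrow> sgn (n \<bullet> x) = sgn (n \<bullet> y)"
  shows "y \<in> complex_interior X \<A>"
proof -
  obtain W where W: "open W" "x \<in> W" "model_space X \<inter> W \<subseteq> \<Union>\<A>" and xM: "x \<in> model_space X"
    using x by (auto simp: complex_interior_iff)
  \<comment> \<open>Scaling \<open>n\<close> by minus its value at \<open>y\<close> makes
    \<open>?W\<close> the open set of points at which every normal that does not vanish at
    \<open>y\<close> has the same sign as at \<open>y\<close>.\<close>
  let ?K = "(\<lambda>n. (- (n \<bullet> y)) *\<^sub>R n) ` {n \<in> K. n \<bullet> y \<noteq> 0}"
  let ?W = "{z. \<forall>n\<in>?K. n \<bullet> z < 0}"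
  have "open ?W"
    using K by (intro open_strict_halfspaces) auto
  moreover have "y \<in> ?W"
  proof (intro CollectI ballI)
    fix n assume "n \<in> ?K"
    then obtain k where k: "k \<bullet> y \<noteq> 0" "n = (- (k \<bullet> y)) *\<^sub>R k"
      by blast
    have "0 < (k \<bullet> y) * (k \<bullet> y)"
      using k(1) not_real_square_gt_zero by blast
    then show "n \<bullet> y < 0"
      by (simp add: k(2))
  qed
  moreover have "z \<in> \<Union>\<A>" if z: "z \<in> model_space X" "z \<in> ?W" for z
  proof -
    have sz: "sgn (n \<bullet> x + t * (n \<bullet> z)) = sgn (n \<bullet> z)" if n: "n \<in> K" and "t > 0" for n t
    proof (cases "n \<bullet> y = 0")
      case True
      then have "n \<bullet> x = 0"
        using s[OF n] by (simp add: sgn_zero_iff)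
      then show ?thesis
        using \<open>t > 0\<close> by (simp add: sgn_mult)
    next
      case False
      have "(- (n \<bullet> y)) *\<^sub>R n \<in> ?K"
        using n False by blast
      then have "(- (n \<bullet> y)) *\<^sub>R n \<bullet> z < 0"
        using z(2) by blast
      then have "0 < (n \<bullet> y) * (n \<bullet> z)"
        by simp
      moreover have "sgn (n \<bullet> x) = sgn (n \<bullet> y)"
        by (rule s[OF n])
      ultimately consider "n \<bullet> x > 0" "n \<bullet> z > 0" | "n \<bullet> x < 0" "n \<bullet> z < 0"
        by (auto simp: zero_less_mult_iff sgn_if split: if_splits)
      then show ?thesis
      proof cases
        case 1
        then have "0 < n \<bullet> x + t * (n \<bullet> z)"
          using \<open>t > 0\<close> by (simp add: add_pos_pos)
        with 1 show ?thesis by simp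
      next
        case 2
        then have "n \<bullet> x + t * (n \<bullet> z) < 0"
          using \<open>t > 0\<close> by (simp add: add_neg_neg mult_pos_neg)
        with 2 show ?thesis by simp
      qed
    qed
    let ?O = "model_cone X \<inter> radial_proj X -` W"
    have "open ?O"
      using continuous_on_radial_proj open_model_cone W(1) by (rule continuous_open_preimage)
    moreover have "x \<in> ?O"
      using xM W(2) model_space_subset_cone radial_proj_id[OF xM] by auto
    moreover have "((\<lambda>t. x + t *\<^sub>R z) \<longlongrightarrow> x + 0 *\<^sub>R z) (at_right 0)"
      by (intro tendsto_intros)
    then have "((\<lambda>t. x + t *\<^sub>R z) \<longlongrightarrow> x) (at_right 0)"
      by simp
    ultimately have "\<forall>\<^sub>F t in at_right 0. x + t *\<^sub>R z \<in> ?O"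
      by (metis topological_tendstoD)
    then have "\<forall>\<^sub>F t in at_right (0::real). x + t *\<^sub>R z \<in> ?O \<and> t > 0"
      using eventually_at_right_less[of 0] by (rule eventually_conj)
    then obtain t where t: "x + t *\<^sub>R z \<in> ?O" "t > 0"
      using eventually_happens' trivial_limit_at_right_real by blast
    define w where "w = radial_proj X (x + t *\<^sub>R z)"
    have "w \<in> model_space X" "w \<in> \<Union>\<A>"
      using t W(3) radial_proj_in_model[of "x + t *\<^sub>R z" X] by (auto simp: w_def)
    moreover have "sgn (n \<bullet> w) = sgn (n \<bullet> z)" if "n \<in> K" for n
    proof -
      have "radial_norm X (x + t *\<^sub>R z) > 0"
        using t radial_norm_pos by blast
      then have "sgn (n \<bullet> w) = sgn (n \<bullet> x + t * (n \<bullet> z))"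
        by (simp add: w_def radial_proj_def sgn_mult inner_add_right del: mult_less_0_iff)
      also have "\<dots> = sgn (n \<bullet> z)"
        using sz[OF that t(2)] .
      finally show ?thesis .
    qed
    ultimately show ?thesis
      using mem[of w z] z(1) by blast
  qed
  ultimately show ?thesis
    using y unfolding complex_interior_iff by blast
qed

section \<open>Exponential map and tangent frames\<close>

fun exp_cos :: "geometry \<Rightarrow> real \<Rightarrow> real" where
  "exp_cos Euclidean r = 1" | "exp_cos Spherical r = cos r" | "exp_cos Hyperbolic r = cosh r"

fun exp_sin :: "geometry \<Rightarrow> real \<Rightarrow> real" where
  "exp_sin Euclidean r = r" | "exp_sin Spherical r = sin r" | "exp_sin Hyperbolic r = sinh r"

lemma geo_exp_eq: "geo_exp X p r u = exp_cos X r *\<^sub>R p + exp_sin X r *\<^sub>R u"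
  by (cases X) auto

lemma exp_cos_tendsto: "(exp_cos X \<longlongrightarrow> 1) (at_right 0)"
proof (cases X)
  case Euclidean
  then have "exp_cos X = (\<lambda>_. 1)"
    by auto
  then show ?thesis
    by simp
next
  case Spherical
  then have "exp_cos X = cos"
    by auto
  then show ?thesis
    using tendsto_cos[OF tendsto_ident_at, of 0 "{0<..}"] by simp
next
  case Hyperbolic
  then have "exp_cos X = cosh"
    by auto
  then show ?thesis
    using tendsto_cosh[OF tendsto_ident_at, of 0 "{0<..}"] by simp
qed

lemma exp_sin_tendsto: "(exp_sin X \<longlongrightarrow> 0) (at_right 0)"
proof (cases X)
  case Euclidean
  then have "exp_sin X = (\<lambda>r. r)"
    by auto
  then show ?thesis
    by (simp add: tendsto_ident_at)
next
  case Spherical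
  then have "exp_sin X = sin"
    by auto
  then show ?thesis
    using tendsto_sin[OF tendsto_ident_at, of 0 "{0<..}"] by simp
next
  case Hyperbolic
  then have "exp_sin X = sinh"
    by auto
  then show ?thesis
    using tendsto_sinh[OF tendsto_ident_at, of 0 "{0<..}"] by simp
qed

lemma exp_sin_pos: "\<forall>\<^sub>F r in at_right 0. exp_sin X r > 0"
proof -
  have "\<forall>\<^sub>F r in at_right 0. r \<in> {0<..<pi}"
    by (rule eventually_at_right_real[OF pi_gt_zero])
  then show ?thesis
    by eventually_elim (cases X; auto intro: sin_gt_zero)
qed

text \<open>Guarantees that the frame selected by \<open>SOME\<close> in
  \<open>sphere_fraction\<close> is a genuine one.\<close>

lemma ex_tangent_frame:
  fixes p :: "'a::euclidean_space \<times> real"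
  assumes "p \<in> model_space X"
  shows "\<exists>L. tangent_frame X p L"
proof (cases X)
  case Euclidean
  have "linear (\<lambda>v::'a. (v, 0::real))"
    by (auto intro!: linearI)
  then have "tangent_frame X p (\<lambda>v. (v, 0))"
    by (simp add: Euclidean tangent_frame_def inner_prod_def)
  then show ?thesis
    by blast
next
  case Spherical
  let ?T = "{v. p \<bullet> v = 0}"
  have "p \<noteq> 0"
    using assms Spherical by auto
  then have "dim ?T = DIM('a)"
    by (simp add: dim_hyperplane)
  then obtain L where L: "linear L" "L ` (UNIV :: 'a set) = ?T" "\<And>x. x \<in> (UNIV :: 'a set) \<Longrightarrow> norm (L x) = norm x"
    using isometry_subspaces[of "UNIV :: 'a set" ?T] by (auto simp: subspace_hyperplane)
  have "L v \<bullet> L w = v \<bullet> w" for v w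
    using orthogonal_transformation_def L(1,3) by (simp add: dot_norm linear_add[OF L(1), symmetric])
  then have "tangent_frame X p L"
    using L by (auto simp: Spherical tangent_frame_def)
  then show ?thesis
    by blast
next
  case Hyperbolic
  obtain q s where p: "p = (q, s)"
    by fastforce
  have qs: "q \<bullet> q = s * s - 1" "s > 0"
    using assms Hyperbolic by (auto simp: lorentz_def p)
  \<comment> \<open>The Lorentz boost that takes \<open>(0, 1)\<close> to \<open>p\<close>,
    restricted to vectors of height 0.\<close>
  define L where "L = (\<lambda>v. (v + ((q \<bullet> v) / (1 + s)) *\<^sub>R q, q \<bullet> v))"
  have "linear L"
    unfolding L_def by (rule linearI) (auto simp: inner_add_right add_divide_distrib scaleR_left_distrib algebra_simps)
  moreover have "lorentz p (L v) = 0" for v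
  proof -
    have "lorentz p (L v) = (q \<bullet> v) * (1 + (s * s - 1) / (1 + s) - s)"
      by (simp add: lorentz_def L_def p inner_add_right qs algebra_simps)
    also have "(s * s - 1) / (1 + s) = s - 1"
      using qs(2) by (simp add: field_simps)
    finally show ?thesis
      by simp
  qed
  moreover have "lorentz (L v) (L w) = v \<bullet> w" for v w
  proof -
    define a b where "a = (q \<bullet> v) / (1 + s)" and "b = (q \<bullet> w) / (1 + s)"
    have qv: "q \<bullet> v = a * (1 + s)" "q \<bullet> w = b * (1 + s)"
      using qs(2) by (simp_all add: a_def b_def)
    have "lorentz (L v) (L w) = (v + a *\<^sub>R q) \<bullet> (w + b *\<^sub>R q) - (q \<bullet> v) * (q \<bullet> w)"
      by (simp add: lorentz_def L_def a_def b_def)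
    also have "\<dots> = v \<bullet> w + b * (q \<bullet> v) + a * (q \<bullet> w) + a * b * (q \<bullet> q) - (q \<bullet> v) * (q \<bullet> w)"
      by (simp add: inner_add_left inner_add_right inner_commute[of v q] algebra_simps)
    also have "\<dots> = v \<bullet> w"
      unfolding qv qs(1) by (simp add: algebra_simps)
    finally show ?thesis .
  qed
  ultimately have "tangent_frame X p L"
    by (simp add: Hyperbolic tangent_frame_def)
  then show ?thesis
    by blast
qed

text \<open>Tangent vectors are orthogonal to \<open>p\<close>, so the quadratic equations of the
  curved models reduce to the identities relating \<open>cos\<close> and \<open>sin\<close>, or
  \<open>cosh\<close> and \<open>sinh\<close>. Membership in the cone selects the upper sheet of the
  hyperboloid.\<close>

lemma geo_exp_in_model:
  assumes p: "p \<in> model_space X" and L: "tangent_frame X p L" and u: "norm u = 1"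
    and U: "geo_exp X p r (L u) \<in> model_cone X"
  shows "geo_exp X p r (L u) \<in> model_space X"
proof (cases X)
  case Euclidean
  then show ?thesis
    using p L by (auto simp: tangent_frame_def)
next
  case Spherical
  have "(cos r *\<^sub>R p + sin r *\<^sub>R L u) \<bullet> (cos r *\<^sub>R p + sin r *\<^sub>R L u) = (cos r)\<^sup>2 * (p \<bullet> p) + (sin r)\<^sup>2 * (L u \<bullet> L u)"
    using L Spherical by (simp add: tangent_frame_def inner_add_left inner_add_right inner_commute[of "L u" p] power2_eq_square)
  also have "p \<bullet> p = 1"
    using p Spherical by (simp add: dot_square_norm)
  also have "L u \<bullet> L u = u \<bullet> u"
    using L Spherical by (simp add: tangent_frame_def)
  also have "u \<bullet> u = 1"
    using u by (simp add: dot_square_norm)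
  also have "(cos r)\<^sup>2 * 1 + (sin r)\<^sup>2 * 1 = 1"
    by simp
  finally show ?thesis
    using Spherical by (simp add: norm_eq_1)
next
  case Hyperbolic
  have bil: "lorentz (a *\<^sub>R x + b *\<^sub>R y) (a *\<^sub>R x + b *\<^sub>R y) = a\<^sup>2 * lorentz x x + 2 * a * b * lorentz x y + b\<^sup>2 * lorentz y y"
    for a b :: real and x y :: "'a \<times> real"
    by (simp add: lorentz_def inner_add_left inner_add_right inner_commute[of "fst y" "fst x"] power2_eq_square algebra_simps)
  have "lorentz p p = - 1" "lorentz p (L u) = 0" "lorentz (L u) (L u) = 1"
    using L u p Hyperbolic by (auto simp: tangent_frame_def dot_square_norm)
  then have "lorentz (geo_exp X p r (L u)) (geo_exp X p r (L u)) = - 1"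
    using Hyperbolic bil[of "cosh r" p "sinh r" "L u"] by (simp add: cosh_square_eq)
  moreover have "snd (geo_exp X p r (L u)) > 0"
    using U Hyperbolic norm_ge_zero[of "fst (geo_exp X p r (L u))"] by (simp del: norm_ge_zero)
  ultimately show ?thesis
    using Hyperbolic by simp
qed

lemma geo_exp_eventually_in:
  fixes p :: "'a::euclidean_space \<times> real"
  assumes L: "tangent_frame X p L" and W: "open W" "p \<in> W"
  shows "\<forall>\<^sub>F r in at_right 0. \<forall>u\<in>sphere 0 1. geo_exp X p r (L u) \<in> W"
proof -
  obtain e where e: "e > 0" "ball p e \<subseteq> W"
    using W open_contains_ball by blast
  obtain b where b: "\<And>u. norm (L u) \<le> b * norm u"
    using L linear_bounded[of L] by (auto simp: tangent_frame_def)
  have "((\<lambda>r. \<bar>exp_cos X r - 1\<bar> * norm p + \<bar>exp_sin X r\<bar> * b) \<longlongrightarrow> \<bar>1 - 1\<bar> * norm p + \<bar>0\<bar> * b) (at_right 0)"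
    by (intro tendsto_intros exp_cos_tendsto exp_sin_tendsto)
  then have "\<forall>\<^sub>F r in at_right 0. \<bar>exp_cos X r - 1\<bar> * norm p + \<bar>exp_sin X r\<bar> * b < e"
    using e(1) by (intro order_tendstoD(2)) auto
  then show ?thesis
  proof eventually_elim
    case (elim r)
    show ?case
    proof
      fix u :: 'a assume "u \<in> sphere 0 1"
      then have u: "norm (L u) \<le> b"
        using b[of u] by simp
      have "geo_exp X p r (L u) - p = (exp_cos X r - 1) *\<^sub>R p + exp_sin X r *\<^sub>R L u"
        by (simp add: geo_exp_eq algebra_simps)
      then have "norm (geo_exp X p r (L u) - p) \<le> \<bar>exp_cos X r - 1\<bar> * norm p + \<bar>exp_sin X r\<bar> * norm (L u)"
        by (metis norm_scaleR norm_triangle_ineq)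
      also have "\<dots> \<le> \<bar>exp_cos X r - 1\<bar> * norm p + \<bar>exp_sin X r\<bar> * b"
        using u by (intro add_left_mono mult_left_mono) auto
      finally show "geo_exp X p r (L u) \<in> W"
        using elim e(2) by (auto simp: dist_norm norm_minus_commute)
    qed
  qed
qed

section \<open>Angles\<close>

lemma radial_cone_mono: "S \<subseteq> T \<Longrightarrow> radial_cone S \<subseteq> radial_cone T"
  unfolding radial_cone_def by blast

lemma radial_cone_Un: "radial_cone (S \<union> T) = radial_cone S \<union> radial_cone T"
  unfolding radial_cone_def by blast

lemma radial_cone_unit_sphere: "radial_cone (sphere (0::'a::euclidean_space) 1) = cball 0 1"
proof (intro equalityI subsetI)
  fix x :: 'a assume x: "x \<in> cball 0 1"
  show "x \<in> radial_cone (sphere 0 1)"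
  proof (cases "x = 0")
    case True
    obtain b :: 'a where "b \<in> Basis"
      using nonempty_Basis by blast
    then show ?thesis
      unfolding radial_cone_def using True by (auto intro!: exI[of _ "0::real"] exI[of _ b])
  next
    case False
    then have "x = norm x *\<^sub>R sgn x" "norm (sgn x) = 1"
      by (simp_all add: sgn_div_norm)
    then show ?thesis
      unfolding radial_cone_def using x by (intro CollectI exI[of _ "norm x"] exI[of _ "sgn x"]) auto
  qed
qed (auto simp: radial_cone_def)

lemma radial_cone_sets_borel:
  fixes U :: "'a::euclidean_space set"
  assumes "openin (top_of_set (sphere 0 1)) U"
  shows "radial_cone U \<in> sets borel"
proof (cases "U = {}")
  case True
  then show ?thesis
    by (simp add: radial_cone_def)
next
  case False
  obtain W where W: "open W" "U = sphere 0 1 \<inter> W"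
    using assms by (auto simp: openin_open)
  let ?V = "- {0} \<inter> sgn -` W"
  have "continuous_on (- {0::'a}) sgn"
    by (intro continuous_intros) auto
  then have "open ?V"
    using W(1) by (intro continuous_open_preimage) auto
  moreover have "radial_cone U = {0} \<union> (cball 0 1 \<inter> ?V)"
  proof (intro equalityI subsetI)
    fix x assume "x \<in> radial_cone U"
    then obtain s q where sq: "x = s *\<^sub>R q" "0 \<le> s" "s \<le> 1" "q \<in> U"
      by (auto simp: radial_cone_def)
    show "x \<in> {0} \<union> (cball 0 1 \<inter> ?V)"
    proof (cases "s = 0")
      case False
      then have "sgn x = q"
        using sq W(2) by (simp add: sgn_scaleR sgn_div_norm)
      then show ?thesis
        using sq W(2) by auto
    qed (use sq in auto)
  next
    fix x assume x: "x \<in> {0} \<union> (cball 0 1 \<inter> ?V)"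
    show "x \<in> radial_cone U"
    proof (cases "x = 0")
      case True
      obtain q where "q \<in> U"
        using False by blast
      then show ?thesis
        unfolding radial_cone_def using True by (auto intro!: exI[of _ "0::real"] exI[of _ q])
    next
      case False
      then have "sgn x \<in> U"
        using x W(2) by (auto simp: norm_sgn)
      then show ?thesis
        unfolding radial_cone_def using x False
        by (intro CollectI exI[of _ "norm x"] exI[of _ "sgn x"]) (auto simp: sgn_div_norm)
    qed
  qed
  ultimately show ?thesis
    by simp
qed

lemma measure_almost_disjoint_Un:
  assumes "S \<in> lmeasurable" "T \<in> lmeasurable" "negligible (S \<inter> T)" "S \<union> T \<subseteq> V" "negligible (V - (S \<union> T))"
  shows "measure lebesgue V = measure lebesgue S + measure lebesgue T"
proof -
  have "measure lebesgue (S \<union> T) = measure lebesgue S + measure lebesgue T"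
    using measure_Un3[OF assms(1,2)] negligible_imp_measure0[OF assms(3)] by simp
  moreover have "measure lebesgue V = measure lebesgue (S \<union> T)"
  proof (rule measure_negligible_symdiff)
    have "S \<union> T - V \<union> (V - (S \<union> T)) = V - (S \<union> T)"
      using assms(4) by blast
    then show "negligible (S \<union> T - V \<union> (V - (S \<union> T)))"
      using assms(5) by simp
  qed (use assms in blast)
  ultimately show ?thesis
    by simp
qed

text \<open>The cones over \<open>U\<close> and \<open>V\<close> share at most the origin, and the
  part of the ball outside both lies in \<open>Z\<close>, because \<open>Z\<close> is closed under
  scaling.\<close>

lemma unit_sphere_fraction_complementary:
  fixes U V Z :: "'a::euclidean_space set"
  assumes U: "openin (top_of_set (sphere 0 1)) U" and V: "openin (top_of_set (sphere 0 1)) V"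
    and "U \<inter> V = {}" and Z: "negligible Z" "\<And>x c. x \<in> Z \<Longrightarrow> c *\<^sub>R x \<in> Z" and cover: "sphere 0 1 \<subseteq> U \<union> V \<union> Z"
  shows "unit_sphere_fraction U + unit_sphere_fraction V = 1"
proof -
  have UV: "U \<subseteq> sphere 0 1" "V \<subseteq> sphere 0 1"
    using U V openin_imp_subset by auto
  have sub: "radial_cone U \<subseteq> cball 0 1" "radial_cone V \<subseteq> cball 0 1"
    using UV[THEN radial_cone_mono] by (simp_all add: radial_cone_unit_sphere)
  then have meas: "radial_cone U \<in> lmeasurable" "radial_cone V \<in> lmeasurable"
    using radial_cone_sets_borel[OF U] radial_cone_sets_borel[OF V]
    by (auto intro!: bounded_set_imp_lmeasurable intro: bounded_subset[OF bounded_cball])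
  have "radial_cone U \<inter> radial_cone V \<subseteq> {0}"
  proof
    fix x assume "x \<in> radial_cone U \<inter> radial_cone V"
    then have "x \<in> radial_cone U" "x \<in> radial_cone V"
      by auto
    then obtain s q s' q' where x: "x = s *\<^sub>R q" "0 \<le> s" "q \<in> U" "x = s' *\<^sub>R q'" "0 \<le> s'" "q' \<in> V"
      unfolding radial_cone_def by blast
    have "norm q = 1" "norm q' = 1"
      using x(3,6) UV by auto
    then have "norm x = s" "norm x = s'"
      using x(1,2) x(4,5) by (simp, metis abs_of_nonneg mult.right_neutral norm_scaleR)
    with x \<open>U \<inter> V = {}\<close> show "x \<in> {0}"
      by (cases "s = 0") auto
  qed
  then have "negligible (radial_cone U \<inter> radial_cone V)"
    using negligible_subset negligible_sing by blast
  moreover have "cball 0 1 - (radial_cone U \<union> radial_cone V) \<subseteq> Z"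
  proof
    fix x assume x: "x \<in> cball 0 1 - (radial_cone U \<union> radial_cone V)"
    then obtain s q where sq: "x = s *\<^sub>R q" "0 \<le> s" "s \<le> 1" "q \<in> sphere 0 1"
      unfolding radial_cone_unit_sphere[symmetric] by (auto simp: radial_cone_def)
    then have "q \<notin> U" "q \<notin> V"
      using x by (auto simp: radial_cone_def)
    then show "x \<in> Z"
      using sq cover Z(2) by auto
  qed
  then have "negligible (cball 0 1 - (radial_cone U \<union> radial_cone V))"
    using Z(1) negligible_subset by blast
  ultimately have "measure lebesgue (cball (0::'a) 1) = measure lebesgue (radial_cone U) + measure lebesgue (radial_cone V)"
    using sub by (intro measure_almost_disjoint_Un meas) auto
  then have "measure lborel (cball (0::'a) 1) = measure lborel (radial_cone U) + measure lborel (radial_cone V)"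
    using radial_cone_sets_borel[OF U] radial_cone_sets_borel[OF V] by simp
  moreover have "measure lborel (cball (0::'a) 1) > 0"
    using content_cball_pos[of 1 "0::'a"] by simp
  ultimately show ?thesis
    by (simp add: unit_sphere_fraction_def radial_cone_unit_sphere flip: add_divide_distrib)
qed

text \<open>\<open>p\<close> is not tangent to the model at itself, so \<open>p\<close> and the
  tangent space span everything. A nonzero normal that vanishes at \<open>p\<close> therefore cannot
  vanish on all tangent vectors, and its zero directions form a hyperplane.\<close>

lemma tangent_frame_hyperplane_negligible:
  fixes p n :: "'a::euclidean_space \<times> real"
  assumes p: "p \<in> model_space X" and L: "tangent_frame X p L" and n: "n \<noteq> 0" "n \<bullet> p = 0"
  shows "negligible {u. n \<bullet> L u = 0}"
proof -
  have lin: "linear L"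
    using L by (simp add: tangent_frame_def)
  have "inj L"
  proof (rule linear_injective_0[OF lin, THEN iffD2], intro allI impI)
    fix v assume "L v = 0"
    moreover have "metric_form X (L v) (L v) = v \<bullet> v"
      using L by (simp add: tangent_frame_def)
    moreover have "metric_form X (0 :: 'a \<times> real) 0 = 0"
      by (cases X) (auto simp: lorentz_def)
    ultimately show "v = 0"
      by simp
  qed
  then have dim: "dim (range L) = DIM('a)"
    using dim_image_eq[OF lin, of UNIV] by (simp add: inj_on_subset)
  have "\<not> tangent_vector X p p"
    using p by (cases X) (auto simp: dot_square_norm)
  then have "p \<notin> range L"
    using L by (auto simp: tangent_frame_def)
  moreover have "span (range L) = range L"
    using linear_subspace_image[OF lin subspace_UNIV] span_eq_iff by blast
  ultimately have "p \<notin> span (range L)"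
    by metis
  then have "dim (insert p (range L)) = DIM('a \<times> real)"
    by (simp add: dim_insert dim)
  then have span: "span (insert p (range L)) = UNIV"
    using dim_eq_full by blast
  have "\<exists>u. n \<bullet> L u \<noteq> 0"
  proof (rule ccontr)
    assume "\<nexists>u. n \<bullet> L u \<noteq> 0"
    then have "insert p (range L) \<subseteq> {x. n \<bullet> x = 0}"
      using n(2) by auto
    then have "span (insert p (range L)) \<subseteq> {x. n \<bullet> x = 0}"
      by (intro span_minimal subspace_hyperplane)
    then have "n \<bullet> n = 0"
      using span by blast
    with n(1) show False
      by simp
  qed
  then obtain u where u: "adjoint L n \<bullet> u \<noteq> 0"
    using adjoint_works[OF lin] by (metis inner_commute)
  then have "adjoint L n \<noteq> 0"
    by auto
  then have "negligible {u. adjoint L n \<bullet> u = 0}"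
    by (intro negligible_hyperplane) auto
  moreover have "adjoint L n \<bullet> v = n \<bullet> L v" for v
    using adjoint_works[OF lin] by (metis inner_commute)
  ultimately show ?thesis
    by simp
qed

text \<open>A normal that is nonzero at \<open>p\<close> keeps its sign nearby; one that vanishes at
  \<open>p\<close> sees only the tangential term, whose factor \<open>exp_sin X r\<close> is
  positive. The resulting sign vector no longer depends on \<open>r\<close>, and one bound on
  \<open>r\<close> serves all directions.\<close>

lemma eventually_sign_vector:
  fixes p :: "'a::euclidean_space \<times> real"
  assumes p: "p \<in> model_space X" and L: "tangent_frame X p L" and K: "finite K"
  shows "\<forall>\<^sub>F r in at_right 0. \<forall>u\<in>sphere 0 1. geo_exp X p r (L u) \<in> model_space X \<and>
     (\<forall>n\<in>K. sgn (n \<bullet> geo_exp X p r (L u)) = (if n \<bullet> p = 0 then sgn (n \<bullet> L u) else sgn (n \<bullet> p)))"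
proof -
  let ?K = "(\<lambda>n. (- (n \<bullet> p)) *\<^sub>R n) ` {n \<in> K. n \<bullet> p \<noteq> 0}"
  let ?W = "{z. \<forall>n\<in>?K. n \<bullet> z < 0}"
  have "open ?W"
    using K by (intro open_strict_halfspaces) simp
  moreover have "p \<in> ?W"
  proof (intro CollectI ballI)
    fix n assume "n \<in> ?K"
    then obtain k where k: "k \<bullet> p \<noteq> 0" "n = (- (k \<bullet> p)) *\<^sub>R k"
      by blast
    have "0 < (k \<bullet> p) * (k \<bullet> p)"
      using k(1) not_real_square_gt_zero by blast
    then show "n \<bullet> p < 0"
      by (simp add: k(2))
  qed
  ultimately have "\<forall>\<^sub>F r in at_right 0. \<forall>u\<in>sphere 0 1. geo_exp X p r (L u) \<in> ?W"
    by (rule geo_exp_eventually_in[OF L])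
  moreover have "p \<in> model_cone X"
    using p model_space_subset_cone by blast
  then have "\<forall>\<^sub>F r in at_right 0. \<forall>u\<in>sphere 0 1. geo_exp X p r (L u) \<in> model_cone X"
    by (rule geo_exp_eventually_in[OF L open_model_cone])
  moreover note exp_sin_pos[of X]
  ultimately show ?thesis
  proof eventually_elim
    case (elim r)
    show ?case
    proof (intro ballI conjI)
      fix u :: 'a assume u: "u \<in> sphere 0 1"
      show "geo_exp X p r (L u) \<in> model_space X"
        using elim u by (intro geo_exp_in_model[OF p L]) auto
      fix n assume n: "n \<in> K"
      show "sgn (n \<bullet> geo_exp X p r (L u)) = (if n \<bullet> p = 0 then sgn (n \<bullet> L u) else sgn (n \<bullet> p))"
      proof (cases "n \<bullet> p = 0")
        case True
        then have "n \<bullet> geo_exp X p r (L u) = exp_sin X r * (n \<bullet> L u)"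
          by (simp add: geo_exp_eq inner_add_right)
        then show ?thesis
          using True elim(3) by (simp add: sgn_mult)
      next
        case False
        then have "(- (n \<bullet> p)) *\<^sub>R n \<in> ?K"
          using n by blast
        then have "(- (n \<bullet> p)) *\<^sub>R n \<bullet> geo_exp X p r (L u) < 0"
          using elim(1) u by blast
        then have "0 < (n \<bullet> p) * (n \<bullet> geo_exp X p r (L u))"
          by simp
        then show ?thesis
          using False by (auto simp: zero_less_mult_iff)
      qed
    qed
  qed
qed

text \<open>For small radii the sign vector at a direction is independent of the radius, and it
  decides membership in the interior. This makes the description by \<open>THE\<close> in
  \<open>face_angle\<close> denote an actual value.\<close>

lemma interior_directions_eventually_constant:
  fixes p :: "'a::euclidean_space \<times> real"
  assumes A: "geometric_complex X \<A>" and p: "p \<in> model_space X" and L: "tangent_frame X p L"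
  obtains U where "openin (top_of_set (sphere 0 1)) U"
    "\<forall>\<^sub>F r in at_right 0. {u \<in> sphere 0 1. geo_exp X p r (L u) \<in> complex_interior X \<A>} = U"
proof -
  let ?S = "\<lambda>r. {u \<in> sphere 0 1. geo_exp X p r (L u) \<in> complex_interior X \<A>}"
  obtain K where K: "finite K"
    "\<And>x y. x \<in> model_space X \<Longrightarrow> y \<in> model_space X \<Longrightarrow> (\<And>n. n \<in> K \<Longrightarrow> sgn (n \<bullet> x) = sgn (n \<bullet> y)) \<Longrightarrow>
      x \<in> \<Union>\<A> \<Longrightarrow> y \<in> \<Union>\<A>"
    using complex_hyperplanes[OF A] by metis
  define P where "P = (\<lambda>r. \<forall>u\<in>sphere 0 1. geo_exp X p r (L u) \<in> model_space X \<and>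
     (\<forall>n\<in>K. sgn (n \<bullet> geo_exp X p r (L u)) = (if n \<bullet> p = 0 then sgn (n \<bullet> L u) else sgn (n \<bullet> p))))"
  have P: "\<forall>\<^sub>F r in at_right 0. P r"
    unfolding P_def by (rule eventually_sign_vector[OF p L K(1)])
  have sub: "?S r \<subseteq> ?S r'" if "P r" "P r'" for r r'
  proof
    fix u assume u: "u \<in> ?S r"
    have "geo_exp X p r' (L u) \<in> complex_interior X \<A>"
    proof (rule complex_interior_sign_vector[where K = K and x = "geo_exp X p r (L u)"])
      show "finite K"
        by (rule K(1))
      show "y \<in> \<Union>\<A>" if "x \<in> model_space X" "y \<in> model_space X" "\<And>n. n \<in> K \<Longrightarrow> sgn (n \<bullet> x) = sgn (n \<bullet> y)"
        "x \<in> \<Union>\<A>" for x y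
        by (rule K(2)[OF that])
      show "geo_exp X p r (L u) \<in> complex_interior X \<A>"
        using u by simp
      show "geo_exp X p r' (L u) \<in> model_space X"
        using u that(2) unfolding P_def by blast
      show "sgn (n \<bullet> geo_exp X p r (L u)) = sgn (n \<bullet> geo_exp X p r' (L u))" if "n \<in> K" for n
        using u \<open>P r\<close> \<open>P r'\<close> that unfolding P_def by simp
    qed
    with u show "u \<in> ?S r'"
      by blast
  qed
  obtain r0 where r0: "P r0"
    using eventually_happens'[OF trivial_limit_at_right_real P] by blast
  show thesis
  proof
    show "\<forall>\<^sub>F r in at_right 0. ?S r = ?S r0"
      using P by eventually_elim (use sub r0 in blast)
    have "linear L"
      using L by (simp add: tangent_frame_def)
    then have "continuous_on (sphere 0 1) L"
      by (simp add: linear_continuous_on linear_conv_bounded_linear)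
    then have "continuous_on (sphere 0 1) (\<lambda>u. geo_exp X p r0 (L u))"
      unfolding geo_exp_eq by (intro continuous_intros)
    then have "openin (top_of_set (sphere 0 1)) (sphere 0 1 \<inter> (\<lambda>u. geo_exp X p r0 (L u)) -` complex_interior X \<A>)"
      by (rule continuous_openin_preimage[OF _ _ openin_complex_interior]) (use r0 in \<open>auto simp: P_def\<close>)
    moreover have "sphere 0 1 \<inter> (\<lambda>u. geo_exp X p r0 (L u)) -` complex_interior X \<A> = ?S r0"
      by blast
    ultimately show "openin (top_of_set (sphere 0 1)) (?S r0)"
      by simp
  qed
qed

lemma eventually_const_the:
  assumes "\<forall>\<^sub>F r in at_right (0::real). f r = c"
  shows "(THE a. \<forall>\<^sub>F r in at_right 0. f r = a) = c"
proof (rule the_equality)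
  show "\<forall>\<^sub>F r in at_right 0. f r = c"
    by (fact assms)
  fix a assume "\<forall>\<^sub>F r in at_right 0. f r = a"
  with assms have "\<forall>\<^sub>F r in at_right (0::real). a = c"
    by eventually_elim simp
  then show "a = c"
    by simp
qed

text \<open>The locality assumption ranges over all relative interior points because the centre is
  an unspecified choice; both complexes use the same centre and the same frame.\<close>

lemma face_angle_local:
  fixes F :: "('a::euclidean_space \<times> real) set"
  assumes F: "geo_cell X F" "F \<noteq> {}"
    and loc: "\<And>p. p \<in> cell_rel_interior X F \<Longrightarrow>
      \<exists>W. open W \<and> p \<in> W \<and> complex_interior X \<A> \<inter> W = complex_interior X \<B> \<inter> W"
  shows "face_angle X F \<A> = face_angle X F \<B>"
proof -
  define p where "p = (SOME p. p \<in> cell_rel_interior X F)"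
  have p: "p \<in> cell_rel_interior X F"
    unfolding p_def by (rule someI_ex) (use cell_rel_interior_nonempty[OF F] in blast)
  then have pM: "p \<in> model_space X"
    using F cell_rel_interior_iff by (metis geo_cell_def)
  define L where "L = (SOME L. tangent_frame X p L)"
  have L: "tangent_frame X p L"
    unfolding L_def by (rule someI_ex[OF ex_tangent_frame[OF pM]])
  obtain W where W: "open W" "p \<in> W" "complex_interior X \<A> \<inter> W = complex_interior X \<B> \<inter> W"
    using loc[OF p] by blast
  have "\<forall>\<^sub>F r in at_right 0. sphere_fraction X p r (complex_interior X \<A>) = sphere_fraction X p r (complex_interior X \<B>)"
    using geo_exp_eventually_in[OF L W(1,2)]
  proof eventually_elim
    case (elim r)
    then have "{u \<in> sphere 0 1. geo_exp X p r (L u) \<in> complex_interior X \<A>} =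
        {u \<in> sphere 0 1. geo_exp X p r (L u) \<in> complex_interior X \<B>}"
      using W(3) by blast
    then show ?case
      by (simp add: sphere_fraction_def L_def[symmetric])
  qed
  then have "(\<forall>\<^sub>F r in at_right 0. sphere_fraction X p r (complex_interior X \<A>) = a) \<longleftrightarrow>
     (\<forall>\<^sub>F r in at_right 0. sphere_fraction X p r (complex_interior X \<B>) = a)" for a
    by (rule eventually_cong[OF _ ]) simp
  then show ?thesis
    by (simp add: face_angle_def p_def[symmetric])
qed

text \<open>A small sphere around \<open>p\<close> lies in the union of the two complexes, so a
  direction entering neither interior puts its point on one of finitely many hyperplanes. Near
  \<open>p\<close> such a hyperplane must pass through \<open>p\<close>, which confines these
  directions to the null set \<open>Z\<close>.\<close>

lemma face_angles_complementary:
  fixes F :: "('a::euclidean_space \<times> real) set"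
  assumes A: "geometric_complex X \<A>" and B: "geometric_complex X \<B>" and F: "geo_cell X F" "F \<noteq> {}"
    and disj: "complex_interior X \<A> \<inter> complex_interior X \<B> = {}"
    and cover: "\<And>p. p \<in> cell_rel_interior X F \<Longrightarrow> \<exists>W. open W \<and> p \<in> W \<and> model_space X \<inter> W \<subseteq> \<Union>\<A> \<union> \<Union>\<B>"
  shows "face_angle X F \<A> + face_angle X F \<B> = 1"
proof -
  define p where "p = (SOME p. p \<in> cell_rel_interior X F)"
  have p: "p \<in> cell_rel_interior X F"
    unfolding p_def by (rule someI_ex) (use cell_rel_interior_nonempty[OF F] in blast)
  then have pM: "p \<in> model_space X"
    using F cell_rel_interior_iff by (metis geo_cell_def)
  define L where "L = (SOME L. tangent_frame X p L)"
  have L: "tangent_frame X p L"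
    unfolding L_def by (rule someI_ex[OF ex_tangent_frame[OF pM]])
  have angle: "face_angle X F \<D> = unit_sphere_fraction U"
    if "\<forall>\<^sub>F r in at_right 0. {u \<in> sphere 0 1. geo_exp X p r (L u) \<in> complex_interior X \<D>} = U" for \<D> U
  proof -
    have "\<forall>\<^sub>F r in at_right 0. sphere_fraction X p r (complex_interior X \<D>) = unit_sphere_fraction U"
      using that by eventually_elim (simp add: sphere_fraction_def L_def[symmetric])
    then show ?thesis
      by (simp add: face_angle_def p_def[symmetric] eventually_const_the)
  qed
  obtain U where U: "openin (top_of_set (sphere 0 1)) U"
    "\<forall>\<^sub>F r in at_right 0. {u \<in> sphere 0 1. geo_exp X p r (L u) \<in> complex_interior X \<A>} = U"
    using interior_directions_eventually_constant[OF A pM L] .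
  obtain V where V: "openin (top_of_set (sphere 0 1)) V"
    "\<forall>\<^sub>F r in at_right 0. {u \<in> sphere 0 1. geo_exp X p r (L u) \<in> complex_interior X \<B>} = V"
    using interior_directions_eventually_constant[OF B pM L] .
  obtain K1 where K1: "finite K1" "0 \<notin> K1"
    "\<And>x. x \<in> \<Union>\<A> \<Longrightarrow> x \<notin> complex_interior X \<A> \<Longrightarrow> \<exists>n\<in>K1. n \<bullet> x = 0"
    using complex_hyperplanes[OF A] by metis
  obtain K2 where K2: "finite K2" "0 \<notin> K2"
    "\<And>x. x \<in> \<Union>\<B> \<Longrightarrow> x \<notin> complex_interior X \<B> \<Longrightarrow> \<exists>n\<in>K2. n \<bullet> x = 0"
    using complex_hyperplanes[OF B] by metis
  define Z where "Z = (\<Union>n\<in>{n \<in> K1 \<union> K2. n \<bullet> p = 0}. {u. n \<bullet> L u = 0})"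
  obtain W where W: "open W" "p \<in> W" "model_space X \<inter> W \<subseteq> \<Union>\<A> \<union> \<Union>\<B>"
    using cover[OF p] by blast
  have "\<forall>\<^sub>F r in at_right (0::real). U \<inter> V = {} \<and> sphere 0 1 \<subseteq> U \<union> V \<union> Z"
    using U(2) V(2) eventually_sign_vector[OF pM L finite_UnI[OF K1(1) K2(1)]] geo_exp_eventually_in[OF L W(1,2)]
  proof eventually_elim
    case (elim r)
    have "u \<in> U \<union> V \<union> Z" if u: "u \<in> sphere 0 1" for u
    proof (cases "u \<in> U \<union> V")
      case False
      let ?x = "geo_exp X p r (L u)"
      have x: "?x \<notin> complex_interior X \<A>" "?x \<notin> complex_interior X \<B>"
        using False u elim(1,2) by blast+
      have "?x \<in> \<Union>\<A> \<union> \<Union>\<B>"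
        using u elim(3,4) W(3) by blast
      then obtain n where n: "n \<in> K1 \<union> K2" "n \<bullet> ?x = 0"
        using K1(3)[OF _ x(1)] K2(3)[OF _ x(2)] by blast
      then have "(if n \<bullet> p = 0 then sgn (n \<bullet> L u) else sgn (n \<bullet> p)) = 0"
        using elim(3) u by (metis sgn_zero)
      then have "n \<bullet> p = 0" "n \<bullet> L u = 0"
        by (auto simp: sgn_zero_iff split: if_splits)
      then show ?thesis
        using n(1) unfolding Z_def by blast
    qed blast
    moreover have "U \<inter> V = {}"
      using elim(1,2) disj by blast
    ultimately show ?case
      by blast
  qed
  then have UV: "U \<inter> V = {}" "sphere 0 1 \<subseteq> U \<union> V \<union> Z"
    using eventually_happens'[OF trivial_limit_at_right_real] by blast+
  have "negligible Z"
    unfolding Z_def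
  proof (rule negligible_Union)
    show "finite ((\<lambda>n. {u. n \<bullet> L u = 0}) ` {n \<in> K1 \<union> K2. n \<bullet> p = 0})"
      using K1(1) K2(1) by simp
    fix S assume "S \<in> (\<lambda>n. {u. n \<bullet> L u = 0}) ` {n \<in> K1 \<union> K2. n \<bullet> p = 0}"
    then obtain n where n: "n \<in> K1 \<union> K2" "n \<bullet> p = 0" "S = {u. n \<bullet> L u = 0}"
      by blast
    then have "n \<noteq> 0"
      using K1(2) K2(2) by blast
    then show "negligible S"
      unfolding n(3) using n(2) by (rule tangent_frame_hyperplane_negligible[OF pM L])
  qed
  moreover have "c *\<^sub>R x \<in> Z" if "x \<in> Z" for x c
    using that L by (auto simp: Z_def tangent_frame_def linear_scale)
  ultimately have "unit_sphere_fraction U + unit_sphere_fraction V = 1"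
    using unit_sphere_fraction_complementary[OF U(1) V(1) UV(1)] UV(2) by blast
  then show ?thesis
    using angle[OF U(2)] angle[OF V(2)] by simp
qed

section \<open>Gluings\<close>

lemma compact_radial_cone:
  fixes S :: "'a::euclidean_space set"
  assumes "compact S"
  shows "compact (radial_cone S)"
proof -
  have "radial_cone S = (\<lambda>z. fst z *\<^sub>R snd z) ` ({0..1} \<times> S)"
    by (force simp: radial_cone_def)
  moreover have "compact ((\<lambda>z. fst z *\<^sub>R snd z) ` ({0..1::real} \<times> S))"
    by (intro compact_continuous_image continuous_intros compact_Times assms compact_Icc)
  ultimately show ?thesis
    by simp
qed

text \<open>A ray meets the model at most once, so away from 0 the two cones overlap only over
  common points of the complexes. These are not interior to \<open>\<A>\<close>, hence lie on
  finitely many linear hyperplanes, and so do the rays through them.\<close>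

lemma normalized_volume_gluing:
  fixes \<A> \<B> \<C> :: "('a::euclidean_space \<times> real) set set"
  assumes A: "geometric_complex X \<A>" and B: "geometric_complex X \<B>"
    and C: "\<Union>\<C> = \<Union>\<A> \<union> \<Union>\<B>" and AB: "\<Union>\<A> \<inter> \<Union>\<B> \<inter> complex_interior X \<A> = {}"
  shows "normalized_volume X \<C> = normalized_volume X \<A> + normalized_volume X \<B>"
proof -
  have cpt: "compact (\<Union>\<A>)" "compact (\<Union>\<B>)"
    using closed_Union_complex[OF A] closed_Union_complex[OF B] by (simp_all add: compact_eq_bounded_closed)
  obtain K where K: "finite K" "0 \<notin> K"
    "\<And>x. x \<in> \<Union>\<A> \<Longrightarrow> x \<notin> complex_interior X \<A> \<Longrightarrow> \<exists>n\<in>K. n \<bullet> x = 0"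
    using complex_hyperplanes[OF A] by metis
  let ?Z = "\<Union>((\<lambda>n. {x. n \<bullet> x = 0}) ` K)"
  have "negligible ?Z"
  proof (rule negligible_Union)
    fix S assume "S \<in> (\<lambda>n. {x. n \<bullet> x = 0}) ` K"
    then obtain n where "n \<in> K" "S = {x. n \<bullet> x = 0}"
      by blast
    with K(2) show "negligible S"
      using negligible_hyperplane[of n 0] by metis
  qed (use K(1) in simp)
  then have "negligible (insert 0 ?Z)"
    by simp
  moreover have "radial_cone (\<Union>\<A>) \<inter> radial_cone (\<Union>\<B>) \<subseteq> insert 0 ?Z"
  proof
    fix x assume "x \<in> radial_cone (\<Union>\<A>) \<inter> radial_cone (\<Union>\<B>)"
    then have "x \<in> radial_cone (\<Union>\<A>)" "x \<in> radial_cone (\<Union>\<B>)"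
      by simp_all
    then obtain s q s' q' where x: "x = s *\<^sub>R q" "0 \<le> s" "q \<in> \<Union>\<A>" "x = s' *\<^sub>R q'" "0 \<le> s'" "q' \<in> \<Union>\<B>"
      unfolding radial_cone_def by blast
    show "x \<in> insert 0 ?Z"
    proof (cases "x = 0")
      case False
      then have "s > 0" "s' > 0"
        using x by (metis order_le_less scaleR_zero_left)+
      have M: "q \<in> model_space X" "q' \<in> model_space X"
        using x closed_Union_complex(3)[OF A] closed_Union_complex(3)[OF B] by blast+
      then have "radial_proj X x = q" "radial_proj X x = q'"
        using x(1,4) \<open>s > 0\<close> \<open>s' > 0\<close> radial_proj_scale radial_proj_id model_space_subset_cone by (metis subsetD)+
      then have "q \<notin> complex_interior X \<A>"
        using x(3,6) AB by blast
      then obtain n where "n \<in> K" "n \<bullet> q = 0"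
        using K(3) x(3) by blast
      then show ?thesis
        using x(1) by force
    qed simp
  qed
  ultimately have "negligible (radial_cone (\<Union>\<A>) \<inter> radial_cone (\<Union>\<B>))"
    by (rule negligible_subset)
  then have "measure lebesgue (radial_cone (\<Union>\<C>)) = measure lebesgue (radial_cone (\<Union>\<A>)) + measure lebesgue (radial_cone (\<Union>\<B>))"
    using cpt[THEN compact_radial_cone]
    by (intro measure_almost_disjoint_Un lmeasurable_compact) (simp_all add: C radial_cone_Un)
  moreover have "compact (radial_cone (\<Union>\<C>))"
    using cpt[THEN compact_radial_cone] by (simp add: C radial_cone_Un compact_Un)
  ultimately have "measure lborel (radial_cone (\<Union>\<C>)) = measure lborel (radial_cone (\<Union>\<A>)) + measure lborel (radial_cone (\<Union>\<B>))"
    using cpt[THEN compact_radial_cone] by (simp add: borel_compact)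
  then show ?thesis
    by (simp add: normalized_volume_def geo_volume_def algebra_simps add_divide_distrib)
qed

text \<open>A small move from \<open>x\<close> towards a point of the relative interior of the cone
  enters that relative interior; projecting back to the model is continuous and fixes
  \<open>x\<close>, so the result stays in \<open>T\<close>.\<close>

lemma cell_rel_interior_dense:
  assumes F: "geo_cell X F" "x \<in> F" and T: "open T" "x \<in> T"
  shows "\<exists>y\<in>cell_rel_interior X F. y \<in> T"
proof -
  have M: "F \<subseteq> model_space X" and conv: "convex (conic hull F)" and ne: "F \<noteq> {}"
    using F by (auto simp: geo_cell_def)
  obtain p where p: "p \<in> rel_interior (conic hull F)"
    using cell_rel_interior_nonempty[OF F(1) ne] cell_rel_interior_iff[OF M ne] by blast
  let ?O = "model_cone X \<inter> radial_proj X -` T"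
  have "open ?O"
    using continuous_on_radial_proj open_model_cone T(1) by (rule continuous_open_preimage)
  moreover have "x \<in> ?O"
    using F(2) M T(2) model_space_subset_cone radial_proj_id by fastforce
  moreover have "((\<lambda>t. x - t *\<^sub>R (x - p)) \<longlongrightarrow> x - 0 *\<^sub>R (x - p)) (at_right 0)"
    by (intro tendsto_intros)
  then have "((\<lambda>t. x - t *\<^sub>R (x - p)) \<longlongrightarrow> x) (at_right 0)"
    by simp
  ultimately have "\<forall>\<^sub>F t in at_right 0. x - t *\<^sub>R (x - p) \<in> ?O"
    by (metis topological_tendstoD)
  moreover have "\<forall>\<^sub>F t in at_right (0::real). t \<in> {0<..<1}"
    by (rule eventually_at_right_real) simp
  ultimately have "\<forall>\<^sub>F t in at_right 0. x - t *\<^sub>R (x - p) \<in> ?O \<and> t \<in> {0<..<1}"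
    by (rule eventually_conj)
  then obtain t where t: "x - t *\<^sub>R (x - p) \<in> ?O" "t \<in> {0<..<1}"
    using eventually_happens' trivial_limit_at_right_real by blast
  let ?y = "x - t *\<^sub>R (x - p)"
  have "x \<in> closure (conic hull F)"
    using F(2) closure_subset[of "conic hull F"] hull_inc[of x F conic] by blast
  then have "?y \<in> rel_interior (conic hull F)"
    using rel_interior_closure_convex_shrink[OF conv p] t(2) by simp
  then have "radial_proj X ?y \<in> rel_interior (conic hull F)"
    unfolding radial_proj_def using radial_norm_pos[of ?y X] t(1)
    by (intro rel_interior_conic_scale conic_conic_hull) simp_all
  then have "radial_proj X ?y \<in> cell_rel_interior X F"
    using t(1) radial_proj_in_model[of ?y X] cell_rel_interior_iff[OF M ne] by blast
  with t(1) show ?thesis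
    by blast
qed

section \<open>Faces and angles away from the common subcomplex\<close>

context
  fixes X :: geometry and \<A> \<B> \<C> :: "('a::euclidean_space \<times> real) set set"
  assumes A: "geometric_complex X \<A>" and B: "geometric_complex X \<B>"
    and C: "\<Union>\<C> = \<Union>\<A> \<union> \<Union>\<B>" and AB: "\<Union>\<A> \<inter> \<Union>\<B> = \<Union>(\<A> \<inter> \<B>)"
begin

text \<open>A common point would lie in a common cell \<open>G\<close>. A cell meeting
  \<open>F\<close> in its relative interior contains \<open>F\<close>, so \<open>F\<close> would be
  a face of \<open>G\<close> and thus belong to \<open>\<B>\<close>.\<close>

lemma gluing_rel_interior_notin:
  assumes F: "F \<in> \<A>" "F \<notin> \<B>" "F \<noteq> {}" and p: "p \<in> cell_rel_interior X F"
  shows "p \<notin> \<Union>\<B>"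
proof
  assume "p \<in> \<Union>\<B>"
  moreover have "p \<in> F"
    using p by (auto simp: cell_rel_interior_def interior_of_def)
  ultimately have "p \<in> \<Union>(\<A> \<inter> \<B>)"
    using AB F(1) by blast
  then obtain G where G: "G \<in> \<A>" "G \<in> \<B>" "p \<in> G"
    by blast
  then have "F \<subseteq> G"
    using complex_contains_cell[OF A F(1) G(1) F(3) p] by simp
  then have "geo_face X F G"
    using complex_subset_in[OF A G(1) F(1)] by simp
  then show False
    using complex_face[OF B G(2)] F(2) by simp
qed

text \<open>\<open>\<Union>\<B>\<close> is closed, so a neighbourhood of a point outside it can be
  shrunk until it sees only \<open>\<A>\<close>.\<close>

lemma gluing_interior_local: "complex_interior X \<C> \<inter> - \<Union>\<B> = complex_interior X \<A> \<inter> - \<Union>\<B>"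
proof
  show "complex_interior X \<A> \<inter> - \<Union>\<B> \<subseteq> complex_interior X \<C> \<inter> - \<Union>\<B>"
    using complex_interior_mono[of \<A> \<C> X] C by blast
  show "complex_interior X \<C> \<inter> - \<Union>\<B> \<subseteq> complex_interior X \<A> \<inter> - \<Union>\<B>"
  proof
    fix x assume x: "x \<in> complex_interior X \<C> \<inter> - \<Union>\<B>"
    then have "x \<in> complex_interior X \<C>"
      by simp
    then obtain W where W: "x \<in> model_space X" "open W" "x \<in> W" "model_space X \<inter> W \<subseteq> \<Union>\<C>"
      unfolding complex_interior_iff by blast
    have "open (W \<inter> - \<Union>\<B>)"
      using W(2) closed_Union_complex(1)[OF B] by (intro open_Int open_Compl)
    moreover have "x \<in> W \<inter> - \<Union>\<B>" "model_space X \<inter> (W \<inter> - \<Union>\<B>) \<subseteq> \<Union>\<A>"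
      using W x C by blast+
    ultimately have "x \<in> complex_interior X \<A>"
      unfolding complex_interior_iff using W(1) by blast
    with x show "x \<in> complex_interior X \<A> \<inter> - \<Union>\<B>"
      by blast
  qed
qed

text \<open>The two interiors may differ at points of \<open>F\<close> that lie in
  \<open>\<Union>\<B>\<close>. But an interior that meets \<open>F\<close> also contains relative
  interior points of \<open>F\<close>, by density, and these avoid
  \<open>\<Union>\<B>\<close>.\<close>

lemma gluing_boundary_iff:
  assumes F: "F \<in> \<A>" "F \<notin> \<B>" "F \<noteq> {}"
  shows "F \<inter> complex_interior X \<C> = {} \<longleftrightarrow> F \<inter> complex_interior X \<A> = {}"
proof
  show "F \<inter> complex_interior X \<C> = {} \<Longrightarrow> F \<inter> complex_interior X \<A> = {}"
    using complex_interior_mono[of \<A> \<C> X] C by blast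
  assume disj: "F \<inter> complex_interior X \<A> = {}"
  show "F \<inter> complex_interior X \<C> = {}"
  proof (rule ccontr)
    assume "F \<inter> complex_interior X \<C> \<noteq> {}"
    then obtain x where x: "x \<in> F" "x \<in> complex_interior X \<C>"
      by blast
    then obtain W where W: "open W" "x \<in> W" "model_space X \<inter> W \<subseteq> \<Union>\<C>"
      unfolding complex_interior_iff by blast
    obtain y where y: "y \<in> cell_rel_interior X F" "y \<in> W"
      using cell_rel_interior_dense[OF complex_cell[OF A F(1)] x(1) W(1,2)] by blast
    have "y \<in> F"
      using y(1) by (auto simp: cell_rel_interior_def interior_of_def)
    moreover have "F \<subseteq> model_space X"
      using complex_cell[OF A F(1)] by (simp add: geo_cell_def)
    ultimately have "y \<in> complex_interior X \<C>"
      using y(2) W unfolding complex_interior_iff by blast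
    then have "y \<in> complex_interior X \<A>"
      using gluing_interior_local gluing_rel_interior_notin[OF F y(1)] by blast
    with \<open>y \<in> F\<close> disj show False
      by blast
  qed
qed

lemma gluing_face_angle:
  assumes F: "F \<in> \<A>" "F \<notin> \<B>" "F \<noteq> {}"
  shows "face_angle X F \<C> = face_angle X F \<A>"
proof (rule face_angle_local[OF complex_cell[OF A F(1)] F(3)])
  fix p assume "p \<in> cell_rel_interior X F"
  then have "p \<in> - \<Union>\<B>"
    using gluing_rel_interior_notin[OF F] by blast
  moreover have "open (- \<Union>\<B>)"
    using closed_Union_complex(1)[OF B] by (rule open_Compl)
  ultimately show "\<exists>W. open W \<and> p \<in> W \<and> complex_interior X \<C> \<inter> W = complex_interior X \<A> \<inter> W"
    using gluing_interior_local by blast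
qed

end

text \<open>A cell that spans the ambient space has its relative interior open in the model, hence
  interior to the complex. So the degrees summed over in \<open>angle_char\<close> exhaust all
  nonempty boundary faces.\<close>

lemma boundary_cell_dim:
  fixes \<A> :: "('a::euclidean_space \<times> real) set set"
  assumes A: "geometric_complex X \<A>" and F: "F \<in> complex_boundary X \<A>" "F \<noteq> {}"
  shows "1 \<le> dim F" "dim F \<le> DIM('a)"
proof -
  have FA: "F \<in> \<A>" and disj: "F \<inter> complex_interior X \<A> = {}"
    using F by (auto simp: complex_boundary_def)
  have cell: "geo_cell X F"
    by (rule complex_cell[OF A FA])
  then have M: "F \<subseteq> model_space X"
    by (simp add: geo_cell_def)
  then have "\<not> F \<subseteq> {0}"
    using F(2) zero_notin_model_space by blast
  then show "1 \<le> dim F"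
    by (metis One_nat_def Suc_leI dim_eq_0 gr0I)
  show "dim F \<le> DIM('a)"
  proof (rule ccontr)
    assume "\<not> dim F \<le> DIM('a)"
    then have "dim F = DIM('a \<times> real)"
      using dim_subset_UNIV[of F] by simp
    then have span: "span F = UNIV"
      using dim_eq_full by blast
    obtain p where p: "p \<in> cell_rel_interior X F"
      using cell_rel_interior_nonempty[OF cell F(2)] by blast
    then have "p \<in> complex_interior X \<A>"
      using interior_of_mono[of F "\<Union>\<A>" "top_of_set (model_space X)"] FA
      unfolding cell_rel_interior_def complex_interior_def span by auto
    moreover have "p \<in> F"
      using p by (auto simp: cell_rel_interior_def interior_of_def)
    ultimately show False
      using disj by blast
  qed
qed

text \<open>The empty face drops out because its \<open>cell_dim\<close> is -1; the lower bound on
  \<open>dim F\<close> keeps the natural subtraction in the exponent from truncating.\<close>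

lemma angle_char_eq:
  fixes \<C> :: "('a::euclidean_space \<times> real) set set"
  assumes "finite (complex_boundary X \<C>)"
    and dim: "\<And>F. F \<in> complex_boundary X \<C> \<Longrightarrow> F \<noteq> {} \<Longrightarrow> 1 \<le> dim F \<and> dim F \<le> DIM('a)"
  shows "angle_char X \<C> = (\<Sum>F\<in>complex_boundary X \<C> - {{}}. (-1) ^ (dim F - 1) * face_angle X F \<C>)"
proof -
  let ?S = "complex_boundary X \<C> - {{}}"
  let ?f = "\<lambda>F. (-1) ^ (dim F - 1) * face_angle X F \<C>"
  have S: "{F. F \<in> complex_boundary X \<C> \<and> cell_dim F = int i} = {F \<in> ?S. dim F - 1 = i}" for i
  proof (intro equalityI subsetI)
    fix F assume F: "F \<in> {F. F \<in> complex_boundary X \<C> \<and> cell_dim F = int i}"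
    have "cell_dim ({} :: ('a \<times> real) set) = - 1"
      by (simp add: cell_dim_def)
    with F have "F \<noteq> {}"
      by auto
    with F show "F \<in> {F \<in> ?S. dim F - 1 = i}"
      by (auto simp: cell_dim_def)
  next
    fix F assume "F \<in> {F \<in> ?S. dim F - 1 = i}"
    then show "F \<in> {F. F \<in> complex_boundary X \<C> \<and> cell_dim F = int i}"
      using dim[of F] by (auto simp: cell_dim_def)
  qed
  have "angle_char X \<C> = (\<Sum>i<DIM('a). \<Sum>F\<in>{F \<in> ?S. dim F - 1 = i}. ?f F)"
    unfolding angle_char_def angle_sum_def S sum_distrib_left
    by (intro sum.cong) auto
  also have "\<dots> = (\<Sum>F\<in>?S. ?f F)"
  proof (rule sum.group)
    show "(\<lambda>F. dim F - 1) ` ?S \<subseteq> {..<DIM('a)}"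
    proof (rule image_subsetI)
      fix F assume "F \<in> ?S"
      then have "1 \<le> dim F \<and> dim F \<le> DIM('a)"
        using dim by blast
      then show "dim F - 1 \<in> {..<DIM('a)}"
        unfolding lessThan_iff by linarith
    qed
  qed (use assms(1) in auto)
  finally show ?thesis .
qed

text \<open>The assumption that the common cells lie in the interior of \<open>\<C>\<close> excludes
  a part of the complement of \<open>\<C>\<close> that touches the spheres, say in a single vertex.
  At such a vertex the angles in \<open>\<A>\<close> and \<open>\<B>\<close> would add up to less
  than 1.\<close>

theorem proposition4p4p4:
  fixes X :: geometry and \<A> \<B> \<C> :: "('a::euclidean_space \<times> real) set set" and m :: nat
  assumes "geometric_complex X \<A>" and "geometric_complex X \<B>"
    and "is_gluing X \<C> \<A> \<B>"
    and "union_of_disjoint_spheres m (\<Union>(\<A> \<inter> \<B>))"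
    and "\<Union>(\<A> \<inter> \<B>) \<subseteq> complex_interior X \<C>"
    and "gram_relation X \<A>" and "gram_relation X \<B>"
  shows "angle_char X \<C> =
    (2 - real m) * (-1) ^ (DIM('a) - 1)
      + curvature_power X DIM('a) * (1 + (-1) ^ DIM('a)) * normalized_volume X \<C> - real m"
proof -
  note A = assms(1) and B = assms(2)
  have C: "\<C> = \<A> \<union> \<B>" and AB: "\<Union>\<A> \<inter> \<Union>\<B> = \<Union>(\<A> \<inter> \<B>)"
    and bdA: "\<A> \<inter> \<B> \<subseteq> complex_boundary X \<A>" and bdB: "\<A> \<inter> \<B> \<subseteq> complex_boundary X \<B>"
    using assms(3) by (auto simp: is_gluing_def)
  \<comment> \<open>The reversed forms let the asymmetric gluing lemmas be applied with
    \<open>\<A>\<close> and \<open>\<B>\<close> exchanged.\<close>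
  have C': "\<Union>\<C> = \<Union>\<A> \<union> \<Union>\<B>" "\<Union>\<C> = \<Union>\<B> \<union> \<Union>\<A>" and AB': "\<Union>\<B> \<inter> \<Union>\<A> = \<Union>(\<B> \<inter> \<A>)"
    using C AB by auto
  have fin: "finite \<A>" "finite \<B>" "finite \<C>"
    using A B C by (auto simp: geometric_complex_def)
  define w where "w = (\<lambda>(\<D> :: ('a \<times> real) set set) F. (-1) ^ (dim F - 1) * face_angle X F \<D>)"
  let ?I = "\<A> \<inter> \<B> - {{}}"
  let ?A = "complex_boundary X \<A> - {{}}" and ?B = "complex_boundary X \<B> - {{}}"
  have bd: "complex_boundary X \<D> \<subseteq> \<D>" for \<D>
    by (auto simp: complex_boundary_def)
  have finbd: "finite ?A" "finite ?B"
    using fin bd[of \<A>] bd[of \<B>] by (auto intro: finite_subset)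
  have bdC: "complex_boundary X \<C> - {{}} = (?A - \<B>) \<union> (?B - \<A>)"
  proof (intro equalityI subsetI)
    fix F assume F: "F \<in> complex_boundary X \<C> - {{}}"
    then have F': "F \<in> \<A> \<union> \<B>" "F \<inter> complex_interior X \<C> = {}" "F \<noteq> {}"
      using C by (auto simp: complex_boundary_def)
    then have "F \<notin> \<A> \<inter> \<B>"
      using assms(5) by blast
    with F' gluing_boundary_iff[OF A B C'(1) AB, of F] gluing_boundary_iff[OF B A C'(2) AB', of F]
    show "F \<in> (?A - \<B>) \<union> (?B - \<A>)"
      unfolding complex_boundary_def by blast
  next
    fix F assume "F \<in> (?A - \<B>) \<union> (?B - \<A>)"
    then show "F \<in> complex_boundary X \<C> - {{}}"
      using gluing_boundary_iff[OF A B C'(1) AB, of F] gluing_boundary_iff[OF B A C'(2) AB', of F] C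
      unfolding complex_boundary_def by blast
  qed
  have char: "angle_char X \<D> = (\<Sum>F\<in>complex_boundary X \<D> - {{}}. w \<D> F)" if D: "geometric_complex X \<D>" for \<D>
    unfolding w_def
  proof (rule angle_char_eq)
    show "finite (complex_boundary X \<D>)"
      using D finite_subset[OF bd] by (auto simp: geometric_complex_def)
  qed (use boundary_cell_dim[OF D] in blast)
  have "angle_char X \<C> = (\<Sum>F\<in>complex_boundary X \<C> - {{}}. w \<C> F)"
    unfolding w_def
  proof (rule angle_char_eq)
    show "finite (complex_boundary X \<C>)"
      using finite_subset[OF bd fin(3)] .
    fix F assume "F \<in> complex_boundary X \<C>" "F \<noteq> {}"
    then have "F \<in> complex_boundary X \<A> \<or> F \<in> complex_boundary X \<B>"
      using bdC by blast
    then show "1 \<le> dim F \<and> dim F \<le> DIM('a)"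
      using boundary_cell_dim[OF A _ \<open>F \<noteq> {}\<close>] boundary_cell_dim[OF B _ \<open>F \<noteq> {}\<close>] by blast
  qed
  also have "\<dots> = (\<Sum>F\<in>?A - \<B>. w \<C> F) + (\<Sum>F\<in>?B - \<A>. w \<C> F)"
    unfolding bdC using finbd bd[of \<A>] bd[of \<B>] by (intro sum.union_disjoint) auto
  also have "(\<Sum>F\<in>?A - \<B>. w \<C> F) = (\<Sum>F\<in>?A - \<B>. w \<A> F)"
    using gluing_face_angle[OF A B C'(1) AB] bd[of \<A>] by (intro sum.cong) (auto simp: w_def)
  also have "(\<Sum>F\<in>?B - \<A>. w \<C> F) = (\<Sum>F\<in>?B - \<A>. w \<B> F)"
    using gluing_face_angle[OF B A C'(2) AB'] bd[of \<B>] by (intro sum.cong) (auto simp: w_def)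
  finally have charC: "angle_char X \<C> = (\<Sum>F\<in>?A - \<B>. w \<A> F) + (\<Sum>F\<in>?B - \<A>. w \<B> F)" .
  have "?A = (?A - \<B>) \<union> ?I" "?B = (?B - \<A>) \<union> ?I"
    using bdA bdB bd[of \<A>] bd[of \<B>] by blast+
  then have "(\<Sum>F\<in>?A. w \<A> F) = (\<Sum>F\<in>?A - \<B>. w \<A> F) + (\<Sum>F\<in>?I. w \<A> F)"
    "(\<Sum>F\<in>?B. w \<B> F) = (\<Sum>F\<in>?B - \<A>. w \<B> F) + (\<Sum>F\<in>?I. w \<B> F)"
    using finbd fin sum.union_disjoint[of "?A - \<B>" ?I "w \<A>"] sum.union_disjoint[of "?B - \<A>" ?I "w \<B>"]
    by auto
  with char[OF A] char[OF B] charC have AB_char: "angle_char X \<A> + angle_char X \<B> = angle_char X \<C> + (\<Sum>F\<in>?I. w \<A> F + w \<B> F)"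
    by (simp add: sum.distrib)
  have disj: "complex_interior X \<A> \<inter> complex_interior X \<B> = {}"
  proof (rule ccontr)
    assume "complex_interior X \<A> \<inter> complex_interior X \<B> \<noteq> {}"
    then obtain x where x: "x \<in> complex_interior X \<A>" "x \<in> complex_interior X \<B>"
      by blast
    then have "x \<in> \<Union>(\<A> \<inter> \<B>)"
      using complex_interior_subset AB by blast
    then obtain F where "F \<in> complex_boundary X \<A>" "x \<in> F"
      using bdA by blast
    with x(1) show False
      by (auto simp: complex_boundary_def)
  qed
  have "(\<Sum>F\<in>?I. w \<A> F + w \<B> F) = (\<Sum>F\<in>?I. (-1) ^ (dim F - 1))"
  proof (rule sum.cong[OF refl])
    fix F assume F: "F \<in> ?I"
    have "face_angle X F \<A> + face_angle X F \<B> = 1"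
    proof (rule face_angles_complementary[OF A B complex_cell[OF A] _ disj])
      fix p assume "p \<in> cell_rel_interior X F"
      then have "p \<in> F"
        by (auto simp: cell_rel_interior_def interior_of_def)
      then have "p \<in> complex_interior X \<C>"
        using F assms(5) by blast
      then show "\<exists>W. open W \<and> p \<in> W \<and> model_space X \<inter> W \<subseteq> \<Union>\<A> \<union> \<Union>\<B>"
        unfolding complex_interior_iff C'(1) by blast
    qed (use F in auto)
    then show "w \<A> F + w \<B> F = (-1) ^ (dim F - 1)"
      by (simp add: w_def flip: distrib_left)
  qed
  also have "\<dots> = real m * (1 - (-1) ^ DIM('a))"
  proof -
    \<comment> \<open>The Euler characteristic of one and the same space is computed from its cells
      and from its topological type; uniqueness equates the results.\<close>
    have "(\<Sum>F\<in>?I. (-1::int) ^ (dim F - 1)) = int m * (1 - (-1) ^ DIM('a))"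
      using has_euler_unique euler_sum_common_subcomplex[OF A B] has_euler_disjoint_spheres[OF assms(4)] by blast
    then have "real_of_int (\<Sum>F\<in>?I. (-1) ^ (dim F - 1)) = real_of_int (int m * (1 - (-1) ^ DIM('a)))"
      by simp
    then show ?thesis
      by simp
  qed
  finally have "angle_char X \<C> = angle_char X \<A> + angle_char X \<B> - real m * (1 - (-1) ^ DIM('a))"
    using AB_char by simp
  moreover have "normalized_volume X \<C> = normalized_volume X \<A> + normalized_volume X \<B>"
  proof (rule normalized_volume_gluing[OF A B C'(1)])
    show "\<Union>\<A> \<inter> \<Union>\<B> \<inter> complex_interior X \<A> = {}"
      using AB bdA unfolding complex_boundary_def by blast
  qed
  \<comment> \<open>Rewrites the contribution of the spheres as
    \<open>m * (1 + (-1) ^ (d - 1))\<close>, to be merged with the two copies of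
    \<open>(-1) ^ (d - 1)\<close> from the Gram relations.\<close>
  moreover have "(-1::real) ^ DIM('a) = - ((-1) ^ (DIM('a) - 1))"
    using DIM_positive[where 'a = 'a] by (cases "DIM('a)") auto
  ultimately show ?thesis
    using assms(6,7) unfolding gram_relation_def by (simp add: algebra_simps)
qed

end
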